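(* Let $d\ge1$, $a,b>0$, and $\Lambda=a\mathbb{Z}^d\times b\mathbb{Z}^d$. Let $\sigma\in\mathcal{S}'(\mathbb{R}^{2d})$ with $\operatorname{supp}\hat\sigma\subseteq Q_\varepsilon=[-\frac{1}{2a}+\varepsilon,\frac{1}{2a}-\varepsilon]^d\times[-\frac{1}{2b}+\varepsilon,\frac{1}{2b}-\varepsilon]^d$ for some $\varepsilon>0$, and let $g\in\mathcal{S}(\mathbb{R}^d)$. Choose $\varphi\in C_c^\infty(\mathbb{R}^{2d})$ such that $\varphi=1$ on $Q_\varepsilon$ and $\operatorname{supp}\varphi\subseteq[-\frac{1}{2a},\frac{1}{2a}]^d\times[-\frac{1}{2b},\frac{1}{2b}]^d$, and assume that $\overline{\mathcal{U}V_gg}$ does not vanish on $\operatorname{supp}\varphi$. Then $\sigma$ can be reconstructed from the numbers $H_{\lambda,\lambda}=\langle\sigma^{KN}\pi(\lambda)g,\pi(\lambda)g\rangle$, $\lambda\in\Lambda$, via $$\sigma=(ab)^d\sum_{\lambda\in\Lambda}H_{\lambda,\lambda}\,T_\lambda\mathcal{F}^{-1}\left(\frac{\varphi}{\overline{\mathcal{U}V_gg}}\right),$$ with convergence in the sense of (tempered) distributions.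
   Context: The Fourier transform is $\mathcal{F}f(\xi)=\hat f(\xi)=\int f(x)e^{-2\pi i\xi\cdot x}\,dx$, extended to tempered distributions. For $z=(x,\xi)\in\mathbb{R}^{2d}$, $\pi(z)f(t)=e^{2\pi i\xi\cdot t}f(t-x)$ for functions $f$ on $\mathbb{R}^d$. For $\lambda\in\mathbb{R}^{2d}$, $T_\lambda F(z)=F(z-\lambda)$ for functions $F$ on $\mathbb{R}^{2d}$. The short-time Fourier transform is $V_gf(x,\xi)=\int f(t)\overline{g(t-x)}e^{-2\pi i\xi\cdot t}\,dt$, and $\mathcal{U}F(\xi,x)=F(-x,\xi)$ for $x,\xi\in\mathbb{R}^d$. The Rihaczek distribution is $R(f,g)(x,\xi)=f(x)\overline{\hat g(\xi)}e^{-2\pi i x\cdot\xi}$. The brackets $\langle\cdot,\cdot\rangle$ denote the extension of the $L^2$ inner product (conjugate-linear in the second argument). For $\sigma\in\mathcal{S}'(\mathbb{R}^{2d})$ the pseudodifferential operator $\sigma^{KN}:\mathcal{S}(\mathbb{R}^d)\to\mathcal{S}'(\mathbb{R}^d)$ with Kohn-Nirenberg symbol $\sigma$ is defined by $\langle\sigma^{KN}f,g\rangle=\langle\sigma,R(g,f)\rangle$ for $f,g\in\mathcal{S}(\mathbb{R}^d)$. The quotient $\varphi/\overline{\mathcal{U}V_gg}$ is understood to be $0$ outside $\operatorname{supp}\varphi$.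
   Formalization: The formal statement additionally assumes ε ≠ 1/(2a) and ε ≠ 1/(2b); if a side of Q_ε collapses to a point the claim fails, e.g. a=b=1, ε=1/2, σ̂ a first derivative of δ₀, φ(0)=1 with nonzero derivative at 0. *)

theory Defs
  imports "HOL-Analysis.Analysis"
begin

primrec iter_deriv ::
    "'a::euclidean_space list \<Rightarrow> ('a \<Rightarrow> complex) \<Rightarrow> 'a \<Rightarrow> complex" where
  "iter_deriv [] f = f"
| "iter_deriv (v # vs) f = (\<lambda>x. frechet_derivative (iter_deriv vs f) (at x) v)"

text \<open>
  A list of basis vectors plays the role of a multi-index. If every iterated partial derivative
  is (totally) differentiable everywhere, then each of them is continuous, so this is \<open>C\<^sup>\<infinity>\<close>.
\<close>

definition smooth :: "('a::euclidean_space \<Rightarrow> complex) \<Rightarrow> bool" where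
  "smooth f \<longleftrightarrow> (\<forall>vs. set vs \<subseteq> Basis \<longrightarrow> (\<forall>x. iter_deriv vs f differentiable (at x)))"

definition fun_support :: "('a::euclidean_space \<Rightarrow> complex) \<Rightarrow> 'a set" where
  "fun_support f = closure {x. f x \<noteq> 0}"

definition test_function :: "('a::euclidean_space \<Rightarrow> complex) \<Rightarrow> bool" where
  "test_function f \<longleftrightarrow> smooth f \<and> compact (fun_support f)"

definition schwartz :: "('a::euclidean_space \<Rightarrow> complex) \<Rightarrow> bool" where
  "schwartz f \<longleftrightarrow> smooth f \<and>
     (\<forall>k vs. set vs \<subseteq> Basis \<longrightarrow> bdd_above (range (\<lambda>x. norm x ^ k * cmod (iter_deriv vs f x))))"

definition schwartz_seminorm ::
    "nat \<Rightarrow> 'a::euclidean_space list \<Rightarrow> ('a \<Rightarrow> complex) \<Rightarrow> real" where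
  "schwartz_seminorm k vs f = (SUP x. norm x ^ k * cmod (iter_deriv vs f x))"

text \<open>The locally convex (Frechet) topology on the Schwartz space defined by these seminorms.\<close>

definition schwartz_topology :: "('a::euclidean_space \<Rightarrow> complex) topology" where
  "schwartz_topology = topology_generated_by
     {{f. schwartz f \<and> schwartz_seminorm k vs (\<lambda>x. f x - h x) < r} | k vs h r.
        set vs \<subseteq> Basis \<and> schwartz h \<and> 0 < r}"

text \<open>
  Distributions are linear functionals. Only their values on Schwartz functions are meaningful;
  the value of such a HOL function elsewhere is irrelevant.
\<close>

type_synonym 'a functional = "('a \<Rightarrow> complex) \<Rightarrow> complex"

definition tempered_distribution :: "'a::euclidean_space functional \<Rightarrow> bool" where
  "tempered_distribution u \<longleftrightarrow>
     (\<forall>f h. schwartz f \<longrightarrow> schwartz h \<longrightarrow> u (\<lambda>x. f x + h x) = u f + u h) \<and>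
     (\<forall>c f. schwartz f \<longrightarrow> u (\<lambda>x. c * f x) = c * u f) \<and>
     continuous_map schwartz_topology euclidean u"

text \<open>
  The sesquilinear bracket extending the \<open>L\<^sup>2\<close> inner product, conjugate-linear in the second
  argument.
\<close>

definition bracket :: "'a::euclidean_space functional \<Rightarrow> ('a \<Rightarrow> complex) \<Rightarrow> complex" where
  "bracket u f = u (\<lambda>x. cnj (f x))"

definition distr_of :: "('a::euclidean_space \<Rightarrow> complex) \<Rightarrow> 'a functional" where
  "distr_of F = (\<lambda>f. LINT x|lborel. F x * f x)"

definition distr_support :: "'a::euclidean_space functional \<Rightarrow> 'a set" where
  "distr_support u =
     - \<Union>{U. open U \<and> (\<forall>f. test_function f \<and> fun_support f \<subseteq> U \<longrightarrow> u f = 0)}"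

definition fourier :: "('a::euclidean_space \<Rightarrow> complex) \<Rightarrow> 'a \<Rightarrow> complex" where
  "fourier f \<xi> = (LINT x|lborel. f x * cis (- 2 * pi * (\<xi> \<bullet> x)))"

definition inverse_fourier :: "('a::euclidean_space \<Rightarrow> complex) \<Rightarrow> 'a \<Rightarrow> complex" where
  "inverse_fourier f x = (LINT \<xi>|lborel. f \<xi> * cis (2 * pi * (\<xi> \<bullet> x)))"

definition fourier_distr :: "'a::euclidean_space functional \<Rightarrow> 'a functional" where
  "fourier_distr u = (\<lambda>f. u (fourier f))"

text \<open>
  Convergence of a series of distributions, tested on each Schwartz function. The sum over the
  index set is unordered (unconditional convergence).
\<close>

definition has_distr_sum ::
    "('i \<Rightarrow> 'a::euclidean_space functional) \<Rightarrow> 'a functional \<Rightarrow> 'i set \<Rightarrow> bool" where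
  "has_distr_sum T u I \<longleftrightarrow> (\<forall>f. schwartz f \<longrightarrow> ((\<lambda>i. T i f) has_sum u f) I)"

text \<open>
  Phase space \<open>\<real>\<^sup>2\<^sup>d\<close> is the product \<^typ>\<open>(real ^ 'd) \<times> (real ^ 'd)\<close>, whose inner product and
  Lebesgue measure are the usual product ones.
\<close>

definition tf_shift ::
    "(real ^ 'd) \<times> (real ^ 'd) \<Rightarrow> (real ^ 'd \<Rightarrow> complex) \<Rightarrow> real ^ 'd \<Rightarrow> complex" where
  "tf_shift z f t = (case z of (x, \<xi>) \<Rightarrow> cis (2 * pi * (\<xi> \<bullet> t)) * f (t - x))"

definition translate :: "'a::euclidean_space \<Rightarrow> ('a \<Rightarrow> complex) \<Rightarrow> 'a \<Rightarrow> complex" where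
  "translate l F z = F (z - l)"

definition stft ::
    "(real ^ 'd \<Rightarrow> complex) \<Rightarrow> (real ^ 'd \<Rightarrow> complex) \<Rightarrow> (real ^ 'd) \<times> (real ^ 'd) \<Rightarrow> complex" where
  "stft g f = (\<lambda>(x, \<xi>). LINT t|lborel. f t * cnj (g (t - x)) * cis (- 2 * pi * (\<xi> \<bullet> t)))"

definition flip_map ::
    "((real ^ 'd) \<times> (real ^ 'd) \<Rightarrow> complex) \<Rightarrow> (real ^ 'd) \<times> (real ^ 'd) \<Rightarrow> complex" where
  "flip_map F = (\<lambda>(\<xi>, x). F (- x, \<xi>))"

definition rihaczek ::
    "(real ^ 'd \<Rightarrow> complex) \<Rightarrow> (real ^ 'd \<Rightarrow> complex) \<Rightarrow> (real ^ 'd) \<times> (real ^ 'd) \<Rightarrow> complex" where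
  "rihaczek f g = (\<lambda>(x, \<xi>). f x * cnj (fourier g \<xi>) * cis (- 2 * pi * (x \<bullet> \<xi>)))"

text \<open>
  Since the functional is recovered from the bracket by \<open>u h = \<langle>u, cnj h\<rangle>\<close>, the conjugation below
  is exactly what makes \<open>\<langle>\<sigma>\<^sup>K\<^sup>N f, g\<rangle> = \<langle>\<sigma>, R(g, f)\<rangle>\<close> hold.
\<close>

definition kohn_nirenberg ::
    "((real ^ 'd) \<times> (real ^ 'd)) functional \<Rightarrow> (real ^ 'd \<Rightarrow> complex) \<Rightarrow> (real ^ 'd) functional" where
  "kohn_nirenberg \<sigma> f = (\<lambda>h. bracket \<sigma> (rihaczek (\<lambda>t. cnj (h t)) f))"

lemma bracket_kohn_nirenberg:
  "bracket (kohn_nirenberg \<sigma> f) g = bracket \<sigma> (rihaczek g f)"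
  by (simp add: bracket_def kohn_nirenberg_def)

definition lattice :: "real \<Rightarrow> real \<Rightarrow> ((real ^ 'd) \<times> (real ^ 'd)) set" where
  "lattice a b = {(a *\<^sub>R k, b *\<^sub>R l) | k l. (\<forall>i. k $ i \<in> \<int>) \<and> (\<forall>i. l $ i \<in> \<int>)}"

text \<open>
  Pitfall: if \<open>\<epsilon>\<close> equals \<open>1 / (2a)\<close> or \<open>1 / (2b)\<close>, a side of the box can collapse to a point and the
  box then has no interior. A smooth \<open>\<phi>\<close> equal to \<open>1\<close> on such a box need not satisfy \<open>\<phi> u = u\<close> for
  distributions \<open>u\<close> supported there (e.g. derivatives of the Dirac distribution), so statements
  about cutoffs have to exclude these two values.
\<close>

definition Q_box :: "real \<Rightarrow> real \<Rightarrow> real \<Rightarrow> ((real ^ 'd) \<times> (real ^ 'd)) set" where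
  "Q_box a b \<epsilon> =
     {(x, \<xi>). (\<forall>i. x $ i \<in> {- 1 / (2 * a) + \<epsilon> .. 1 / (2 * a) - \<epsilon>}) \<and>
               (\<forall>i. \<xi> $ i \<in> {- 1 / (2 * b) + \<epsilon> .. 1 / (2 * b) - \<epsilon>})}"

definition support_quotient ::
    "('a::euclidean_space \<Rightarrow> complex) \<Rightarrow> ('a \<Rightarrow> complex) \<Rightarrow> 'a \<Rightarrow> complex" where
  "support_quotient F G = (\<lambda>z. if z \<in> fun_support F then F z / G z else 0)"

end

theory Submission
  imports Defs "HOL-Probability.Characteristic_Functions" "HOL-Probability.Sinc_Integral"
begin

text \<open>
  Put \<open>u = \<F>\<sigma>\<close>, \<open>S = cnj R(g, g)\<close>, \<open>E = \<F>\<inverse>S\<close> and \<open>e\<^sub>\<lambda>(w) = exp(2\<pi>i \<lambda>\<bullet>w)\<close>. The Rihaczek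
  distribution is covariant under time-frequency shifts (\<open>rihaczek_tf_shift\<close>), so the numbers
  \<open>H\<^sub>\<lambda>\<^sub>,\<^sub>\<lambda> = \<sigma>(T\<^sub>\<lambda>S) = u(E e\<^sub>\<lambda>)\<close> are samples of a smoothing of \<open>\<sigma>\<close> by a fixed Schwartz function. The
  Fourier transform of \<open>R(g, g)\<close> is \<open>\<U>V\<^sub>gg\<close> (\<open>fourier_rihaczek\<close>), hence \<open>E = cnj \<U>V\<^sub>gg\<close> and the quotient in the
  statement is \<open>\<Phi> = \<phi>/E\<close>: on the support of \<open>u\<close> it undoes the multiplication by \<open>E\<close>.

  Test the series on a Schwartz function \<open>f\<close> and put \<open>h = \<F>\<inverse>f\<close>. Pairing \<open>T\<^sub>\<lambda>\<F>\<inverse>\<Phi>\<close> with \<open>f\<close> gives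
  \<open>\<F>(\<Phi>h)(\<lambda>)\<close> (\<open>pairing_translate_inverse_fourier\<close>), so the series is \<open>\<Sum> c\<^sub>\<lambda> u(E e\<^sub>\<lambda>)\<close>, where the
  \<open>c\<^sub>\<lambda> = (ab)\<^sup>d \<F>(\<Phi>h)(\<lambda>)\<close> are the Fourier coefficients of \<open>\<Phi>h\<close> on the box
  \<open>[-1/2a, 1/2a]\<^sup>d \<times> [-1/2b, 1/2b]\<^sup>d\<close>, a fundamental domain of the lattice dual to \<open>\<Lambda>\<close>. Since \<open>\<Phi>h\<close> is a
  Schwartz function, the coefficients decay rapidly; \<open>p = \<Sum> c\<^sub>\<lambda> e\<^sub>\<lambda>\<close> then converges uniformly with all
  derivatives, the partial sums of \<open>E p\<close> converge in the Schwartz space, and continuity of \<open>\<sigma>\<close> makes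
  the sum equal to \<open>u(E p)\<close>.

  Inside the box \<open>p = \<Phi>h\<close> (\<open>fourier_series\<close>), because \<open>\<Phi>\<close> is supported in it. Therefore
  \<open>E p = \<phi>h = h\<close> on \<open>Q\<^sub>\<epsilon>\<close>. Outside the box \<open>p\<close> is periodic and has nothing to do with \<open>h\<close>, so all that
  is known is that \<open>E p - h\<close> vanishes on a set containing the support of \<open>u\<close>. For a box with nonempty
  interior this suffices: dilating \<open>E p - h\<close> slightly makes it vanish on a neighbourhood of the
  support (\<open>vanishing_on_support\<close>). If the box is empty, \<open>u\<close> is zero. So the sum is \<open>u(h) = \<sigma>(\<F>\<F>\<inverse>f) = \<sigma>(f)\<close>.

  The analytic estimates are made for families of functions with a common bound. The same lemmas then
  give membership in the Schwartz space, when the bounds are constants, and convergence in it, when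
  the bounds tend to \<open>0\<close>.
\<close>

section \<open>Families of functions with controlled derivatives\<close>

abbreviation deriv_at :: "('a::euclidean_space \<Rightarrow> complex) \<Rightarrow> 'a \<Rightarrow> 'a \<Rightarrow> complex" where
  "deriv_at f x \<equiv> frechet_derivative f (at x)"

text \<open>
  \<open>reg P n f\<close>: every partial derivative of order at most \<open>n\<close> of the members of the family \<open>f\<close> exists, is
  (below order \<open>n\<close>) differentiable, and as a family satisfies \<open>P\<close>. The recursion differentiates first and
  then descends, so closure properties of \<open>reg\<close> follow by induction on \<open>n\<close> from the product or chain
  rule, whereas \<open>iter_deriv\<close> differentiates last.
\<close>

primrec reg ::
    "(('i \<Rightarrow> 'a::euclidean_space \<Rightarrow> complex) \<Rightarrow> bool) \<Rightarrow> nat \<Rightarrow> ('i \<Rightarrow> 'a \<Rightarrow> complex) \<Rightarrow> bool" where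
  "reg P 0 f = P f"
| "reg P (Suc n) f = (P f \<and> (\<forall>i x. f i differentiable (at x)) \<and>
     (\<forall>b\<in>Basis. reg P n (\<lambda>i x. deriv_at (f i) x b)))"

lemma reg_imp: "reg P n f \<Longrightarrow> P f"
  by (cases n) auto

lemma reg_SucI:
  assumes "P f" "\<And>i x. (f i has_derivative f' i x) (at x)"
    and "\<And>b. b \<in> Basis \<Longrightarrow> reg P n (\<lambda>i x. f' i x b)"
  shows "reg P (Suc n) f"
proof -
  have "deriv_at (f i) x = f' i x" for i x
    using frechet_derivative_at[OF assms(2)] by simp
  then show ?thesis
    using assms(1,3) differentiableI[OF assms(2)] by simp
qed

lemma reg_SucD:
  assumes "reg P (Suc n) f"
  shows "reg P n f"
  using assms
proof (induction n arbitrary: f)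
  case (Suc n)
  then show ?case by (simp only: reg.simps(2)[of P "Suc n"] reg.simps(2)[of P n]) blast
qed auto

lemma reg_mono: "(\<And>f. P f \<Longrightarrow> Q f) \<Longrightarrow> reg P n f \<Longrightarrow> reg Q n f"
  by (induction n arbitrary: f) auto

lemma reg_has_derivative:
  "reg P (Suc n) f \<Longrightarrow> (f i has_derivative deriv_at (f i) x) (at x)"
  by (simp add: frechet_derivative_works)

text \<open>
  \<open>iter_deriv\<close> applies the head of its list last. Moving the innermost derivative to the end of the
  list matches the recursion of \<open>reg\<close>.
\<close>

lemma iter_deriv_snoc:
  "iter_deriv (vs @ [b]) f = iter_deriv vs (\<lambda>x. deriv_at f x b)"
  by (induction vs) auto

lemma reg_iter_deriv:
  assumes "reg P (length vs + n) f" "set vs \<subseteq> Basis"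
  shows "reg P n (\<lambda>i. iter_deriv vs (f i))"
  using assms
proof (induction vs arbitrary: f rule: rev_induct)
  case (snoc b vs)
  then have "reg P (length vs + n) (\<lambda>i x. deriv_at (f i) x b)"
    by auto
  with snoc show ?case by (simp add: iter_deriv_snoc)
qed auto

lemma reg_if_iter_deriv:
  fixes f :: "'i \<Rightarrow> 'a::euclidean_space \<Rightarrow> complex"
  assumes "\<And>vs. set vs \<subseteq> Basis \<Longrightarrow>
    P (\<lambda>i. iter_deriv vs (f i)) \<and> (\<forall>i x. iter_deriv vs (f i) differentiable (at x))"
  shows "reg P n f"
  using assms
proof (induction n arbitrary: f)
  case 0
  from 0[of "[]"] show ?case by simp
next
  case (Suc n)
  have "reg P n (\<lambda>i x. deriv_at (f i) x b)" if "b \<in> Basis" for b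
  proof (rule Suc.IH)
    fix vs assume "set vs \<subseteq> (Basis::'a set)"
    then show "P (\<lambda>i. iter_deriv vs (\<lambda>x. deriv_at (f i) x b)) \<and>
      (\<forall>i x. iter_deriv vs (\<lambda>x. deriv_at (f i) x b) differentiable at x)"
      using Suc.prems[of "vs @ [b]"] that by (simp add: iter_deriv_snoc)
  qed
  then show ?case using Suc.prems[of "[]"] by simp
qed

lemma smooth_iff_reg: "smooth f \<longleftrightarrow> (\<forall>n. reg (\<lambda>_. True) n (\<lambda>_::unit. f))"
proof
  assume "smooth f"
  then show "\<forall>n. reg (\<lambda>_. True) n (\<lambda>_::unit. f)"
    by (auto simp: smooth_def intro!: reg_if_iter_deriv)
next
  assume R: "\<forall>n. reg (\<lambda>_. True) n (\<lambda>_::unit. f)"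
  have "reg (\<lambda>_. True) 1 (\<lambda>_::unit. iter_deriv vs f)" if "set vs \<subseteq> Basis" for vs
    by (rule reg_iter_deriv[OF _ that, where f="\<lambda>_. f"]) (use R in blast)
  then show "smooth f" by (auto simp: smooth_def)
qed

lemma reg_add:
  assumes "reg P n f" "reg P n g" "\<And>f g. P f \<Longrightarrow> P g \<Longrightarrow> P (\<lambda>i x. f i x + g i x)"
  shows "reg P n (\<lambda>i x. f i x + g i x)"
  using assms(1,2)
proof (induction n arbitrary: f g)
  case (Suc n)
  show ?case
    by (rule reg_SucI, (use Suc.prems assms(3) in auto)[1],
        rule has_derivative_add[OF reg_has_derivative[OF Suc.prems(1)] reg_has_derivative[OF Suc.prems(2)]],
        rule Suc.IH) (use Suc.prems in auto)
qed (use assms(3) in auto)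

lemma reg_mult:
  assumes "reg P n f" "reg Q n g"
    and "\<And>f g. P f \<Longrightarrow> Q g \<Longrightarrow> R (\<lambda>i x. f i x * g i x)"
    and "\<And>f g. R f \<Longrightarrow> R g \<Longrightarrow> R (\<lambda>i x. f i x + g i x)"
  shows "reg R n (\<lambda>i x. f i x * g i x)"
  using assms(1,2)
proof (induction n arbitrary: f g)
  case (Suc n)
  show ?case
  proof (rule reg_SucI)
    show "R (\<lambda>i x. f i x * g i x)" using Suc.prems assms(3) by auto
  next
    fix b :: 'b assume "b \<in> Basis"
    then have "reg P n (\<lambda>i x. deriv_at (f i) x b)"
      "reg Q n (\<lambda>i x. deriv_at (g i) x b)"
      using Suc.prems by auto
    moreover have "reg P n f" "reg Q n g"
      using Suc.prems by (auto intro: reg_SucD)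
    ultimately show "reg R n (\<lambda>i x. f i x * deriv_at (g i) x b
        + deriv_at (f i) x b * g i x)"
      by (intro reg_add Suc.IH assms(4))
  qed (intro has_derivative_mult reg_has_derivative[OF Suc.prems(1)] reg_has_derivative[OF Suc.prems(2)])
qed (use assms(3) in auto)

text \<open>
  The scalar may depend on the index: multiplying a bounded family by null factors produces a null
  family, so the predicates before and after differ.
\<close>

lemma reg_scale:
  assumes "reg P n f" "\<And>f. P f \<Longrightarrow> Q (\<lambda>i x. c i * f i x)"
  shows "reg Q n (\<lambda>i x. c i * f i x)"
  using assms(1)
proof (induction n arbitrary: f)
  case (Suc n)
  show ?case
    by (rule reg_SucI, (use Suc.prems assms(2) in auto)[1],
        rule has_derivative_mult_right[OF reg_has_derivative[OF Suc.prems(1)]],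
        rule Suc.IH) (use Suc.prems in auto)
qed (use assms(2) in auto)

lemma reg_cmult:
  assumes "reg P n f" "\<And>f. P f \<Longrightarrow> P (\<lambda>i x. c * f i x)"
  shows "reg P n (\<lambda>i x. c * f i x)"
  by (rule reg_scale[where c="\<lambda>_. c" and Q=P, OF assms(1)]) (rule assms(2))

lemma reg_cnj:
  assumes "reg P n f" "\<And>f. P f \<Longrightarrow> P (\<lambda>i x. cnj (f i x))"
  shows "reg P n (\<lambda>i x. cnj (f i x))"
  using assms(1)
proof (induction n arbitrary: f)
  case (Suc n)
  show ?case
    by (rule reg_SucI, (use Suc.prems assms(2) in auto)[1],
        rule has_derivative_cnj[OF reg_has_derivative[OF Suc.prems(1)]],
        rule Suc.IH) (use Suc.prems in auto)
qed (use assms(2) in auto)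

lemma reg_dilate:
  fixes c :: real
  assumes "reg P n f" and arg: "\<And>f. P f \<Longrightarrow> P (\<lambda>i x. f i (c *\<^sub>R x))"
    and scale: "\<And>f. P f \<Longrightarrow> P (\<lambda>i x. of_real c * f i x)"
  shows "reg P n (\<lambda>i x. f i (c *\<^sub>R x))"
  using assms(1)
proof (induction n arbitrary: f)
  case (Suc n)
  note d = reg_has_derivative[OF Suc.prems]
  show ?case
  proof (rule reg_SucI)
    show "P (\<lambda>i x. f i (c *\<^sub>R x))" using Suc.prems arg by auto
  next
    fix i x
    show "((\<lambda>x. f i (c *\<^sub>R x)) has_derivative (\<lambda>h. deriv_at (f i) (c *\<^sub>R x) (c *\<^sub>R h))) (at x)"
      by (rule has_derivative_compose[where g="f i", OF _ d]) (auto intro!: derivative_eq_intros)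
  next
    fix b :: 'b assume b: "b \<in> Basis"
    have "reg P n (\<lambda>i x. of_real c * deriv_at (f i) (c *\<^sub>R x) b)"
      by (rule reg_cmult[OF Suc.IH[where f="\<lambda>i x. deriv_at (f i) x b"] scale])
        (use Suc.prems b in auto)
    then show "reg P n (\<lambda>i x. deriv_at (f i) (c *\<^sub>R x) (c *\<^sub>R b))"
      by (simp add: linear_scale[OF has_derivative_linear[OF d]] scaleR_conv_of_real)
  qed
qed (use arg in auto)

text \<open>
  A set of admissible bounds. For \<open>const_bounds\<close> the estimates below express uniform boundedness of a
  family, for \<open>null_bounds F\<close> they express uniform convergence to \<open>0\<close> along the filter \<open>F\<close>.
\<close>

definition bound_class :: "('i \<Rightarrow> real) set \<Rightarrow> bool" where
  "bound_class \<B> \<longleftrightarrow> (\<forall>A\<in>\<B>. \<forall>B\<in>\<B>. (\<lambda>i. A i + B i) \<in> \<B>) \<and> (\<forall>c. \<forall>A\<in>\<B>. (\<lambda>i. c * A i) \<in> \<B>)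
     \<and> (\<lambda>_. 0) \<in> \<B>"

definition const_bounds :: "('i \<Rightarrow> real) set" where
  "const_bounds = range (\<lambda>C _. C)"

definition null_bounds :: "'i filter \<Rightarrow> ('i \<Rightarrow> real) set" where
  "null_bounds F = {B. (B \<longlongrightarrow> 0) F}"

lemma bound_class_const: "bound_class const_bounds"
  by (auto simp: bound_class_def const_bounds_def)

lemma bound_class_null: "bound_class (null_bounds F)"
  by (auto simp: bound_class_def null_bounds_def intro: tendsto_add_zero tendsto_mult_right_zero)

lemma bound_class_add: "bound_class \<B> \<Longrightarrow> A \<in> \<B> \<Longrightarrow> B \<in> \<B> \<Longrightarrow> (\<lambda>i. A i + B i) \<in> \<B>"
  by (simp add: bound_class_def)

lemma bound_class_scale: "bound_class \<B> \<Longrightarrow> A \<in> \<B> \<Longrightarrow> (\<lambda>i. c * A i) \<in> \<B>"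
  by (simp add: bound_class_def)

lemma bound_class_zero: "bound_class \<B> \<Longrightarrow> (\<lambda>i. 0) \<in> \<B>"
  by (simp add: bound_class_def)

lemma bound_class_sum:
  assumes "bound_class \<B>" "\<And>j. j \<in> J \<Longrightarrow> A j \<in> \<B>"
  shows "(\<lambda>i. \<Sum>j\<in>J. A j i) \<in> \<B>"
  using assms(2)
  by (induction J rule: infinite_finite_induct)
    (auto simp: bound_class_zero[OF assms(1)] intro!: bound_class_add[OF assms(1)])

definition unif :: "('i \<Rightarrow> real) set \<Rightarrow> ('i \<Rightarrow> 'a \<Rightarrow> complex) \<Rightarrow> bool" where
  "unif \<B> f \<longleftrightarrow> (\<exists>B\<in>\<B>. \<forall>i x. cmod (f i x) \<le> B i)"

definition rapid :: "('i \<Rightarrow> real) set \<Rightarrow> ('i \<Rightarrow> 'a::euclidean_space \<Rightarrow> complex) \<Rightarrow> bool" where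
  "rapid \<B> f \<longleftrightarrow> (\<forall>k. unif \<B> (\<lambda>i x. of_real (norm x ^ k) * f i x))"

lemma rapidD:
  assumes "rapid \<B> f"
  obtains B where "B \<in> \<B>" "\<And>i x. norm x ^ k * cmod (f i x) \<le> B i"
proof -
  obtain B where "B \<in> \<B>" "\<And>i x. cmod (of_real (norm x ^ k) * f i x) \<le> B i"
    using assms unfolding rapid_def unif_def by blast
  with that show ?thesis by (simp add: norm_mult norm_power)
qed

lemma rapidI:
  assumes "\<And>k. \<exists>B\<in>\<B>. \<forall>i x. norm x ^ k * cmod (f i x) \<le> B i"
  shows "rapid \<B> f"
  using assms unfolding rapid_def unif_def by (auto simp: norm_mult norm_power)

lemma unif_add:
  assumes "bound_class \<B>" "unif \<B> f" "unif \<B> g"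
  shows "unif \<B> (\<lambda>i x. f i x + g i x)"
proof -
  obtain A B where "A \<in> \<B>" "\<And>i x. cmod (f i x) \<le> A i" "B \<in> \<B>" "\<And>i x. cmod (g i x) \<le> B i"
    using assms by (auto simp: unif_def)
  then show ?thesis unfolding unif_def
    by (intro bexI[of _ "\<lambda>i. A i + B i"] bound_class_add assms(1)) (auto intro: norm_triangle_mono)
qed

lemma unif_mult:
  assumes "bound_class \<B>" "unif const_bounds f" "unif \<B> g"
  shows "unif \<B> (\<lambda>i x. f i x * g i x)"
proof -
  obtain C B where C: "\<And>i x. cmod (f i x) \<le> C" and B: "B \<in> \<B>" "\<And>i x. cmod (g i x) \<le> B i"
    using assms by (auto simp: unif_def const_bounds_def)
  have "0 \<le> C" using C[of undefined undefined] norm_ge_zero[of "f undefined undefined"] by linarith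
  then show ?thesis unfolding unif_def
    by (intro bexI[of _ "\<lambda>i. C * B i"] bound_class_scale assms(1) B)
      (auto simp: norm_mult intro!: mult_mono C B)
qed

lemma unif_cmult: "bound_class \<B> \<Longrightarrow> unif \<B> f \<Longrightarrow> unif \<B> (\<lambda>i x. c * f i x)"
  by (rule unif_mult) (auto simp: unif_def const_bounds_def)

lemma rapid_add: "bound_class \<B> \<Longrightarrow> rapid \<B> f \<Longrightarrow> rapid \<B> g \<Longrightarrow> rapid \<B> (\<lambda>i x. f i x + g i x)"
  unfolding rapid_def distrib_left by (auto intro: unif_add)

lemma rapid_mult:
  "bound_class \<B> \<Longrightarrow> rapid const_bounds f \<Longrightarrow> unif \<B> g \<Longrightarrow> rapid \<B> (\<lambda>i x. f i x * g i x)"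
  unfolding rapid_def mult.assoc[symmetric] by (auto intro: unif_mult)

lemma rapid_cmult: "bound_class \<B> \<Longrightarrow> rapid \<B> f \<Longrightarrow> rapid \<B> (\<lambda>i x. c * f i x)"
  unfolding rapid_def
  using unif_cmult[of \<B> _ c] by (subst mult.left_commute) blast

lemma rapid_imp_unif: "rapid \<B> f \<Longrightarrow> unif \<B> f"
  unfolding rapid_def by (drule spec[of _ 0]) simp

lemma rapid_coord:
  assumes "rapid \<B> f" "norm b \<le> 1"
  shows "rapid \<B> (\<lambda>i x. of_real (x \<bullet> b) * f i x)"
proof (rule rapidI)
  fix k
  obtain B where B: "B \<in> \<B>" "\<And>i x. norm x ^ Suc k * cmod (f i x) \<le> B i"
    using rapidD[OF assms(1)] by metis
  have "norm x ^ k * cmod (of_real (x \<bullet> b) * f i x) \<le> B i" for i x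
  proof -
    have "\<bar>x \<bullet> b\<bar> \<le> norm x * norm b" by (rule Cauchy_Schwarz_ineq2)
    also have "\<dots> \<le> norm x" using assms(2) by (simp add: mult_left_le)
    finally have "norm x ^ k * (\<bar>x \<bullet> b\<bar> * cmod (f i x)) \<le> norm x ^ k * (norm x * cmod (f i x))"
      by (intro mult_left_mono mult_right_mono) auto
    also have "\<dots> \<le> B i" using B(2)[where i=i and x=x] by (simp add: mult_ac)
    finally show ?thesis by (simp add: norm_mult)
  qed
  with B show "\<exists>B\<in>\<B>. \<forall>i x. norm x ^ k * cmod (of_real (x \<bullet> b) * f i x) \<le> B i" by blast
qed

lemma reg_rapid_coord:
  assumes "bound_class \<B>" "b \<in> Basis" "reg (rapid \<B>) n f"
  shows "reg (rapid \<B>) n (\<lambda>i x. of_real (x \<bullet> b) * f i x)"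
  using assms(3)
proof (induction n arbitrary: f)
  case (Suc n)
  show ?case
  proof (rule reg_SucI)
    show "rapid \<B> (\<lambda>i x. of_real (x \<bullet> b) * f i x)"
      using Suc.prems assms(2) by (auto intro: rapid_coord)
  next
    fix i x
    show "((\<lambda>x. of_real (x \<bullet> b) * f i x) has_derivative
      (\<lambda>h. of_real (x \<bullet> b) * deriv_at (f i) x h + of_real (h \<bullet> b) * f i x)) (at x)"
      by (intro has_derivative_mult reg_has_derivative[OF Suc.prems] has_derivative_of_real
          has_derivative_inner_left has_derivative_ident)
  next
    fix c :: 'b assume c: "c \<in> Basis"
    show "reg (rapid \<B>) n (\<lambda>i x. of_real (x \<bullet> b) * deriv_at (f i) x c
        + of_real (c \<bullet> b) * f i x)"
      using Suc.prems c reg_SucD[OF Suc.prems]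
      by (intro reg_add reg_cmult Suc.IH rapid_add rapid_cmult assms(1)) auto
  qed
qed (use assms(2) in \<open>auto intro: rapid_coord\<close>)

text \<open>
  With constant bounds this is a bounded subset of the Schwartz space, with null bounds a family
  converging to \<open>0\<close> in its topology.
\<close>

definition schwartz_family :: "('i \<Rightarrow> real) set \<Rightarrow> ('i \<Rightarrow> 'a::euclidean_space \<Rightarrow> complex) \<Rightarrow> bool" where
  "schwartz_family \<B> f \<longleftrightarrow> (\<forall>n. reg (rapid \<B>) n f)"

lemma schwartz_family_iff:
  "schwartz_family \<B> f \<longleftrightarrow> (\<forall>vs. set vs \<subseteq> Basis \<longrightarrow>
     rapid \<B> (\<lambda>i. iter_deriv vs (f i)) \<and> (\<forall>i x. iter_deriv vs (f i) differentiable (at x)))"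
proof
  assume R: "schwartz_family \<B> f"
  have "reg (rapid \<B>) 1 (\<lambda>i. iter_deriv vs (f i))" if "set vs \<subseteq> Basis" for vs
    by (rule reg_iter_deriv[OF _ that]) (use R in \<open>unfold schwartz_family_def, blast\<close>)
  then show "\<forall>vs. set vs \<subseteq> Basis \<longrightarrow>
     rapid \<B> (\<lambda>i. iter_deriv vs (f i)) \<and> (\<forall>i x. iter_deriv vs (f i) differentiable (at x))"
    by auto
qed (auto simp: schwartz_family_def intro!: reg_if_iter_deriv)

lemma rapid_const_iff:
  "rapid const_bounds (\<lambda>_. f) \<longleftrightarrow> (\<forall>k. bdd_above (range (\<lambda>x. norm x ^ k * cmod (f x))))"
  by (auto simp: rapid_def unif_def const_bounds_def bdd_above_def norm_mult norm_power)

text \<open>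
  The index type of the constant family is arbitrary here, while the converse fixes it to \<open>unit\<close>, so that no
  type variable occurs only in a premise.
\<close>

lemma schwartz_family_constI: "schwartz f \<Longrightarrow> schwartz_family const_bounds (\<lambda>_. f)"
  unfolding schwartz_family_iff rapid_const_iff schwartz_def smooth_def by auto

lemma schwartz_familyD: "schwartz_family const_bounds (\<lambda>_::unit. f) \<Longrightarrow> schwartz f"
  unfolding schwartz_family_iff rapid_const_iff schwartz_def smooth_def by auto

lemma rapid_member: "rapid \<B> f \<Longrightarrow> rapid const_bounds (\<lambda>_. f i)"
  unfolding rapid_def unif_def const_bounds_def by (metis rangeI)

lemma schwartz_family_member: "schwartz_family \<B> f \<Longrightarrow> schwartz (f i)"
  by (rule schwartz_familyD) (auto simp: schwartz_family_iff intro: rapid_member)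

lemma schwartz_family_seminorm:
  fixes f :: "'i \<Rightarrow> 'a::euclidean_space \<Rightarrow> complex"
  assumes "schwartz_family \<B> f" "set vs \<subseteq> Basis"
  obtains B where "B \<in> \<B>" "\<And>i. 0 \<le> schwartz_seminorm k vs (f i)" "\<And>i. schwartz_seminorm k vs (f i) \<le> B i"
proof -
  have "rapid \<B> (\<lambda>i. iter_deriv vs (f i))"
    using assms by (simp add: schwartz_family_iff)
  then obtain B where B: "B \<in> \<B>" "\<And>i x. norm x ^ k * cmod (iter_deriv vs (f i) x) \<le> B i"
    using rapidD by metis
  show ?thesis
  proof (rule that[OF B(1)])
    fix i
    show "schwartz_seminorm k vs (f i) \<le> B i"
      unfolding schwartz_seminorm_def by (rule cSUP_least) (use B in auto)
    have "0 \<le> norm (0::'a) ^ k * cmod (iter_deriv vs (f i) 0)" by simp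
    also have "\<dots> \<le> schwartz_seminorm k vs (f i)"
      unfolding schwartz_seminorm_def
      by (rule cSUP_upper) (use B in \<open>auto simp: bdd_above_def\<close>)
    finally show "0 \<le> schwartz_seminorm k vs (f i)" .
  qed
qed

lemma schwartz_family_add:
  "bound_class \<B> \<Longrightarrow> schwartz_family \<B> f \<Longrightarrow> schwartz_family \<B> g \<Longrightarrow>
   schwartz_family \<B> (\<lambda>i x. f i x + g i x)"
  unfolding schwartz_family_def by (auto intro: reg_add rapid_add)

lemma schwartz_family_cmult:
  "bound_class \<B> \<Longrightarrow> schwartz_family \<B> f \<Longrightarrow> schwartz_family \<B> (\<lambda>i x. c * f i x)"
  unfolding schwartz_family_def by (auto intro: reg_cmult rapid_cmult)

lemma schwartz_family_coord:
  "bound_class \<B> \<Longrightarrow> b \<in> Basis \<Longrightarrow> schwartz_family \<B> f \<Longrightarrow>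
   schwartz_family \<B> (\<lambda>i x. of_real (x \<bullet> b) * f i x)"
  unfolding schwartz_family_def by (auto intro: reg_rapid_coord)

lemma schwartz_family_deriv:
  "b \<in> Basis \<Longrightarrow> schwartz_family \<B> f \<Longrightarrow>
   schwartz_family \<B> (\<lambda>i x. deriv_at (f i) x b)"
  unfolding schwartz_family_def by (metis reg.simps(2))

lemma schwartz_family_mult:
  fixes q :: "'i \<Rightarrow> 'a::euclidean_space \<Rightarrow> complex"
  assumes "bound_class \<B>" "schwartz f" "\<And>n. reg (unif \<B>) n q"
  shows "schwartz_family \<B> (\<lambda>i x. f x * q i x)"
  unfolding schwartz_family_def
proof
  fix n
  have f: "reg (rapid const_bounds) n (\<lambda>_::'i. f)"
    by (rule schwartz_family_constI[OF assms(2), unfolded schwartz_family_def, rule_format])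
  show "reg (rapid \<B>) n (\<lambda>i x. f x * q i x)"
    by (rule reg_mult[OF f assms(3)]) (auto intro: rapid_mult rapid_add assms(1))
qed

lemma schwartz_imp_unif: "schwartz f \<Longrightarrow> reg (unif const_bounds) n (\<lambda>_. f)"
  using reg_mono[of "rapid const_bounds" "unif const_bounds"] rapid_imp_unif schwartz_family_constI
  unfolding schwartz_family_def by blast

lemma schwartz_mult_bounded: "schwartz f \<Longrightarrow> (\<And>n. reg (unif const_bounds) n (\<lambda>_::unit. q)) \<Longrightarrow> schwartz (\<lambda>x. f x * q x)"
  by (rule schwartz_family_member[OF schwartz_family_mult[OF bound_class_const]])

lemma schwartz_add: "schwartz f \<Longrightarrow> schwartz g \<Longrightarrow> schwartz (\<lambda>x. f x + g x)"
  by (rule schwartz_familyD) (intro schwartz_family_add[OF bound_class_const] schwartz_family_constI)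

lemma schwartz_cmult: "schwartz f \<Longrightarrow> schwartz (\<lambda>x. c * f x)"
  by (rule schwartz_familyD) (intro schwartz_family_cmult[OF bound_class_const] schwartz_family_constI)

lemma schwartz_diff: "schwartz f \<Longrightarrow> schwartz g \<Longrightarrow> schwartz (\<lambda>x. f x - g x)"
  using schwartz_add[OF _ schwartz_cmult[of g "-1"]] by force

lemma schwartz_zero: "schwartz (\<lambda>_. 0)"
proof (rule schwartz_familyD, unfold schwartz_family_def, rule allI)
  fix n show "reg (rapid const_bounds) n (\<lambda>(_::unit) _. 0)"
    by (induction n) (auto simp: rapid_const_iff)
qed

lemma schwartz_sum: "(\<And>j. j \<in> J \<Longrightarrow> schwartz (f j)) \<Longrightarrow> schwartz (\<lambda>x. \<Sum>j\<in>J. f j x)"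
  by (induction J rule: infinite_finite_induct) (auto intro: schwartz_add schwartz_zero)

lemma schwartz_cnj: "schwartz f \<Longrightarrow> schwartz (\<lambda>x. cnj (f x))"
  by (rule schwartz_familyD, unfold schwartz_family_def, intro allI reg_cnj)
    (auto simp: rapid_def unif_def norm_mult dest: schwartz_family_constI[unfolded schwartz_family_def])

lemma schwartz_family_uminus_arg:
  fixes f :: "'i \<Rightarrow> 'a::euclidean_space \<Rightarrow> complex"
  assumes "bound_class \<B>" "schwartz_family \<B> f"
  shows "schwartz_family \<B> (\<lambda>i x. f i (- x))"
proof -
  have neg: "rapid \<B> (\<lambda>i x. f i (- x))" if f: "rapid \<B> f" for f :: "'i \<Rightarrow> 'a \<Rightarrow> complex"
  proof (rule rapidI)
    fix k
    obtain B where "B \<in> \<B>" and B: "\<And>i x. norm x ^ k * cmod (f i x) \<le> B i"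
      using rapidD[OF f] by metis
    moreover have "norm x ^ k * cmod (f i (- x)) \<le> B i" for i x
      using B[of "- x" i] by simp
    ultimately show "\<exists>B\<in>\<B>. \<forall>i x. norm x ^ k * cmod (f i (- x)) \<le> B i"
      by blast
  qed
  have "reg (rapid \<B>) n (\<lambda>i x. f i (-1 *\<^sub>R x))" for n
    by (rule reg_dilate)
      (use assms neg rapid_cmult[OF assms(1), where c="-1"] in \<open>simp_all add: schwartz_family_def\<close>)
  then show ?thesis by (simp add: schwartz_family_def)
qed

lemma schwartz_uminus_arg: "schwartz f \<Longrightarrow> schwartz (\<lambda>x. f (- x))"
  by (rule schwartz_familyD) (intro schwartz_family_uminus_arg[OF bound_class_const] schwartz_family_constI)

lemma schwartz_continuous: "schwartz f \<Longrightarrow> continuous_on S f"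
  using schwartz_def[of f] smooth_def[of f]
  by (metis continuous_at_imp_continuous_on differentiable_imp_continuous_within empty_subsetI iter_deriv.simps(1) list.set(1))

lemma schwartz_decay:
  assumes "schwartz f"
  obtains C where "\<And>x. norm x ^ k * cmod (f x) \<le> C"
proof -
  have "bdd_above (range (\<lambda>x. norm x ^ k * cmod (iter_deriv [] f x)))"
    using assms unfolding schwartz_def by (metis empty_subsetI list.set(1))
  with that show ?thesis by (auto simp: bdd_above_def)
qed

section \<open>Integration on Euclidean space\<close>

text \<open>
  Lebesgue measure on a Euclidean space is the product of one-dimensional Lebesgue measures along the
  basis. This reduces Gaussians, exponentials on a box and the integrability of \<open>decay\<close> to dimension one.
\<close>

lemma
  fixes \<phi> :: "'a::euclidean_space \<Rightarrow> real \<Rightarrow> 'c::{real_normed_field,banach,second_countable_topology}"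
  assumes "\<And>b. b \<in> Basis \<Longrightarrow> integrable lborel (\<phi> b)"
  shows integrable_prod_Basis: "integrable lborel (\<lambda>x::'a. \<Prod>b\<in>Basis. \<phi> b (x \<bullet> b))" (is ?I)
    and integral_prod_Basis:
      "(LINT x|lborel. (\<Prod>b\<in>Basis. \<phi> b (x \<bullet> b))) = (\<Prod>b\<in>Basis. LINT t|lborel. \<phi> b t)" (is ?E)
proof -
  interpret product_sigma_finite "\<lambda>_::'a. lborel :: real measure" ..
  define T :: "('a \<Rightarrow> real) \<Rightarrow> 'a" where "T f = (\<Sum>b\<in>Basis. f b *\<^sub>R b)" for f
  have T [measurable]: "T \<in> Pi\<^sub>M Basis (\<lambda>_. lborel) \<rightarrow>\<^sub>M borel"
    unfolding T_def by measurable
  have [measurable]: "\<phi> b \<in> borel_measurable borel" if "b \<in> Basis" for b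
    using borel_measurable_integrable[OF assms[OF that]] by simp
  have m: "(\<lambda>x::'a. \<Prod>b\<in>Basis. \<phi> b (x \<bullet> b)) \<in> borel_measurable borel"
    by measurable
  have eq: "(\<Prod>b\<in>Basis. \<phi> b (T f \<bullet> b)) = (\<Prod>b\<in>Basis. \<phi> b (f b))" for f
    by (intro prod.cong) (simp_all add: T_def)
  have L: "(lborel :: 'a measure) = distr (Pi\<^sub>M Basis (\<lambda>_. lborel)) borel T"
    unfolding T_def by (rule lborel_eq)
  show ?I
    by (subst L) (simp add: integrable_distr_eq m eq product_integrable_prod assms)
  show ?E
    by (subst L) (simp add: integral_distr m eq product_integral_prod assms)
qed

lemma
  fixes f :: "'a::euclidean_space \<Rightarrow> 'c::{banach, second_countable_topology}"
  assumes c: "c \<noteq> 0" and f: "integrable lborel f"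
  shows integrable_affine_arg: "integrable lborel (\<lambda>x. f (t + c *\<^sub>R x))"
    and integral_affine_arg: "(LINT x|lborel. f x) = \<bar>c\<bar> ^ DIM('a) *\<^sub>R (LINT x|lborel. f (t + c *\<^sub>R x))"
proof -
  have m [measurable]: "f \<in> borel_measurable borel"
    using borel_measurable_integrable[OF f] by simp
  note L = lborel_affine[OF c, of t]
  have "integrable (distr lborel borel (\<lambda>x. t + c *\<^sub>R x)) (\<lambda>x. \<bar>c\<bar> ^ DIM('a) *\<^sub>R f x)"
    by (subst integrable_density[symmetric]) (use f L in auto)
  then have "integrable (distr lborel borel (\<lambda>x. t + c *\<^sub>R x))
      (\<lambda>x. inverse (\<bar>c\<bar> ^ DIM('a)) *\<^sub>R (\<bar>c\<bar> ^ DIM('a) *\<^sub>R f x))"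
    by (rule integrable_scaleR_right)
  then have "integrable (distr lborel borel (\<lambda>x. t + c *\<^sub>R x)) f"
    using c by simp
  then show "integrable lborel (\<lambda>x. f (t + c *\<^sub>R x))"
    by (subst (asm) integrable_distr_eq) auto
  show "(LINT x|lborel. f x) = \<bar>c\<bar> ^ DIM('a) *\<^sub>R (LINT x|lborel. f (t + c *\<^sub>R x))"
    by (subst L) (simp add: integral_density integral_distr)
qed

lemma
  fixes f :: "'a::euclidean_space \<Rightarrow> 'c::{banach, second_countable_topology}"
  assumes f: "integrable lborel f"
  shows integrable_shift: "integrable lborel (\<lambda>x. f (x + t))"
    and integral_shift: "(LINT x|lborel. f (x + t)) = (LINT x|lborel. f x)"
  using integrable_affine_arg[of 1 f t] integral_affine_arg[of 1 f t] f
  by (simp_all add: add.commute[of t])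

lemma integral_reflect:
  fixes f :: "'a::euclidean_space \<Rightarrow> 'c::{banach, second_countable_topology}"
  assumes f: "integrable lborel f"
  shows "(LINT x|lborel. f (- x)) = (LINT x|lborel. f x)"
  using integral_affine_arg[of "-1" f 0] f by simp

lemma cis_measurable [measurable]: "cis \<in> borel_measurable borel"
  by (intro borel_measurable_continuous_onI continuous_intros)

lemma integrable_mult_cis:
  fixes f :: "'b \<Rightarrow> complex"
  assumes f: "integrable M f" and [measurable]: "\<theta> \<in> borel_measurable M"
  shows "integrable M (\<lambda>x. f x * cis (\<theta> x))"
  by (rule Bochner_Integration.integrable_bound[OF f]) (use f in \<open>auto simp: norm_mult\<close>)

lemma integrable_inverse_1_plus_sq: "integrable lborel (\<lambda>x::real. inverse (1 + x\<^sup>2))"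
  using integrable_inverse_1_plus_square by (simp add: set_integrable_def)

text \<open>
  The exponent is twice the dimension because \<open>decay\<close> is then dominated by a product of the
  one-dimensional integrable functions \<open>1/(1 + t\<^sup>2)\<close>.
\<close>

definition decay :: "'a::euclidean_space \<Rightarrow> real" where
  "decay x = inverse ((1 + norm x) ^ (2 * DIM('a)))"

lemma decay_pos: "0 < decay x"
  by (simp add: decay_def add_pos_nonneg)

lemma decay_le_prod: "decay x \<le> (\<Prod>b\<in>Basis. inverse (1 + ((x::'a::euclidean_space) \<bullet> b)\<^sup>2))"
proof -
  have "decay x = (\<Prod>b\<in>(Basis::'a set). inverse ((1 + norm x)\<^sup>2))"
    by (simp add: decay_def power_mult power_inverse)
  also have "\<dots> \<le> (\<Prod>b\<in>Basis. inverse (1 + (x \<bullet> b)\<^sup>2))"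
  proof (intro prod_mono conjI le_imp_inverse_le)
    fix b :: 'a assume "b \<in> Basis"
    then have "(x \<bullet> b)\<^sup>2 \<le> (norm x)\<^sup>2"
      using Basis_le_norm[of b x] by (metis abs_le_square_iff abs_norm_cancel)
    then show "1 + (x \<bullet> b)\<^sup>2 \<le> (1 + norm x)\<^sup>2"
      by (simp add: power2_eq_square algebra_simps) (use norm_ge_zero[of x] in linarith)
  qed (auto intro: add_pos_nonneg)
  finally show ?thesis .
qed

lemma integrable_decay: "integrable lborel (decay :: 'a::euclidean_space \<Rightarrow> real)"
proof (rule Bochner_Integration.integrable_bound)
  show "integrable lborel (\<lambda>x::'a. \<Prod>b\<in>Basis. inverse (1 + (x \<bullet> b)\<^sup>2))"
    by (rule integrable_prod_Basis[OF integrable_inverse_1_plus_sq])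
  show "decay \<in> borel_measurable lborel"
    unfolding decay_def by measurable
  show "AE x::'a in lborel. norm (decay x) \<le> norm (\<Prod>b\<in>Basis. inverse (1 + (x \<bullet> b)\<^sup>2))"
    by (simp add: abs_of_pos[OF decay_pos] prod_nonneg decay_le_prod)
qed

lemma power_one_plus_le:
  fixes r :: real assumes "0 \<le> r"
  shows "(1 + r) ^ n \<le> 2 ^ n * (1 + r ^ n)"
proof (cases "r \<le> 1")
  case True
  then have "(1 + r) ^ n \<le> 2 ^ n" using assms by (intro power_mono) auto
  also have "\<dots> \<le> 2 ^ n * (1 + r ^ n)" using assms by simp
  finally show ?thesis .
next
  case False
  then have "(1 + r) ^ n \<le> (2 * r) ^ n" using assms by (intro power_mono) auto
  also have "\<dots> \<le> 2 ^ n * (1 + r ^ n)" by (simp add: power_mult_distrib)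
  finally show ?thesis .
qed

lemma rapid_le_decay:
  fixes f :: "'i \<Rightarrow> 'a::euclidean_space \<Rightarrow> complex"
  assumes "bound_class \<B>" "rapid \<B> f"
  obtains B where "B \<in> \<B>" "\<And>i x. cmod (f i x) \<le> B i * decay x"
proof -
  let ?N = "2 * DIM('a)"
  obtain A where A: "A \<in> \<B>" "\<And>i x. norm x ^ 0 * cmod (f i x) \<le> A i"
    using rapidD[OF assms(2)] by metis
  obtain B where B: "B \<in> \<B>" "\<And>i x. norm x ^ ?N * cmod (f i x) \<le> B i"
    using rapidD[OF assms(2)] by metis
  show ?thesis
  proof (rule that)
    show "(\<lambda>i. 2 ^ ?N * (A i + B i)) \<in> \<B>"
      by (intro bound_class_scale bound_class_add assms(1) A B)
    fix i x
    have "(1 + norm x) ^ ?N * cmod (f i x) \<le> 2 ^ ?N * (1 + norm x ^ ?N) * cmod (f i x)"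
      by (intro mult_right_mono power_one_plus_le) auto
    also have "\<dots> = 2 ^ ?N * (norm x ^ 0 * cmod (f i x) + norm x ^ ?N * cmod (f i x))"
      by (simp add: algebra_simps)
    also have "\<dots> \<le> 2 ^ ?N * (A i + B i)"
      by (intro mult_left_mono add_mono A B) auto
    finally have *: "(1 + norm x) ^ ?N * cmod (f i x) \<le> 2 ^ ?N * (A i + B i)" .
    have "0 < (1 + norm x) ^ ?N" by (simp add: add_pos_nonneg)
    with * show "cmod (f i x) \<le> 2 ^ ?N * (A i + B i) * decay x"
      by (simp add: decay_def field_simps)
  qed
qed

lemma rapid_integrable:
  fixes f :: "'i \<Rightarrow> 'a::euclidean_space \<Rightarrow> complex"
  assumes "bound_class \<B>" "rapid \<B> f" "\<And>i. f i \<in> borel_measurable borel"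
  obtains B where "B \<in> \<B>" "\<And>i. integrable lborel (f i)" "\<And>i. (LINT x|lborel. cmod (f i x)) \<le> B i"
proof -
  obtain B where B: "B \<in> \<B>" "\<And>i x. cmod (f i x) \<le> B i * decay x"
    using rapid_le_decay[OF assms(1,2)] by metis
  have int: "integrable lborel (f i)" for i
    by (rule Bochner_Integration.integrable_bound[where f="\<lambda>x. B i * decay x"])
      (use assms(3) B(2) order_trans[OF B(2) abs_ge_self] in \<open>auto intro: integrable_decay\<close>)
  show ?thesis
  proof (rule that[of "\<lambda>i. integral\<^sup>L lborel (decay::'a\<Rightarrow>real) * B i"])
    show "(\<lambda>i. integral\<^sup>L lborel (decay::'a\<Rightarrow>real) * B i) \<in> \<B>"
      by (intro bound_class_scale assms(1) B)
    fix i
    have "(LINT x|lborel. cmod (f i x)) \<le> (LINT x::'a|lborel. B i * decay x)"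
      by (intro Bochner_Integration.integral_mono integrable_norm int integrable_mult_right integrable_decay B)
    then show "(LINT x|lborel. cmod (f i x)) \<le> integral\<^sup>L lborel (decay::'a\<Rightarrow>real) * B i"
      by (simp add: mult.commute)
  qed (rule int)
qed

lemma schwartz_measurable: "schwartz f \<Longrightarrow> f \<in> borel_measurable borel"
  by (intro borel_measurable_continuous_onI schwartz_continuous)

lemma schwartz_rapid: "schwartz f \<Longrightarrow> rapid const_bounds (\<lambda>_. f)"
  using schwartz_family_constI[of f] by (auto simp: schwartz_family_def dest: reg_imp)

lemma schwartz_integrable: "schwartz f \<Longrightarrow> integrable lborel f"
  using rapid_integrable[OF bound_class_const schwartz_rapid schwartz_measurable] by metis

text \<open>
  The form of Fubini's theorem needed for exponential kernels of modulus one. One of the two measures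
  may be a counting measure, which covers the interchange of a series and an integral.
\<close>

lemma (in pair_sigma_finite) integral_swap_kernel:
  fixes f g :: "_ \<Rightarrow> complex"
  assumes f: "integrable M1 f" and g: "integrable M2 g"
    and k: "case_prod k \<in> borel_measurable (M1 \<Otimes>\<^sub>M M2)" "\<And>x y. cmod (k x y) \<le> 1"
  shows "integrable (M1 \<Otimes>\<^sub>M M2) (\<lambda>(x, y). f x * g y * k x y)"
    and "(LINT x|M1. f x * (LINT y|M2. g y * k x y)) = (LINT y|M2. g y * (LINT x|M1. f x * k x y))"
proof -
  have [measurable]: "f \<in> borel_measurable M1" "g \<in> borel_measurable M2"
    using f g by auto
  note [measurable] = k(1)
  have "integrable (M1 \<Otimes>\<^sub>M M2) (\<lambda>(x, y). f x * g y)"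
    by (rule Fubini_integrable)
      (use f g in \<open>auto simp: norm_mult intro!: integrable_mult_left integrable_norm\<close>)
  then show int: "integrable (M1 \<Otimes>\<^sub>M M2) (\<lambda>(x, y). f x * g y * k x y)"
    by (rule Bochner_Integration.integrable_bound)
      (auto simp: norm_mult k intro!: AE_I2 mult_left_le)
  have "(LINT x|M1. f x * (LINT y|M2. g y * k x y)) = (LINT x|M1. LINT y|M2. f x * g y * k x y)"
    by (simp add: mult.assoc)
  also have "\<dots> = (LINT y|M2. LINT x|M1. f x * g y * k x y)"
    using Fubini_integral[OF int] by simp
  also have "\<dots> = (LINT y|M2. LINT x|M1. g y * (f x * k x y))"
    by (simp add: mult_ac)
  finally show "(LINT x|M1. f x * (LINT y|M2. g y * k x y)) = (LINT y|M2. g y * (LINT x|M1. f x * k x y))"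
    by simp
qed

section \<open>Gaussians and Fourier inversion\<close>

definition gauss :: "'a::euclidean_space \<Rightarrow> real" where
  "gauss x = exp (- pi * (norm x)\<^sup>2)"

text \<open>
  Rescaling by \<open>sqrt (2\<pi>)\<close> turns the characteristic function of the standard normal distribution into
  the fixed point \<open>exp (-\<pi>u\<^sup>2)\<close> of the Fourier transform.
\<close>

lemma gauss_real:
  shows "integrable lborel (\<lambda>u::real. exp (- pi * u\<^sup>2))"
    and "(LINT u|lborel. of_real (exp (- pi * u\<^sup>2)) * cis (- 2 * pi * (s * u))) = of_real (exp (- pi * s\<^sup>2))"
proof -
  define r where "r = sqrt (2 * pi)"
  have r: "r > 0" "r\<^sup>2 = 2 * pi" by (auto simp: r_def)
  have rr: "r * (r * y) = 2 * pi * y" for y using r(2) by (simp add: power2_eq_square mult.assoc[symmetric])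
  have d: "std_normal_density (0 + r * u) = exp (- pi * u\<^sup>2) / r" for u
    using r by (simp add: normal_density_def r_def[symmetric] power_mult_distrib)
  have "integrable lborel (\<lambda>u. r * std_normal_density (0 + r * u))"
    using r by (intro integrable_mult_right lborel_integrable_real_affine integrable_normal_density) auto
  then show "integrable lborel (\<lambda>u::real. exp (- pi * u\<^sup>2))"
    unfolding d using r by simp
  have "char std_normal_distribution (- r * s) =
      (LINT x|lborel. std_normal_density x *\<^sub>R iexp ((- r * s) * x))"
    unfolding char_def by (subst integral_density) auto
  also have "\<dots> = \<bar>r\<bar> *\<^sub>R (LINT u|lborel. std_normal_density (0 + r * u) *\<^sub>R iexp ((- r * s) * (0 + r * u)))"
    using r by (intro lborel_integral_real_affine) auto
  also have "\<dots> = (LINT u|lborel. \<bar>r\<bar> *\<^sub>R (std_normal_density (0 + r * u) *\<^sub>R iexp ((- r * s) * (0 + r * u))))"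
    by (simp only: integral_scaleR_right)
  also have "\<dots> = (LINT u|lborel. of_real (exp (- pi * u\<^sup>2)) * cis (- 2 * pi * (s * u)))"
  proof (rule Bochner_Integration.integral_cong[OF refl])
    fix u
    have "iexp ((- r * s) * (0 + r * u)) = cis (- 2 * pi * (s * u))"
    proof -
      have "(- r * s) * (0 + r * u) = - 2 * pi * (s * u)"
        using rr[of "s * u"] by (simp add: mult_ac)
      then show ?thesis by (simp only: cis_conv_exp)
    qed
    then show "\<bar>r\<bar> *\<^sub>R (std_normal_density (0 + r * u) *\<^sub>R iexp ((- r * s) * (0 + r * u))) =
      of_real (exp (- pi * u\<^sup>2)) * cis (- 2 * pi * (s * u))"
      unfolding d using r(1) by (simp add: scaleR_conv_of_real)
  qed
  also have "char std_normal_distribution (- r * s) = of_real (exp (- pi * s\<^sup>2))"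
    unfolding char_std_normal_distribution using r(2) by (simp add: power_mult_distrib)
  finally show "(LINT u|lborel. of_real (exp (- pi * u\<^sup>2)) * cis (- 2 * pi * (s * u))) = of_real (exp (- pi * s\<^sup>2))" ..
qed

lemma cis_sum: "finite A \<Longrightarrow> cis (\<Sum>b\<in>A. f b) = (\<Prod>b\<in>A. cis (f b))"
  by (induction A rule: finite_induct) (auto simp: cis_mult[symmetric])

lemma gauss_prod: "gauss x = (\<Prod>b\<in>Basis. exp (- pi * (x \<bullet> b)\<^sup>2))"
  by (simp add: gauss_def norm_eq_sqrt_inner euclidean_inner[of x x] sum_nonneg power2_eq_square
      sum_distrib_left exp_sum[symmetric] sum_negf)

lemma integrable_gauss: "integrable lborel (gauss :: 'a::euclidean_space \<Rightarrow> real)"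
  unfolding gauss_prod[abs_def] by (rule integrable_prod_Basis[OF gauss_real(1)])

lemma fourier_gauss: "fourier (\<lambda>x::'a::euclidean_space. of_real (gauss x)) \<xi> = of_real (gauss \<xi>)"
proof -
  have "fourier (\<lambda>x::'a. of_real (gauss x)) \<xi> =
      (LINT x|lborel. (\<Prod>b\<in>Basis. of_real (exp (- pi * (x \<bullet> b)\<^sup>2)) * cis (- 2 * pi * ((\<xi> \<bullet> b) * (x \<bullet> b)))))"
    unfolding fourier_def
  proof (rule Bochner_Integration.integral_cong[OF refl])
    fix x :: 'a
    have "cis (- 2 * pi * (\<xi> \<bullet> x)) = (\<Prod>b\<in>Basis. cis (- 2 * pi * ((\<xi> \<bullet> b) * (x \<bullet> b))))"
      by (subst cis_sum[symmetric]) (simp_all add: euclidean_inner[of \<xi> x] sum_distrib_left)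
    then show "of_real (gauss x) * cis (- 2 * pi * (\<xi> \<bullet> x)) =
      (\<Prod>b\<in>Basis. of_real (exp (- pi * (x \<bullet> b)\<^sup>2)) * cis (- 2 * pi * ((\<xi> \<bullet> b) * (x \<bullet> b))))"
      by (simp only: gauss_prod of_real_prod prod.distrib)
  qed
  also have "\<dots> = (\<Prod>b\<in>Basis. LINT u|lborel. of_real (exp (- pi * u\<^sup>2)) * cis (- 2 * pi * ((\<xi> \<bullet> b) * u)))"
  proof (rule integral_prod_Basis)
    fix b :: 'a
    show "integrable lborel (\<lambda>u. of_real (exp (- pi * u\<^sup>2)) * cis (- 2 * pi * ((\<xi> \<bullet> b) * u)))"
      by (intro integrable_mult_cis integrable_of_real gauss_real(1)) measurable
  qed
  also have "\<dots> = of_real (gauss \<xi>)"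
    by (simp only: gauss_real(2) gauss_prod of_real_prod)
  finally show ?thesis .
qed

lemma gauss_zero: "gauss 0 = 1" by (simp add: gauss_def)

lemma gauss_nonneg: "0 \<le> gauss x" by (simp add: gauss_def)

lemma gauss_le_1: "gauss x \<le> 1" by (simp add: gauss_def)

lemma gauss_measurable [measurable]: "gauss \<in> borel_measurable borel"
  unfolding gauss_def[abs_def] by measurable

text \<open>
  Insert the Gaussian factor \<open>gauss (\<xi>/c)\<close>, with \<open>c = n + 1\<close>, into the inversion integral. By Fubini and
  the self-duality of the Gaussian the regularised integral is an average of \<open>f (x + y/c)\<close> against
  \<open>gauss y\<close>. As \<open>n\<close> tends to infinity, dominated convergence applies to both expressions.
\<close>

theorem fourier_inversion:
  fixes f :: "'a::euclidean_space \<Rightarrow> complex"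
  assumes f: "integrable lborel f" and cont: "continuous_on UNIV f" and bdd: "\<And>x. cmod (f x) \<le> C"
    and hat: "integrable lborel (fourier f)"
  shows "inverse_fourier (fourier f) x = f x"
proof -
  have [measurable]: "f \<in> borel_measurable borel" "fourier f \<in> borel_measurable borel"
    using borel_measurable_integrable[OF f] borel_measurable_integrable[OF hat] by simp_all
  define I where "I n = (LINT \<xi>|lborel. fourier f \<xi> * cis (2 * pi * (\<xi> \<bullet> x)) * of_real (gauss (\<xi> /\<^sub>R real (Suc n))))" for n
  have lim0: "(\<lambda>n. y /\<^sub>R real (Suc n)) \<longlonglongrightarrow> 0" for y :: 'a
    using tendsto_scaleR[OF LIMSEQ_inverse_real_of_nat tendsto_const[of y]] by simp
  have 1: "I \<longlonglongrightarrow> inverse_fourier (fourier f) x"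
    unfolding I_def inverse_fourier_def
  proof (rule integral_dominated_convergence[where w="\<lambda>\<xi>. cmod (fourier f \<xi>)"])
    have "isCont (gauss :: 'a \<Rightarrow> real) 0"
      unfolding gauss_def[abs_def] by (intro continuous_intros)
    have "(\<lambda>n. gauss (\<xi> /\<^sub>R real (Suc n))) \<longlonglongrightarrow> 1" for \<xi> :: 'a
      using isCont_tendsto_compose[OF \<open>isCont gauss 0\<close> lim0[of \<xi>]] by (simp only: gauss_zero)
    moreover have "(\<lambda>n. c * of_real (h n)) \<longlonglongrightarrow> c" if "h \<longlonglongrightarrow> 1" for c :: complex and h
      using tendsto_mult[OF tendsto_const tendsto_of_real[OF that], of c] by simp
    ultimately show "AE \<xi> in lborel. (\<lambda>n. fourier f \<xi> * cis (2 * pi * (\<xi> \<bullet> x)) *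
        of_real (gauss (\<xi> /\<^sub>R real (Suc n)))) \<longlonglongrightarrow> fourier f \<xi> * cis (2 * pi * (\<xi> \<bullet> x))"
      by simp
  qed (use hat in \<open>auto simp: norm_mult gauss_nonneg gauss_le_1 mult_left_le\<close>)
  have 2: "I n = (LINT y|lborel. f (x + y /\<^sub>R real (Suc n)) * of_real (gauss y))" for n
  proof -
    define c where "c = real (Suc n)"
    have c: "c > 0" by (simp add: c_def)
    have "I n = (LINT \<xi>|lborel. of_real (gauss (\<xi> /\<^sub>R c)) * (LINT y|lborel. f y * cis (2 * pi * (\<xi> \<bullet> (x - y)))))"
      unfolding I_def fourier_def c_def[symmetric]
    proof (rule Bochner_Integration.integral_cong[OF refl])
      fix \<xi> :: 'a
      have "(LINT y|lborel. f y * cis (2 * pi * (\<xi> \<bullet> (x - y)))) =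
         (LINT y|lborel. f y * cis (- 2 * pi * (\<xi> \<bullet> y)) * cis (2 * pi * (\<xi> \<bullet> x)))"
        by (intro Bochner_Integration.integral_cong[OF refl])
          (simp add: mult.assoc cis_mult inner_diff_right algebra_simps)
      then show "(LINT y|lborel. f y * cis (- 2 * pi * (\<xi> \<bullet> y))) * cis (2 * pi * (\<xi> \<bullet> x)) * of_real (gauss (\<xi> /\<^sub>R c)) =
        of_real (gauss (\<xi> /\<^sub>R c)) * (LINT y|lborel. f y * cis (2 * pi * (\<xi> \<bullet> (x - y))))"
        by simp
    qed
    also have "\<dots> = (LINT y|lborel. f y * (LINT \<xi>|lborel. of_real (gauss (\<xi> /\<^sub>R c)) * cis (2 * pi * (\<xi> \<bullet> (x - y)))))"
    proof (rule lborel_pair.integral_swap_kernel(2))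
      show "integrable lborel (\<lambda>\<xi>::'a. complex_of_real (gauss (\<xi> /\<^sub>R c)))"
        using integrable_affine_arg[OF _ integrable_gauss, of "1 / c" 0]
        c by (intro integrable_of_real) (simp add: divide_inverse)
    qed (use f in auto)
    also have "\<dots> = (LINT y|lborel. f y * (of_real (c ^ DIM('a)) * of_real (gauss (c *\<^sub>R (y - x)))))"
    proof (rule Bochner_Integration.integral_cong[OF refl])
      fix y
      have "(LINT \<xi>|lborel. of_real (gauss (\<xi> /\<^sub>R c)) * cis (2 * pi * (\<xi> \<bullet> (x - y)))) =
        c ^ DIM('a) *\<^sub>R (LINT \<xi>|lborel. of_real (gauss ((0 + c *\<^sub>R \<xi>) /\<^sub>R c)) * cis (2 * pi * ((0 + c *\<^sub>R \<xi>) \<bullet> (x - y))))"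
      proof (subst integral_affine_arg[where c="c" and t=0])
        have "integrable lborel (\<lambda>\<xi>::'a. gauss (\<xi> /\<^sub>R c))"
          using integrable_affine_arg[OF _ integrable_gauss, of "1 / c" 0] c by (simp add: divide_inverse)
        then show "integrable lborel (\<lambda>\<xi>. of_real (gauss (\<xi> /\<^sub>R c)) * cis (2 * pi * (\<xi> \<bullet> (x - y))))"
          by (intro integrable_mult_cis integrable_of_real) measurable
      qed (use c in auto)
      also have "(LINT \<xi>|lborel. of_real (gauss ((0 + c *\<^sub>R \<xi>) /\<^sub>R c)) * cis (2 * pi * ((0 + c *\<^sub>R \<xi>) \<bullet> (x - y)))) =
          fourier (\<lambda>\<xi>::'a. of_real (gauss \<xi>)) (c *\<^sub>R (y - x))"
        unfolding fourier_def
      proof (rule Bochner_Integration.integral_cong[OF refl])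
        fix \<xi> :: 'a
        have "2 * pi * ((0 + c *\<^sub>R \<xi>) \<bullet> (x - y)) = - 2 * pi * ((c *\<^sub>R (y - x)) \<bullet> \<xi>)"
          by (simp add: inner_diff_left inner_diff_right inner_commute[of \<xi>] algebra_simps)
        moreover have "(0 + c *\<^sub>R \<xi>) /\<^sub>R c = \<xi>" using c by simp
        ultimately show "of_real (gauss ((0 + c *\<^sub>R \<xi>) /\<^sub>R c)) * cis (2 * pi * ((0 + c *\<^sub>R \<xi>) \<bullet> (x - y))) =
          of_real (gauss \<xi>) * cis (- 2 * pi * ((c *\<^sub>R (y - x)) \<bullet> \<xi>))"
          by (simp only:)
      qed
      finally show "f y * (LINT \<xi>|lborel. of_real (gauss (\<xi> /\<^sub>R c)) * cis (2 * pi * (\<xi> \<bullet> (x - y)))) =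
         f y * (of_real (c ^ DIM('a)) * of_real (gauss (c *\<^sub>R (y - x))))"
        using c by (simp add: fourier_gauss scaleR_conv_of_real)
    qed
    also have "\<dots> = (LINT y|lborel. f (x + y /\<^sub>R c) * of_real (gauss y))"
    proof (subst integral_affine_arg[where c="inverse c" and t=x])
      show "integrable lborel (\<lambda>y. f y * (of_real (c ^ DIM('a)) * of_real (gauss (c *\<^sub>R (y - x)))))"
        by (rule Bochner_Integration.integrable_bound[where f="\<lambda>y. c ^ DIM('a) * cmod (f y)"])
          (use f c in \<open>auto simp: norm_mult norm_power gauss_nonneg mult_ac intro!: AE_I2 mult_left_mono mult_left_le gauss_le_1\<close>)
    next
      show "\<bar>inverse c\<bar> ^ DIM('a) *\<^sub>R (LINT y|lborel. f (x + inverse c *\<^sub>R y) *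
          (of_real (c ^ DIM('a)) * of_real (gauss (c *\<^sub>R (x + inverse c *\<^sub>R y - x))))) =
        (LINT y|lborel. f (x + y /\<^sub>R c) * of_real (gauss y))"
        using c by (simp add: scaleR_conv_of_real power_inverse mult.left_commute[of "f _"] flip: of_real_power)
    qed (use c in simp)
    finally show ?thesis unfolding c_def .
  qed
  have "(\<lambda>n. LINT y|lborel. f (x + y /\<^sub>R real (Suc n)) * of_real (gauss y)) \<longlonglongrightarrow> (LINT y::'a|lborel. f x * of_real (gauss y))"
  proof (rule integral_dominated_convergence[where w="\<lambda>y. C * gauss y"])
    have "(\<lambda>n. f (x + y /\<^sub>R real (Suc n))) \<longlonglongrightarrow> f x" for y
    proof -
      have "(\<lambda>n. x + y /\<^sub>R real (Suc n)) \<longlonglongrightarrow> x"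
        using tendsto_add[OF tendsto_const lim0, of x y] by simp
      moreover have "isCont f x" using cont by (simp add: continuous_on_eq_continuous_at)
      ultimately show ?thesis by (metis isCont_tendsto_compose)
    qed
    then show "AE y in lborel. (\<lambda>n. f (x + y /\<^sub>R real (Suc n)) * of_real (gauss y)) \<longlonglongrightarrow> f x * of_real (gauss y)"
      by (intro AE_I2 tendsto_mult tendsto_const)
  qed (auto simp: norm_mult gauss_nonneg intro!: integrable_gauss mult_right_mono bdd)
  moreover have "(LINT y::'a|lborel. complex_of_real (gauss y)) = 1"
    using fourier_gauss[of "0::'a"] by (simp add: fourier_def gauss_zero)
  ultimately have "I \<longlonglongrightarrow> f x" unfolding 2[abs_def] by simp
  with 1 show ?thesis by (rule LIMSEQ_unique)
qed

section \<open>The Fourier transform on Schwartz functions\<close>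

lemma cis_taylor: "cmod (cis (a + d) - cis a - \<i> * of_real d * cis a) \<le> d\<^sup>2"
proof -
  have "cis (a + d) - cis a - \<i> * of_real d * cis a = cis a * (iexp d - (\<Sum>k\<le>1. (\<i> * d) ^ k / fact k))"
    by (simp add: cis_conv_exp exp_add algebra_simps)
  then have "cmod (cis (a + d) - cis a - \<i> * of_real d * cis a) \<le> \<bar>d\<bar> ^ Suc 1 / fact (Suc 1)"
    using iexp_approx1[of d 1] by (simp only: norm_mult norm_cis mult_1)
  then show ?thesis by (simp add: power2_eq_square[symmetric]) (smt (verit) zero_le_power2)
qed

text \<open>
  An integral of exponentials \<open>exp (i \<xi> \<bullet> \<theta> y)\<close>. Lebesgue measure with \<open>\<theta> x = -2\<pi>x\<close> gives the Fourier
  transform, counting measure on a lattice with \<open>\<theta> l = 2\<pi>l\<close> gives a Fourier series with coefficients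
  \<open>f\<close>. Both are differentiated by the same lemma.
\<close>

definition osc :: "'b measure \<Rightarrow> ('b \<Rightarrow> 'a::euclidean_space) \<Rightarrow> ('b \<Rightarrow> complex) \<Rightarrow> 'a \<Rightarrow> complex" where
  "osc M \<theta> f \<xi> = (LINT y|M. f y * cis (\<xi> \<bullet> \<theta> y))"

lemma norm_integral_le:
  fixes f :: "'b \<Rightarrow> complex"
  assumes "integrable M f" "integrable M g" "\<And>x. norm (f x) \<le> g x"
  shows "norm (\<integral>x. f x \<partial>M) \<le> (\<integral>x. g x \<partial>M)"
  using integral_norm_bound Bochner_Integration.integral_mono[OF integrable_norm[OF assms(1)] assms(2,3)]
  by (rule order_trans)

text \<open>
  The second-order Taylor bound for the exponential gives a remainder of at most \<open>|h|\<^sup>2\<close> times the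
  second moment of \<open>f\<close>.
\<close>

lemma osc_has_derivative:
  assumes [measurable]: "\<theta> \<in> M \<rightarrow>\<^sub>M borel" "f \<in> borel_measurable M"
    and int: "\<And>k. integrable M (\<lambda>y. norm (\<theta> y) ^ k * cmod (f y))"
  shows "(osc M \<theta> f has_derivative (\<lambda>h. osc M \<theta> (\<lambda>y. \<i> * of_real (\<theta> y \<bullet> h) * f y) \<xi>)) (at \<xi>)"
proof -
  define D where "D h = osc M \<theta> (\<lambda>y. \<i> * of_real (\<theta> y \<bullet> h) * f y) \<xi>" for h
  define K where "K k = (LINT y|M. norm (\<theta> y) ^ k * cmod (f y))" for k :: nat
  have int0: "integrable M (\<lambda>y. f y * cis (\<xi> \<bullet> \<theta> y))" for \<xi>
    by (rule Bochner_Integration.integrable_bound[OF int[of 0]]) (auto simp: norm_mult)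
  have le1: "cmod (\<i> * of_real (\<theta> y \<bullet> h) * f y * cis (\<xi> \<bullet> \<theta> y)) \<le> norm h * (norm (\<theta> y) ^ 1 * cmod (f y))" for y h
    using mult_right_mono[OF Cauchy_Schwarz_ineq2[of "\<theta> y" h], of "cmod (f y)"]
    by (simp add: norm_mult mult_ac)
  have int1: "integrable M (\<lambda>y. \<i> * of_real (\<theta> y \<bullet> h) * f y * cis (\<xi> \<bullet> \<theta> y))" for h
    by (rule Bochner_Integration.integrable_bound[OF integrable_mult_right[OF int[of 1], of "norm h"]])
      (use le1 in \<open>auto intro!: AE_I2 simp: abs_mult\<close>)
  have lin: "bounded_linear D"
  proof (rule bounded_linear_intro)
    fix h k show "D (h + k) = D h + D k"
      unfolding D_def osc_def
      by (subst Bochner_Integration.integral_add[symmetric, OF int1 int1]) (simp add: inner_add_right algebra_simps)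
  next
    fix r h show "D (r *\<^sub>R h) = r *\<^sub>R D h"
      unfolding D_def osc_def
      by (subst integral_scaleR_right[symmetric]) (simp add: scaleR_conv_of_real mult_ac)
  next
    fix h
    have "cmod (D h) \<le> (LINT y|M. norm h * (norm (\<theta> y) ^ 1 * cmod (f y)))"
      unfolding D_def osc_def using le1
      by (intro norm_integral_le int1 integrable_mult_right int)
    then show "cmod (D h) \<le> norm h * K 1"
      by (simp add: K_def)
  qed
  have rem: "cmod (osc M \<theta> f (\<xi> + h) - osc M \<theta> f \<xi> - D h) \<le> K 2 * norm h * norm h" for h
  proof -
    let ?r = "\<lambda>y. f y * cis ((\<xi> + h) \<bullet> \<theta> y) - f y * cis (\<xi> \<bullet> \<theta> y) - \<i> * of_real (\<theta> y \<bullet> h) * f y * cis (\<xi> \<bullet> \<theta> y)"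
    have "osc M \<theta> f (\<xi> + h) - osc M \<theta> f \<xi> - D h = (LINT y|M. ?r y)"
      unfolding D_def osc_def
      by (simp add: Bochner_Integration.integral_diff int0 int1 Bochner_Integration.integrable_diff)
    also have "cmod \<dots> \<le> (LINT y|M. (norm h)\<^sup>2 * (norm (\<theta> y) ^ 2 * cmod (f y)))"
    proof (rule norm_integral_le)
      fix y
      have "cmod (?r y) = cmod (f y) * cmod (cis (\<xi> \<bullet> \<theta> y + \<theta> y \<bullet> h) - cis (\<xi> \<bullet> \<theta> y) - \<i> * of_real (\<theta> y \<bullet> h) * cis (\<xi> \<bullet> \<theta> y))"
        by (simp add: norm_mult[symmetric] inner_add_left inner_commute[of h] algebra_simps)
      also have "\<dots> \<le> cmod (f y) * (\<theta> y \<bullet> h)\<^sup>2"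
        by (intro mult_left_mono cis_taylor) auto
      also have "\<dots> \<le> cmod (f y) * (norm (\<theta> y) * norm h)\<^sup>2"
        using Cauchy_Schwarz_ineq2[of "\<theta> y" h]
        by (intro mult_left_mono) (auto simp: abs_le_square_iff[symmetric])
      finally show "cmod (?r y) \<le> (norm h)\<^sup>2 * (norm (\<theta> y) ^ 2 * cmod (f y))"
        by (simp add: power_mult_distrib mult_ac)
    qed (intro Bochner_Integration.integrable_diff int0 int1 integrable_mult_right int)+
    also have "\<dots> = K 2 * norm h * norm h"
      by (simp add: K_def power2_eq_square)
    finally show ?thesis .
  qed
  have "((\<lambda>h. K 2 * norm h) \<longlongrightarrow> 0) (at 0)"
    by (auto intro!: tendsto_eq_intros)
  then have "((\<lambda>h. cmod (osc M \<theta> f (\<xi> + h) - osc M \<theta> f \<xi> - D h) / norm h) \<longlongrightarrow> 0) (at 0)"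
  proof (rule Lim_null_comparison[rotated])
    show "\<forall>\<^sub>F h in at 0. norm (cmod (osc M \<theta> f (\<xi> + h) - osc M \<theta> f \<xi> - D h) / norm h) \<le> K 2 * norm h"
      using rem by (auto simp: eventually_at_filter divide_le_eq)
  qed
  with lin show ?thesis
    unfolding has_derivative_at D_def by simp
qed

definition moments_in :: "('i \<Rightarrow> real) set \<Rightarrow> 'b measure \<Rightarrow> ('b \<Rightarrow> 'a::euclidean_space) \<Rightarrow> ('i \<Rightarrow> 'b \<Rightarrow> complex) \<Rightarrow> bool" where
  "moments_in \<B> M \<theta> f \<longleftrightarrow> (\<forall>i. f i \<in> borel_measurable M) \<and>
     (\<forall>k. \<exists>B\<in>\<B>. \<forall>i. integrable M (\<lambda>y. norm (\<theta> y) ^ k * cmod (f i y)) \<and>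
        (LINT y|M. norm (\<theta> y) ^ k * cmod (f i y)) \<le> B i)"

lemma moments_in_mult:
  assumes [measurable]: "\<theta> \<in> M \<rightarrow>\<^sub>M borel" and f: "moments_in \<B> M \<theta> f" and b: "norm b \<le> 1"
  shows "moments_in \<B> M \<theta> (\<lambda>i y. \<i> * of_real (\<theta> y \<bullet> b) * f i y)"
  unfolding moments_in_def
proof (intro conjI allI)
  have [measurable]: "f i \<in> borel_measurable M" for i
    using f by (auto simp: moments_in_def)
  show "(\<lambda>y. \<i> * of_real (\<theta> y \<bullet> b) * f i y) \<in> borel_measurable M" for i
    by measurable
  fix k
  obtain B where B: "B \<in> \<B>" "\<And>i. integrable M (\<lambda>y. norm (\<theta> y) ^ Suc k * cmod (f i y))"
    "\<And>i. (LINT y|M. norm (\<theta> y) ^ Suc k * cmod (f i y)) \<le> B i"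
    using f unfolding moments_in_def by meson
  have le: "norm (\<theta> y) ^ k * cmod (\<i> * of_real (\<theta> y \<bullet> b) * f i y) \<le> norm (\<theta> y) ^ Suc k * cmod (f i y)" for i y
  proof -
    have "\<bar>\<theta> y \<bullet> b\<bar> \<le> norm (\<theta> y)"
      using Cauchy_Schwarz_ineq2[of "\<theta> y" b] mult_left_le[OF b norm_ge_zero[of "\<theta> y"]] by linarith
    then have "norm (\<theta> y) ^ k * (\<bar>\<theta> y \<bullet> b\<bar> * cmod (f i y)) \<le> norm (\<theta> y) ^ k * (norm (\<theta> y) * cmod (f i y))"
      by (intro mult_left_mono mult_right_mono) auto
    then show ?thesis by (simp add: norm_mult mult_ac)
  qed
  have int: "integrable M (\<lambda>y. norm (\<theta> y) ^ k * cmod (\<i> * of_real (\<theta> y \<bullet> b) * f i y))" for i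
    by (rule Bochner_Integration.integrable_bound[OF B(2)[of i]]) (use le in \<open>auto intro!: AE_I2 simp: abs_mult\<close>)
  have "(LINT y|M. norm (\<theta> y) ^ k * cmod (\<i> * of_real (\<theta> y \<bullet> b) * f i y)) \<le> B i" for i
    using Bochner_Integration.integral_mono[OF int B(2) le] B(3)[of i] by (rule order_trans)
  with int B(1) show "\<exists>B\<in>\<B>. \<forall>i. integrable M (\<lambda>y. norm (\<theta> y) ^ k * cmod (\<i> * of_real (\<theta> y \<bullet> b) * f i y)) \<and>
        (LINT y|M. norm (\<theta> y) ^ k * cmod (\<i> * of_real (\<theta> y \<bullet> b) * f i y)) \<le> B i"
    by blast
qed

lemma osc_unif:
  assumes f: "moments_in \<B> M \<theta> f"
  shows "unif \<B> (\<lambda>i. osc M \<theta> (f i))"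
proof -
  obtain B where B: "B \<in> \<B>" "\<And>i. integrable M (\<lambda>y. norm (\<theta> y) ^ 0 * cmod (f i y))"
    "\<And>i. (LINT y|M. norm (\<theta> y) ^ 0 * cmod (f i y)) \<le> B i"
    using f unfolding moments_in_def by meson
  have "cmod (osc M \<theta> (f i) \<xi>) \<le> B i" for i \<xi>
    using order_trans[OF integral_norm_bound[of M "\<lambda>y. f i y * cis (\<xi> \<bullet> \<theta> y)"]] B(3)[of i]
    by (simp add: osc_def norm_mult)
  with B(1) show ?thesis by (auto simp: unif_def)
qed

text \<open>
  A derivative of an oscillatory integral is again one, with \<open>f\<close> multiplied by a coordinate of \<open>\<theta>\<close>. If
  all moments are under control, all derivatives are bounded.
\<close>

lemma osc_reg:
  fixes f :: "'i \<Rightarrow> 'b \<Rightarrow> complex"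
  assumes \<theta>: "\<theta> \<in> M \<rightarrow>\<^sub>M borel" and f: "moments_in \<B> M \<theta> f"
  shows "reg (unif \<B>) n (\<lambda>i. osc M \<theta> (f i))"
  using f
proof (induction n arbitrary: f)
  case 0
  then show ?case by (simp add: osc_unif)
next
  case (Suc n)
  show ?case
  proof (rule reg_SucI)
    show "unif \<B> (\<lambda>i. osc M \<theta> (f i))" by (rule osc_unif[OF Suc.prems])
    show "(osc M \<theta> (f i) has_derivative (\<lambda>h. osc M \<theta> (\<lambda>y. \<i> * of_real (\<theta> y \<bullet> h) * f i y) \<xi>)) (at \<xi>)" for i \<xi>
      using Suc.prems unfolding moments_in_def by (intro osc_has_derivative[OF \<theta>]) blast+
    show "reg (unif \<B>) n (\<lambda>i \<xi>. osc M \<theta> (\<lambda>y. \<i> * of_real (\<theta> y \<bullet> b) * f i y) \<xi>)" if "b \<in> Basis" for b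
      using that by (intro Suc.IH moments_in_mult[OF \<theta> Suc.prems]) simp
  qed
qed

lemma fourier_eq_osc: "fourier f = osc lborel (\<lambda>x. (- 2 * pi) *\<^sub>R x) f"
  by (simp add: fun_eq_iff fourier_def osc_def)

lemma inverse_fourier_eq: "inverse_fourier f x = fourier f (- x)"
  by (simp add: inverse_fourier_def fourier_def inner_commute)

lemma rapid_norm_power: "rapid \<B> f \<Longrightarrow> rapid \<B> (\<lambda>i x. of_real (norm x ^ k) * f i x)"
  unfolding rapid_def by (auto simp: mult.assoc[symmetric] power_add[symmetric] simp flip: of_real_mult of_real_power)

lemma schwartz_family_measurable: "schwartz_family \<B> f \<Longrightarrow> f i \<in> borel_measurable borel"
  by (intro schwartz_measurable schwartz_family_member)

lemma schwartz_family_rapid: "schwartz_family \<B> f \<Longrightarrow> rapid \<B> f"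
  unfolding schwartz_family_def by (metis reg.simps(1))

lemma schwartz_family_moments:
  fixes f :: "'i \<Rightarrow> 'a::euclidean_space \<Rightarrow> complex"
  assumes "bound_class \<B>" "schwartz_family \<B> f"
  shows "moments_in \<B> lborel (\<lambda>x. (- 2 * pi) *\<^sub>R x) f"
  unfolding moments_in_def
proof (intro conjI allI)
  have m [measurable]: "f i \<in> borel_measurable borel" for i
    by (rule schwartz_family_measurable[OF assms(2)])
  then show "f i \<in> borel_measurable lborel" for i by simp
  fix k
  have r: "rapid \<B> (\<lambda>i x. of_real (norm x ^ k) * f i x)"
    by (intro rapid_norm_power schwartz_family_rapid assms)
  obtain B where B: "B \<in> \<B>" "\<And>i. integrable lborel (\<lambda>x. of_real (norm x ^ k) * f i x)"
    "\<And>i. (LINT x|lborel. cmod (of_real (norm x ^ k) * f i x)) \<le> B i"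
  proof -
    have "(\<lambda>x. of_real (norm x ^ k) * f i x) \<in> borel_measurable borel" for i by measurable
    from rapid_integrable[OF assms(1) r this] that show ?thesis by blast
  qed
  have eq: "norm ((- 2 * pi) *\<^sub>R x) ^ k * cmod (f i x) = (2 * pi) ^ k * cmod (of_real (norm x ^ k) * f i x)" for x i
    by (simp add: norm_mult norm_power power_mult_distrib)
  show "\<exists>B\<in>\<B>. \<forall>i. integrable lborel (\<lambda>x. norm ((- 2 * pi) *\<^sub>R x) ^ k * cmod (f i x)) \<and>
        (LINT x|lborel. norm ((- 2 * pi) *\<^sub>R x) ^ k * cmod (f i x)) \<le> B i"
    unfolding eq
    by (rule bexI[OF _ bound_class_scale[OF assms(1) B(1), of "(2 * pi) ^ k"]])
      (auto intro!: integrable_mult_right integrable_norm B mult_left_mono simp del: norm_mult of_real_power)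
qed

lemma directional_mvt:
  fixes f :: "'a::euclidean_space \<Rightarrow> complex"
  assumes f: "\<And>x. (f has_derivative f' x) (at x)" and t: "0 < t"
  obtains s where "0 < s" "s < t" "cmod (f (x + t *\<^sub>R h) - f x) \<le> t * cmod (f' (x + s *\<^sub>R h) h)"
proof -
  have d: "((\<lambda>s. f (x + s *\<^sub>R h)) has_derivative (\<lambda>u. f' (x + s *\<^sub>R h) (u *\<^sub>R h))) (at s)" for s
    by (rule has_derivative_compose[OF _ f]) (auto intro!: derivative_eq_intros)
  obtain s where s: "s \<in> {0<..<t}"
    and le: "norm (f (x + t *\<^sub>R h) - f (x + 0 *\<^sub>R h)) \<le> norm (f' (x + s *\<^sub>R h) ((t - 0) *\<^sub>R h))"
  proof -
    have "continuous_on {0..t} (\<lambda>s. f (x + s *\<^sub>R h))"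
      by (intro continuous_at_imp_continuous_on ballI has_derivative_continuous[OF d])
    from mvt_general[OF t this d] that show ?thesis by blast
  qed
  moreover have "f' (x + s *\<^sub>R h) (t *\<^sub>R h) = t *\<^sub>R f' (x + s *\<^sub>R h) h"
    by (rule linear_scale[OF has_derivative_linear[OF f]])
  ultimately show ?thesis using t by (intro that[of s]) auto
qed

text \<open>
  Shifts by at most one cost a constant factor, so a difference quotient inherits the decay of the
  derivative.
\<close>

lemma decay_shift:
  fixes x y :: "'a::euclidean_space"
  assumes "norm y \<le> 1"
  shows "decay (x + y) \<le> 4 ^ DIM('a) * decay x"
proof -
  define n where "n = norm (x + y)"
  have "norm x \<le> n + norm y" "0 \<le> n"
    using norm_triangle_ineq4[of "x + y" y] by (simp_all add: n_def)
  then have "1 + norm x \<le> 2 * (1 + n)" using assms by argo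
  then have "1 + norm x \<le> 2 * (1 + norm (x + y))" by (simp only: n_def)
  then have "(1 + norm x) ^ (2 * DIM('a)) \<le> (2 * (1 + norm (x + y))) ^ (2 * DIM('a))"
    by (intro power_mono) auto
  also have "\<dots> = 4 ^ DIM('a) * (1 + norm (x + y)) ^ (2 * DIM('a))"
    by (simp only: power_mult_distrib) (simp add: power_mult)
  finally have *: "(1 + norm x) ^ (2 * DIM('a)) \<le> 4 ^ DIM('a) * (1 + norm (x + y)) ^ (2 * DIM('a))" .
  have "0 < (1 + norm x) ^ (2 * DIM('a))" "0 < (1 + norm (x + y)) ^ (2 * DIM('a))"
    by (auto intro!: zero_less_power add_pos_nonneg)
  with * show ?thesis by (simp add: decay_def field_simps)
qed

lemma has_derivative_cis:
  assumes "(g has_derivative g') (at x)"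
  shows "((\<lambda>x. cis (g x)) has_derivative (\<lambda>h. \<i> * of_real (g' h) * cis (g x))) (at x)"
proof -
  have "(cis has_vector_derivative \<i> * cis a) (at a)" for a
    unfolding cis_conv_exp by (rule has_vector_derivative_real_field derivative_eq_intros refl | simp)+
  then have "(cis has_derivative (\<lambda>t. \<i> * of_real t * cis a)) (at a)" for a
    by (simp add: has_vector_derivative_def scaleR_conv_of_real mult_ac)
  from has_derivative_compose[OF assms this] show ?thesis .
qed

text \<open>
  The integral of each difference quotient of \<open>f\<close> vanishes by translation invariance. The mean value
  theorem and the decay of the derivative dominate the quotients, so the limit integral vanishes too.
\<close>

lemma integral_directional_derivative:
  fixes f :: "'a::euclidean_space \<Rightarrow> complex"
  assumes d: "\<And>x. (f has_derivative f' x) (at x)" and f: "integrable lborel f"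
    and [measurable]: "(\<lambda>x. f' x b) \<in> borel_measurable borel"
    and B: "\<And>x. cmod (f' x b) \<le> B * decay x" and b: "norm b \<le> 1"
  shows "(LINT x|lborel. f' x b) = 0"
proof -
  let ?g = "\<lambda>x. f' x b"
  define t where "t n = inverse (real (Suc n))" for n
  have t: "0 < t n" "t n \<le> 1" for n by (auto simp: t_def divide_simps)
  have t0: "t \<longlonglongrightarrow> 0" unfolding t_def by (rule LIMSEQ_inverse_real_of_nat)
  define q where "q n x = (f (x + t n *\<^sub>R b) - f x) /\<^sub>R t n" for n x
  have [measurable]: "f \<in> borel_measurable borel"
    using borel_measurable_integrable[OF f] by simp
  have [measurable]: "q n \<in> borel_measurable borel" for n
    unfolding q_def by measurable
  have q_le: "cmod (q n x) \<le> 4 ^ DIM('a) * B * decay x" for n x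
  proof -
    obtain s where s: "0 < s" "s < t n"
      and le: "cmod (f (x + t n *\<^sub>R b) - f x) \<le> t n * cmod (?g (x + s *\<^sub>R b))"
      by (rule directional_mvt[OF d t(1)])
    have "s * norm b \<le> 1 * 1" using s t(2)[of n] b by (intro mult_mono) auto
    then have sb: "norm (s *\<^sub>R b) \<le> 1" using s by simp
    have "cmod (q n x) = cmod (f (x + t n *\<^sub>R b) - f x) / t n"
      using t(1)[of n] by (simp add: q_def divide_inverse mult.commute)
    also have "\<dots> \<le> cmod (?g (x + s *\<^sub>R b))"
      using le t(1)[of n] by (simp add: divide_le_eq mult.commute)
    also have "\<dots> \<le> B * decay (x + s *\<^sub>R b)" by (rule B)
    also have "\<dots> \<le> B * (4 ^ DIM('a) * decay x)"
    proof (intro mult_left_mono decay_shift sb)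
      have "0 \<le> B * decay (0::'a)" using order_trans[OF norm_ge_zero B] .
      then show "0 \<le> B" using decay_pos[of "0::'a"] by (simp add: zero_le_mult_iff)
    qed
    finally show ?thesis by (simp add: mult_ac)
  qed
  have q_lim: "(\<lambda>n. q n x) \<longlonglongrightarrow> ?g x" for x
  proof -
    have "((\<lambda>s. f (x + s *\<^sub>R b)) has_vector_derivative ?g x) (at 0)"
      unfolding has_vector_derivative_def
    proof (rule has_derivative_eq_rhs)
      show "((\<lambda>s. f (x + s *\<^sub>R b)) has_derivative (\<lambda>u. f' (x + 0 *\<^sub>R b) (u *\<^sub>R b))) (at 0)"
        by (rule has_derivative_compose[OF _ d]) (auto intro!: derivative_eq_intros)
    qed (simp add: fun_eq_iff linear_scale[OF has_derivative_linear[OF d]])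
    then have lim: "((\<lambda>s. norm (f (x + s *\<^sub>R b) - f x - s *\<^sub>R ?g x) / norm s) \<longlongrightarrow> 0) (at 0)"
      by (simp add: has_vector_derivative_def has_derivative_at)
    have "norm (f (x + s *\<^sub>R b) - f x - s *\<^sub>R ?g x) / norm s = norm ((f (x + s *\<^sub>R b) - f x) /\<^sub>R s - ?g x)"
      if "s \<noteq> 0" for s
    proof -
      have "(f (x + s *\<^sub>R b) - f x) /\<^sub>R s - ?g x = (f (x + s *\<^sub>R b) - f x - s *\<^sub>R ?g x) /\<^sub>R s"
        using that by (simp add: scaleR_diff_right)
      then show ?thesis by (simp add: divide_inverse mult.commute)
    qed
    then have "((\<lambda>s. norm ((f (x + s *\<^sub>R b) - f x) /\<^sub>R s - ?g x)) \<longlongrightarrow> 0) (at 0)"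
      by (intro Lim_transform_eventually[OF lim]) (simp add: eventually_at_filter)
    then have "((\<lambda>s. (f (x + s *\<^sub>R b) - f x) /\<^sub>R s) \<longlongrightarrow> ?g x) (at 0)"
      by (rule LIM_zero_cancel[OF tendsto_norm_zero_cancel])
    moreover have "filterlim t (at 0) sequentially"
      using t0 t(1)[THEN less_imp_neq, symmetric] by (simp add: filterlim_at)
    ultimately show ?thesis
      unfolding q_def by (rule filterlim_compose)
  qed
  have "(\<lambda>n. LINT x|lborel. q n x) \<longlonglongrightarrow> (LINT x|lborel. ?g x)"
    by (rule integral_dominated_convergence[where w="\<lambda>x. 4 ^ DIM('a) * B * decay x"])
      (auto simp: q_le q_lim intro!: integrable_mult_right integrable_decay)
  moreover have "(LINT x|lborel. q n x) = 0" for n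
    using integral_shift[OF f, of "t n *\<^sub>R b"] integrable_shift[OF f, of "t n *\<^sub>R b"] f
    by (simp add: q_def)
  ultimately show ?thesis by (simp add: LIMSEQ_const_iff)
qed

text \<open>
  Integration by parts: the derivative of \<open>f x * cis (-2\<pi> \<xi> \<bullet> x)\<close> integrates to zero.
\<close>

lemma fourier_frechet_derivative:
  fixes f :: "'a::euclidean_space \<Rightarrow> complex"
  assumes f: "schwartz f" and b: "b \<in> Basis"
  shows "fourier (\<lambda>x. deriv_at f x b) \<xi> = 2 * pi * \<i> * of_real (\<xi> \<bullet> b) * fourier f \<xi>"
proof -
  note F = schwartz_family_constI[OF f, where 'b=unit]
  have d: "(f has_derivative deriv_at f x) (at x)" for x
    using F reg_has_derivative[where f="\<lambda>_::unit. f"] unfolding schwartz_family_def by metis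
  let ?g = "\<lambda>x. deriv_at f x b"
  let ?\<theta> = "\<lambda>x. - 2 * pi * (\<xi> \<bullet> x)" and ?c = "\<i> * of_real (- 2 * pi * (\<xi> \<bullet> b))"
  have g: "schwartz ?g"
    using schwartz_family_member[OF schwartz_family_deriv[OF b F]] by simp
  have [measurable]: "f \<in> borel_measurable borel" "?g \<in> borel_measurable borel"
    using f g by (auto intro: schwartz_measurable)
  obtain A :: "unit \<Rightarrow> real" where A: "\<And>i x. cmod (?g x) \<le> A i * decay x"
    by (rule rapid_le_decay[OF bound_class_const schwartz_rapid[OF g]]) blast
  obtain B :: "unit \<Rightarrow> real" where B: "\<And>i x. cmod (f x) \<le> B i * decay x"
    by (rule rapid_le_decay[OF bound_class_const schwartz_rapid[OF f]]) blast
  have i: "integrable lborel (\<lambda>x. f x * cis (?\<theta> x))" "integrable lborel (\<lambda>x. ?g x * cis (?\<theta> x))"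
    by (intro integrable_mult_cis schwartz_integrable f g; measurable)+
  have "(LINT x|lborel. f x * (\<i> * of_real (- 2 * pi * (\<xi> \<bullet> b)) * cis (?\<theta> x)) + ?g x * cis (?\<theta> x)) = 0"
  proof (rule integral_directional_derivative[where b=b and B="A () + cmod ?c * B ()"])
    show "((\<lambda>x. f x * cis (?\<theta> x)) has_derivative
      (\<lambda>h. f x * (\<i> * of_real (- 2 * pi * (\<xi> \<bullet> h)) * cis (?\<theta> x)) + deriv_at f x h * cis (?\<theta> x))) (at x)" for x
      by (intro has_derivative_mult d has_derivative_cis) (auto intro!: derivative_eq_intros)
    show "cmod (f x * (?c * cis (?\<theta> x)) + ?g x * cis (?\<theta> x)) \<le> (A () + cmod ?c * B ()) * decay x" for x
    proof -
      have "cmod (f x * (?c * cis (?\<theta> x)) + ?g x * cis (?\<theta> x)) \<le> cmod ?c * cmod (f x) + cmod (?g x)"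
        by (rule order_trans[OF norm_triangle_ineq]) (simp add: norm_mult mult_ac)
      also have "\<dots> \<le> cmod ?c * (B () * decay x) + A () * decay x"
        by (intro add_mono mult_left_mono A B) auto
      finally show ?thesis by (simp add: algebra_simps)
    qed
  qed (use i b in auto)
  also have "(\<lambda>x. f x * (?c * cis (?\<theta> x)) + ?g x * cis (?\<theta> x)) = (\<lambda>x. ?c * (f x * cis (?\<theta> x)) + ?g x * cis (?\<theta> x))"
    by (simp add: mult_ac)
  also have "(LINT x|lborel. ?c * (f x * cis (?\<theta> x)) + ?g x * cis (?\<theta> x)) = ?c * fourier f \<xi> + fourier ?g \<xi>"
    unfolding fourier_def using i by simp
  finally show ?thesis by (simp add: add_eq_0_iff mult_ac)
qed

text \<open>
  One power of \<open>norm \<xi>\<close> is bounded by the sum of the coordinates \<open>|\<xi> \<bullet> b|\<close>, and each of these is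
  absorbed into a derivative of \<open>f\<close>. The constant \<open>2\<pi>\<close> is at least one and works in favour of the
  estimate.
\<close>

lemma fourier_rapid:
  fixes f :: "'i \<Rightarrow> 'a::euclidean_space \<Rightarrow> complex"
  assumes \<B>: "bound_class \<B>" and f: "schwartz_family \<B> f"
  shows "rapid \<B> (\<lambda>i. fourier (f i))"
proof (rule rapidI)
  fix k
  show "\<exists>B\<in>\<B>. \<forall>i \<xi>. norm \<xi> ^ k * cmod (fourier (f i) \<xi>) \<le> B i"
    using f
  proof (induction k arbitrary: f)
    case 0
    then show ?case
      using osc_unif[OF schwartz_family_moments[OF \<B>]] by (simp add: fourier_eq_osc unif_def)
  next
    case (Suc k)
    have "\<forall>b\<in>Basis. \<exists>B\<in>\<B>. \<forall>i \<xi>. norm \<xi> ^ k * cmod (fourier (\<lambda>x. deriv_at (f i) x b) \<xi>) \<le> B i"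
      by (intro ballI Suc.IH schwartz_family_deriv Suc.prems)
    then obtain B where B: "\<And>b. b \<in> Basis \<Longrightarrow> B b \<in> \<B>" and
      le: "\<And>b i \<xi>. b \<in> Basis \<Longrightarrow> norm \<xi> ^ k * cmod (fourier (\<lambda>x. deriv_at (f i) x b) \<xi>) \<le> B b i"
      by metis
    show ?case
    proof (intro bexI allI)
      show "(\<lambda>i. \<Sum>b\<in>Basis. B b i) \<in> \<B>" by (intro bound_class_sum \<B> B)
      fix i \<xi>
      let ?z = "cmod (fourier (f i) \<xi>)"
      have "norm \<xi> ^ Suc k * ?z \<le> (\<Sum>b\<in>Basis. \<bar>\<xi> \<bullet> b\<bar>) * (norm \<xi> ^ k * ?z)"
        using mult_right_mono[OF norm_le_l1[of \<xi>], of "norm \<xi> ^ k * ?z"] by (simp add: mult_ac)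
      also have "\<dots> = (\<Sum>b\<in>Basis. norm \<xi> ^ k * (1 * (\<bar>\<xi> \<bullet> b\<bar> * ?z)))"
        by (subst sum_distrib_right) (intro sum.cong, auto simp: mult_ac)
      also have "\<dots> \<le> (\<Sum>b\<in>Basis. norm \<xi> ^ k * (2 * pi * (\<bar>\<xi> \<bullet> b\<bar> * ?z)))"
        using pi_gt3 by (intro sum_mono mult_left_mono mult_right_mono) auto
      also have "\<dots> = (\<Sum>b\<in>Basis. norm \<xi> ^ k * cmod (fourier (\<lambda>x. deriv_at (f i) x b) \<xi>))"
        using schwartz_family_member[OF Suc.prems]
        by (intro sum.cong refl) (simp add: fourier_frechet_derivative norm_mult mult_ac)
      also have "\<dots> \<le> (\<Sum>b\<in>Basis. B b i)"
        by (intro sum_mono le)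
      finally show "norm \<xi> ^ Suc k * ?z \<le> (\<Sum>b\<in>Basis. B b i)" .
    qed
  qed
qed

text \<open>
  With constant bounds: the Fourier transform maps the Schwartz space into itself. With null bounds:
  it is continuous there.
\<close>

theorem schwartz_family_fourier:
  fixes f :: "'i \<Rightarrow> 'a::euclidean_space \<Rightarrow> complex"
  assumes \<B>: "bound_class \<B>" and f: "schwartz_family \<B> f"
  shows "schwartz_family \<B> (\<lambda>i. fourier (f i))"
  unfolding schwartz_family_def
proof
  fix n show "reg (rapid \<B>) n (\<lambda>i. fourier (f i))"
    using f
  proof (induction n arbitrary: f)
    case 0
    then show ?case by (simp add: fourier_rapid[OF \<B>])
  next
    case (Suc n)
    let ?\<theta> = "\<lambda>x::'a. (- 2 * pi) *\<^sub>R x"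
    show ?case
    proof (rule reg_SucI)
      show "rapid \<B> (\<lambda>i. fourier (f i))" by (rule fourier_rapid[OF \<B> Suc.prems])
      have m: "moments_in \<B> lborel ?\<theta> f" by (rule schwartz_family_moments[OF \<B> Suc.prems])
      show "(fourier (f i) has_derivative (\<lambda>h. fourier (\<lambda>y. \<i> * of_real (?\<theta> y \<bullet> h) * f i y) \<xi>)) (at \<xi>)" for i \<xi>
        unfolding fourier_eq_osc
        by (rule osc_has_derivative) (use m in \<open>auto simp: moments_in_def simp del: norm_scaleR\<close>)
      fix b :: 'a assume b: "b \<in> Basis"
      have "schwartz_family \<B> (\<lambda>i y. (\<i> * of_real (- 2 * pi)) * (of_real (y \<bullet> b) * f i y))"
        by (intro schwartz_family_cmult schwartz_family_coord \<B> b Suc.prems)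
      then show "reg (rapid \<B>) n (\<lambda>i \<xi>. fourier (\<lambda>y. \<i> * of_real (?\<theta> y \<bullet> b) * f i y) \<xi>)"
        by (intro Suc.IH) (simp add: mult_ac)
    qed
  qed
qed

lemma schwartz_fourier: "schwartz f \<Longrightarrow> schwartz (fourier f)"
  by (rule schwartz_familyD) (intro schwartz_family_fourier[OF bound_class_const] schwartz_family_constI)

lemma schwartz_inverse_fourier: "schwartz f \<Longrightarrow> schwartz (inverse_fourier f)"
  unfolding inverse_fourier_eq[abs_def] by (intro schwartz_uminus_arg schwartz_fourier)

lemma inverse_fourier_fourier:
  assumes "schwartz f"
  shows "inverse_fourier (fourier f) = f"
proof
  fix x
  obtain C where "\<And>x. norm x ^ 0 * cmod (f x) \<le> C"
    using schwartz_decay[OF assms] by metis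
  then show "inverse_fourier (fourier f) x = f x"
    using assms by (intro fourier_inversion[where C=C] schwartz_integrable schwartz_continuous schwartz_fourier) auto
qed

lemma fourier_inverse_fourier:
  assumes "schwartz f"
  shows "fourier (inverse_fourier f) = f"
proof
  fix \<xi>
  let ?h = "\<lambda>x. fourier f x * cis (2 * pi * (\<xi> \<bullet> x))"
  have [measurable]: "fourier f \<in> borel_measurable borel"
    using assms by (intro schwartz_measurable schwartz_fourier)
  have "integrable lborel ?h"
    by (intro integrable_mult_cis schwartz_integrable schwartz_fourier assms) measurable
  then have "(LINT x|lborel. ?h (- x)) = (LINT x|lborel. ?h x)"
    by (rule integral_reflect)
  then have "fourier (inverse_fourier f) \<xi> = inverse_fourier (fourier f) \<xi>"
    by (simp add: fourier_def[of "inverse_fourier f"] inverse_fourier_eq[of f] inverse_fourier_def[of "fourier f"] inner_commute)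
  then show "fourier (inverse_fourier f) \<xi> = f \<xi>"
    by (simp add: inverse_fourier_fourier[OF assms])
qed

section \<open>Fourier series of functions supported in a cell\<close>

definition grid :: "'a::euclidean_space \<Rightarrow> 'a set" where
  "grid s = {l. \<forall>b\<in>Basis. \<exists>k::int. l \<bullet> b = of_int k * (s \<bullet> b)}"

text \<open>
  The closed fundamental domain, centred at the origin, of the lattice dual to \<open>grid s\<close>.
\<close>

definition cell :: "'a::euclidean_space \<Rightarrow> 'a set" where
  "cell s = {w. \<forall>b\<in>Basis. \<bar>w \<bullet> b\<bar> \<le> 1 / (2 * (s \<bullet> b))}"

lemma integral_count_space_supported:
  fixes f :: "'b \<Rightarrow> 'c::{banach, second_countable_topology}"
  assumes F: "finite F" "F \<subseteq> A" and out: "\<And>l. l \<notin> F \<Longrightarrow> f l = 0"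
  shows "(LINT l|count_space A. f l) = (\<Sum>l\<in>F. f l)"
proof -
  have "(LINT l|count_space A. f l) = (\<Sum>l | l \<in> A \<and> f l \<noteq> 0. f l)"
    by (rule lebesgue_integral_count_space_finite_support) (use out in \<open>auto intro: finite_subset[OF _ F(1)]\<close>)
  also have "\<dots> = (\<Sum>l\<in>F. f l)"
    by (rule sum.mono_neutral_left) (use F out in auto)
  finally show ?thesis .
qed

lemma grid_zero: "0 \<in> grid s"
  by (auto simp: grid_def intro: exI[of _ 0])

lemma grid_add: "l \<in> grid s \<Longrightarrow> m \<in> grid s \<Longrightarrow> l + m \<in> grid s"
  unfolding grid_def by (simp add: inner_add_left) (metis distrib_right of_int_add)

lemma grid_uminus: "l \<in> grid s \<Longrightarrow> - l \<in> grid s"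
  unfolding grid_def by (simp add: inner_minus_left) (metis minus_mult_left of_int_minus)

lemma grid_axis: "b \<in> Basis \<Longrightarrow> (s \<bullet> b) *\<^sub>R b \<in> grid s"
  unfolding grid_def by (auto simp: inner_Basis)

lemma grid_bij:
  assumes "\<And>b. b \<in> Basis \<Longrightarrow> 0 < s \<bullet> b"
  shows "bij_betw (\<lambda>k::'a \<Rightarrow> int. \<Sum>b\<in>Basis. (of_int (k b) * (s \<bullet> b)) *\<^sub>R b) (PiE Basis (\<lambda>_. UNIV)) (grid (s::'a::euclidean_space))"
proof (rule bij_betwI[where g="\<lambda>l. restrict (\<lambda>b. \<lfloor>(l \<bullet> b) / (s \<bullet> b)\<rfloor>) Basis"])
  show "(\<lambda>k::'a \<Rightarrow> int. \<Sum>b\<in>Basis. (of_int (k b) * (s \<bullet> b)) *\<^sub>R b) \<in> PiE Basis (\<lambda>_. UNIV) \<rightarrow> grid s"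
    by (auto simp: grid_def)
  show "restrict (\<lambda>b. \<lfloor>((\<Sum>b\<in>Basis. (of_int (k b) * (s \<bullet> b)) *\<^sub>R b) \<bullet> b) / (s \<bullet> b)\<rfloor>) Basis = k"
    if "k \<in> PiE Basis (\<lambda>_. UNIV)" for k :: "'a \<Rightarrow> int"
    using that assms[THEN less_imp_neq] by (auto simp: fun_eq_iff PiE_def extensional_def restrict_def)
  show "(\<Sum>b\<in>Basis. (of_int (restrict (\<lambda>b. \<lfloor>(l \<bullet> b) / (s \<bullet> b)\<rfloor>) Basis b) * (s \<bullet> b)) *\<^sub>R b) = l"
    if l: "l \<in> grid s" for l
  proof (rule euclidean_eqI)
    fix b :: 'a assume b: "b \<in> Basis"
    then obtain k :: int where "l \<bullet> b = of_int k * (s \<bullet> b)" using l unfolding grid_def by blast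
    then show "(\<Sum>b\<in>Basis. (of_int (restrict (\<lambda>b. \<lfloor>(l \<bullet> b) / (s \<bullet> b)\<rfloor>) Basis b) * (s \<bullet> b)) *\<^sub>R b) \<bullet> b = l \<bullet> b"
      using b assms[OF b] by simp
  qed
qed auto

lemma countable_grid:
  assumes "\<And>b. b \<in> Basis \<Longrightarrow> 0 < s \<bullet> b"
  shows "countable (grid (s::'a::euclidean_space))"
proof -
  have "countable (PiE (Basis::'a set) (\<lambda>_. UNIV :: int set))"
    by (intro countable_PiE) auto
  then show ?thesis
    by (subst bij_betw_imp_surj_on[OF grid_bij[OF assms], symmetric]) (assumption | rule countable_image)+
qed

lemma summable_int_inverse_square:
  assumes "0 < (r::real)"
  shows "integrable (count_space UNIV) (\<lambda>k::int. inverse (1 + (of_int k * r)\<^sup>2))"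
proof -
  let ?f = "\<lambda>k::int. inverse (1 + (of_int k * r)\<^sup>2)"
  let ?g = "\<lambda>n::nat. inverse (1 + (real n * r)\<^sup>2)"
  have "summable (\<lambda>n::nat. norm (?g n))"
  proof (rule summable_comparison_test')
    show "summable (\<lambda>n::nat. inverse (r\<^sup>2) * inverse (real n ^ 2))"
      by (intro summable_mult inverse_power_summable) simp
    fix n :: nat assume "1 \<le> n"
    then have "inverse (1 + (real n * r)\<^sup>2) \<le> inverse ((real n * r)\<^sup>2)"
      using assms by (intro le_imp_inverse_le) auto
    then show "norm (norm (?g n)) \<le> inverse (r\<^sup>2) * inverse (real n ^ 2)"
      by (simp add: power_mult_distrib mult.commute abs_of_nonneg add_nonneg_nonneg)
  qed
  then have n: "integrable (count_space UNIV) ?g"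
    by (simp only: integrable_count_space_nat_iff)
  have 1: "integrable (count_space (range int)) ?f"
    using n integrable_bij_count_space[OF inj_on_imp_bij_betw[of int UNIV], of ?f] by simp
  have 2: "integrable (count_space (range (\<lambda>n. - int n))) ?f"
    using n integrable_bij_count_space[OF inj_on_imp_bij_betw[of "\<lambda>n. - int n" UNIV], of ?f]
    by (simp add: inj_def)
  have "range int \<union> range (\<lambda>n. - int n) = UNIV"
    by (auto simp: image_iff) (metis int_cases2)
  then show ?thesis
    using abs_summable_on_union[unfolded abs_summable_on_def, OF 1 2] by simp
qed

lemma integrable_grid_decay:
  fixes s :: "'a::euclidean_space"
  assumes s: "\<And>b. b \<in> Basis \<Longrightarrow> 0 < s \<bullet> b"
  shows "integrable (count_space (grid s)) decay"
proof (rule Bochner_Integration.integrable_bound)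
  let ?g = "\<lambda>k::'a \<Rightarrow> int. \<Sum>b\<in>Basis. (of_int (k b) * (s \<bullet> b)) *\<^sub>R b"
  let ?P = "\<lambda>x::'a. \<Prod>b\<in>Basis. inverse (1 + (x \<bullet> b)\<^sup>2)"
  have "integrable (count_space (PiE Basis (\<lambda>_. UNIV)))
      (\<lambda>k::'a \<Rightarrow> int. \<Prod>b\<in>Basis. inverse (1 + (of_int (k b) * (s \<bullet> b))\<^sup>2))"
    by (rule abs_summable_on_prod_PiE[unfolded abs_summable_on_def]) (auto intro: summable_int_inverse_square s)
  then have "integrable (count_space (PiE Basis (\<lambda>_. UNIV))) (\<lambda>k::'a \<Rightarrow> int. ?P (?g k))"
    by simp
  moreover have "bij_betw ?g (PiE Basis (\<lambda>_. UNIV)) (grid s)"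
    by (rule grid_bij[OF s])
  ultimately show "integrable (count_space (grid s)) ?P"
    using integrable_bij_count_space[where f="?P"] by blast
  show "AE x in count_space (grid s). norm (decay x) \<le> norm (?P x)"
    by (simp add: abs_of_pos[OF decay_pos] prod_nonneg decay_le_prod)
qed auto

lemma grid_moments:
  fixes s :: "'a::euclidean_space"
  assumes s: "\<And>b. b \<in> Basis \<Longrightarrow> 0 < s \<bullet> b" and h: "schwartz h"
  shows "integrable (count_space (grid s)) (\<lambda>l. norm ((2 * pi) *\<^sub>R l) ^ k * cmod (h l))"
proof -
  have r: "rapid const_bounds (\<lambda>_::unit. \<lambda>x. of_real (norm x ^ k) * h x)"
    by (intro rapid_norm_power schwartz_rapid h)
  obtain B :: "unit \<Rightarrow> real" where B: "\<And>i x. cmod (of_real (norm x ^ k) * h x) \<le> B i * decay x"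
    by (rule rapid_le_decay[OF bound_class_const r]) blast
  show ?thesis
  proof (rule Bochner_Integration.integrable_bound)
    show "integrable (count_space (grid s)) (\<lambda>x. ((2 * pi) ^ k * B ()) * decay x)"
      by (intro integrable_mult_right integrable_grid_decay s)
    have "norm (norm ((2 * pi) *\<^sub>R l) ^ k * cmod (h l)) \<le> norm ((2 * pi) ^ k * B () * decay l)" for l
    proof -
      have "norm (norm ((2 * pi) *\<^sub>R l) ^ k * cmod (h l)) = (2 * pi) ^ k * cmod (of_real (norm l ^ k) * h l)"
        by (simp add: norm_mult norm_power power_mult_distrib)
      also have "\<dots> \<le> (2 * pi) ^ k * (B () * decay l)"
        by (intro mult_left_mono B) auto
      also have "\<dots> \<le> norm ((2 * pi) ^ k * B () * decay l)"
        unfolding real_norm_def mult.assoc by (rule abs_ge_self)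
      finally show ?thesis .
    qed
    then show "AE l in count_space (grid s). norm (norm ((2 * pi) *\<^sub>R l) ^ k * cmod (h l)) \<le> norm ((2 * pi) ^ k * B () * decay l)"
      by simp
  qed auto
qed

lemma compact_cell: "compact (cell (s::'a::euclidean_space))"
proof -
  have "cell s = cbox (\<Sum>b\<in>Basis. (- (1 / (2 * (s \<bullet> b)))) *\<^sub>R b) (\<Sum>b\<in>Basis. (1 / (2 * (s \<bullet> b))) *\<^sub>R b)"
    by (simp add: cell_def cbox_def abs_le_iff minus_le_iff conj_commute sum_negf)
  then show ?thesis by simp
qed

lemma cell_measurable [measurable]: "cell (s::'a::euclidean_space) \<in> sets borel"
  by (intro borel_closed compact_imp_closed compact_cell)

lemma integral_cis_interval:
  fixes r :: real and k :: int
  assumes "0 < r"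
  shows "integrable lborel (\<lambda>t. indicator {- 1 / (2 * r)..1 / (2 * r)} t * cis (2 * pi * (of_int k * r) * t))"
    and "(LINT t|lborel. indicator {- 1 / (2 * r)..1 / (2 * r)} t * cis (2 * pi * (of_int k * r) * t)) = (if k = 0 then of_real (1 / r) else 0)"
proof -
  define m where "m = 2 * pi * (of_int k * r)"
  let ?I = "{- 1 / (2 * r)..1 / (2 * r)}"
  have le: "- 1 / (2 * r) \<le> 1 / (2 * r)" using assms by simp
  have e: "indicator ?I t * cis (m * t) = indicator ?I t *\<^sub>R cis (m * t)" for t
    by (simp add: indicator_def)
  have "set_integrable lborel ?I (\<lambda>t. cis (m * t))"
    by (intro borel_integrable_atLeastAtMost' continuous_intros)
  then show "integrable lborel (\<lambda>t. indicator ?I t * cis (2 * pi * (of_int k * r) * t))"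
    unfolding m_def[symmetric] e set_integrable_def .
  show "(LINT t|lborel. indicator ?I t * cis (2 * pi * (of_int k * r) * t)) = (if k = 0 then of_real (1 / r) else 0)"
  proof (cases "k = 0")
    case True
    have "(LINT t|lborel. (indicator ?I t :: complex)) = (LINT t|lborel. complex_of_real (indicator ?I t))"
      by (intro Bochner_Integration.integral_cong) (auto simp: indicator_def)
    also have "\<dots> = of_real (1 / r)"
      unfolding integral_complex_of_real using assms le by (simp add: field_simps)
    finally have "(LINT t|lborel. (indicator ?I t :: complex)) = of_real (1 / r)" .
    with True show ?thesis by simp
  next
    case False
    then have m: "m \<noteq> 0" using assms by (simp add: m_def)
    define F where "F t = cis (m * t) / (\<i> * of_real m)" for t
    have "(LBINT t=- 1 / (2 * r)..1 / (2 * r). cis (m * t)) = F (1 / (2 * r)) - F (- 1 / (2 * r))"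
    proof (rule interval_integral_FTC_finite)
      show "continuous_on {min (- 1 / (2 * r)) (1 / (2 * r))..max (- 1 / (2 * r)) (1 / (2 * r))} (\<lambda>t. cis (m * t))"
        by (intro continuous_intros)
      fix t
      show "(F has_vector_derivative cis (m * t)) (at t within {min (- 1 / (2 * r)) (1 / (2 * r))..max (- 1 / (2 * r)) (1 / (2 * r))})"
        unfolding F_def cis_conv_exp
        by (rule has_vector_derivative_real_field derivative_eq_intros refl | simp add: m mult_ac)+
    qed
    also have "m * (1 / (2 * r)) = pi * of_int k" "m * (- 1 / (2 * r)) = - (pi * of_int k)"
      using assms by (simp_all add: m_def)
    then have "F (1 / (2 * r)) - F (- 1 / (2 * r)) = (cis (pi * of_int k) - cis (- (pi * of_int k))) / (\<i> * of_real m)"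
      by (simp only: F_def diff_divide_distrib)
    also have "cis (pi * of_int k) = cis (- (pi * of_int k))"
      by (simp add: complex_eq_iff sin_times_pi_eq_0 mult.commute[of pi])
    finally have "(LBINT t=- 1 / (2 * r)..1 / (2 * r). cis (m * t)) = 0" by simp
    then show ?thesis
      unfolding m_def[symmetric] e using False le
      by (simp add: interval_integral_Icc set_lebesgue_integral_def)
  qed
qed

text \<open>
  Exponentials with frequencies in \<open>grid s\<close> are orthogonal on the cell.
\<close>

lemma integral_cell_cis:
  fixes s :: "'a::euclidean_space"
  assumes s: "\<And>b. b \<in> Basis \<Longrightarrow> 0 < s \<bullet> b" and l: "l \<in> grid s"
  shows "(LINT w|lborel. indicator (cell s) w * cis (2 * pi * (l \<bullet> w))) =
    (if l = 0 then inverse (of_real (\<Prod>b\<in>Basis. s \<bullet> b)) else 0)"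
proof -
  have "\<forall>b\<in>Basis. \<exists>k::int. l \<bullet> b = of_int k * (s \<bullet> b)" using l by (simp add: grid_def)
  then obtain k :: "'a \<Rightarrow> int" where k: "\<And>b. b \<in> Basis \<Longrightarrow> l \<bullet> b = of_int (k b) * (s \<bullet> b)" by metis
  let ?\<phi> = "\<lambda>b t. indicator {- 1 / (2 * (s \<bullet> b))..1 / (2 * (s \<bullet> b))} t * cis (2 * pi * (of_int (k b) * (s \<bullet> b)) * t)"
  have "indicator (cell s) w * cis (2 * pi * (l \<bullet> w)) = (\<Prod>b\<in>Basis. ?\<phi> b (w \<bullet> b))" for w
  proof -
    have "2 * pi * (l \<bullet> w) = (\<Sum>b\<in>Basis. 2 * pi * (of_int (k b) * (s \<bullet> b)) * (w \<bullet> b))"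
      by (simp add: euclidean_inner[of l w] k sum_distrib_left mult_ac)
    moreover have "(indicator (cell s) w :: complex) = (\<Prod>b\<in>Basis. indicator {- 1 / (2 * (s \<bullet> b))..1 / (2 * (s \<bullet> b))} (w \<bullet> b))"
    proof (cases "w \<in> cell s")
      case True
      then have "w \<bullet> b \<in> {- 1 / (2 * (s \<bullet> b))..1 / (2 * (s \<bullet> b))}" if "b \<in> Basis" for b
        using that by (auto simp: cell_def abs_le_iff minus_le_iff)
      with True show ?thesis by simp
    next
      case False
      then obtain b where b: "b \<in> Basis" "w \<bullet> b \<notin> {- 1 / (2 * (s \<bullet> b))..1 / (2 * (s \<bullet> b))}"
        by (auto simp: cell_def abs_le_iff minus_le_iff)
      then have "(\<Prod>b\<in>Basis. indicator {- 1 / (2 * (s \<bullet> b))..1 / (2 * (s \<bullet> b))} (w \<bullet> b)) = (0::complex)"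
        by (intro prod_zero finite_Basis bexI[of _ b]) (simp_all add: indicator_def del: atLeastAtMost_iff)
      with False show ?thesis by simp
    qed
    ultimately show ?thesis by (simp add: cis_sum prod.distrib)
  qed
  then have "(LINT w|lborel. indicator (cell s) w * cis (2 * pi * (l \<bullet> w))) = (LINT w|lborel. (\<Prod>b\<in>Basis. ?\<phi> b (w \<bullet> b)))"
    by simp
  also have "\<dots> = (\<Prod>b\<in>Basis. LINT t|lborel. ?\<phi> b t)"
    by (intro integral_prod_Basis integral_cis_interval s)
  also have "\<dots> = (\<Prod>b\<in>Basis. if k b = 0 then of_real (1 / (s \<bullet> b)) else 0)"
    by (intro prod.cong refl integral_cis_interval s)
  also have "\<dots> = (if l = 0 then inverse (of_real (\<Prod>b\<in>Basis. s \<bullet> b)) else 0)"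
  proof (cases "l = 0")
    case True
    then have "k b = 0" if "b \<in> Basis" for b using k[OF that] s[OF that] by simp
    then have "(\<Prod>b\<in>Basis. if k b = 0 then of_real (1 / (s \<bullet> b)) else 0) = (\<Prod>b\<in>Basis. complex_of_real (inverse (s \<bullet> b)))"
      by (intro prod.cong) (auto simp: divide_inverse)
    with True show ?thesis by (simp add: prod_inversef[symmetric] flip: of_real_prod of_real_inverse)
  next
    case False
    then obtain b where b: "b \<in> Basis" "l \<bullet> b \<noteq> 0" by (metis euclidean_all_zero_iff)
    then have "k b \<noteq> 0" using k by auto
    with b False show ?thesis by (auto intro!: prod_zero)
  qed
  finally show ?thesis .
qed

text \<open>
  Trigonometric polynomials with frequencies in \<open>grid s\<close>.
\<close>

inductive_set trig :: "'a::euclidean_space \<Rightarrow> ('a \<Rightarrow> complex) set" for s where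
  trig_cis: "m \<in> grid s \<Longrightarrow> (\<lambda>w. c * cis (2 * pi * (m \<bullet> w))) \<in> trig s"
| trig_add: "p \<in> trig s \<Longrightarrow> q \<in> trig s \<Longrightarrow> (\<lambda>w. p w + q w) \<in> trig s"

lemma trig_mult_cis:
  assumes "m \<in> grid s" "p \<in> trig s"
  shows "(\<lambda>w. c * cis (2 * pi * (m \<bullet> w)) * p w) \<in> trig s"
  using assms(2)
proof induction
  case (trig_cis m' c')
  have "c * cis (2 * pi * (m \<bullet> w)) * (c' * cis (2 * pi * (m' \<bullet> w))) = (c * c') * cis (2 * pi * ((m + m') \<bullet> w))" for w
    by (simp add: inner_add_left distrib_left cis_mult[symmetric])
  with trig.trig_cis[OF grid_add[OF assms(1) trig_cis], of "c * c'"] show ?case by (simp only:)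
qed (simp add: distrib_left trig_add)

lemma trig_mult: "p \<in> trig s \<Longrightarrow> q \<in> trig s \<Longrightarrow> (\<lambda>w. p w * q w) \<in> trig s"
  by (induction rule: trig.induct) (auto simp: distrib_right intro: trig_mult_cis trig_add)

lemma trig_const: "(\<lambda>_. c) \<in> trig s"
  using trig_cis[OF grid_zero, of c s] by simp

lemma trig_power: "p \<in> trig s \<Longrightarrow> (\<lambda>w. p w ^ n) \<in> trig s"
  by (induction n) (auto intro: trig_const trig_mult)

lemma trig_sum: "(\<And>j. j \<in> J \<Longrightarrow> p j \<in> trig s) \<Longrightarrow> (\<lambda>w. \<Sum>j\<in>J. p j w) \<in> trig s"
  by (induction J rule: infinite_finite_induct) (auto intro: trig_const trig_add)

lemma trig_cos:
  assumes "m \<in> grid s"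
  shows "(\<lambda>w. complex_of_real (cos (2 * pi * (m \<bullet> (w - w0))))) \<in> trig s"
proof -
  let ?c = "cis (- (2 * pi * (m \<bullet> w0))) / 2"
  have "complex_of_real (cos (2 * pi * (m \<bullet> (w - w0)))) =
      ?c * cis (2 * pi * (m \<bullet> w)) + cnj ?c * cis (2 * pi * (- m \<bullet> w))" for w
  proof -
    have "complex_of_real (cos x) = (cis x + cis (- x)) / 2" for x
      by (simp add: complex_eq_iff)
    then show ?thesis
      by (simp add: cis_cnj cis_mult inner_diff_right algebra_simps add_divide_distrib)
  qed
  then show ?thesis
    using trig_add[OF trig_cis[OF assms] trig_cis[OF grid_uminus[OF assms]]] by (simp only:)
qed

lemma orthogonal_trig:
  fixes D :: "'a::euclidean_space \<Rightarrow> complex"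
  assumes D: "integrable lborel D"
    and orth: "\<And>m. m \<in> grid s \<Longrightarrow> (LINT w|lborel. D w * cis (2 * pi * (m \<bullet> w))) = 0"
    and "q \<in> trig s"
  shows "integrable lborel (\<lambda>w. D w * q w) \<and> (LINT w|lborel. D w * q w) = 0"
  using assms(3)
proof induction
  case (trig_cis m c)
  have [measurable]: "D \<in> borel_measurable borel" using borel_measurable_integrable[OF D] by simp
  have "integrable lborel (\<lambda>w. c * (D w * cis (2 * pi * (m \<bullet> w))))"
    by (intro integrable_mult_right integrable_mult_cis D) measurable
  moreover have "(LINT w|lborel. c * (D w * cis (2 * pi * (m \<bullet> w)))) = 0"
    by (simp add: orth trig_cis)
  ultimately show ?case by (simp add: mult.left_commute)
qed (simp add: distrib_left)

definition cos_mean :: "'a::euclidean_space \<Rightarrow> 'a \<Rightarrow> 'a \<Rightarrow> real" where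
  "cos_mean s w0 w = (\<Sum>b\<in>Basis. cos (2 * pi * (((s \<bullet> b) *\<^sub>R b) \<bullet> (w - w0)))) / DIM('a)"

text \<open>
  Each \<open>s \<bullet> b * (w \<bullet> b - w0 \<bullet> b)\<close> has modulus less than one, because \<open>w\<close> lies in the cell and \<open>w0\<close> in its
  interior. So all cosines can equal one only at \<open>w = w0\<close>.
\<close>

lemma cos_mean_lt_1:
  fixes s w w0 :: "'a::euclidean_space"
  assumes s: "\<And>b. b \<in> Basis \<Longrightarrow> 0 < s \<bullet> b"
    and w0: "\<And>b. b \<in> Basis \<Longrightarrow> \<bar>w0 \<bullet> b\<bar> < 1 / (2 * (s \<bullet> b))"
    and w: "w \<in> cell s" "w \<noteq> w0"
  shows "cos_mean s w0 w < 1"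
proof -
  obtain b where b: "b \<in> Basis" "w \<bullet> b \<noteq> w0 \<bullet> b"
    using w(2) by (metis euclidean_eqI)
  have "cos (2 * pi * (((s \<bullet> b) *\<^sub>R b) \<bullet> (w - w0))) \<noteq> 1"
  proof
    assume "cos (2 * pi * (((s \<bullet> b) *\<^sub>R b) \<bullet> (w - w0))) = 1"
    then obtain n :: int where n: "2 * pi * (((s \<bullet> b) *\<^sub>R b) \<bullet> (w - w0)) = of_int n * 2 * pi"
      unfolding cos_one_2pi_int by auto
    then have "((s \<bullet> b) *\<^sub>R b) \<bullet> (w - w0) = of_int n" by simp
    then have n': "(s \<bullet> b) * (w \<bullet> b - w0 \<bullet> b) = of_int n"
      by (simp add: inner_diff_right inner_commute[of b] right_diff_distrib)
    have "\<bar>w \<bullet> b\<bar> \<le> 1 / (2 * (s \<bullet> b))" using w(1) b by (auto simp: cell_def)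
    then have "\<bar>w \<bullet> b - w0 \<bullet> b\<bar> < 1 / (2 * (s \<bullet> b)) + 1 / (2 * (s \<bullet> b))"
      using w0[OF b(1)] by linarith
    then have "\<bar>w \<bullet> b - w0 \<bullet> b\<bar> < 1 / (s \<bullet> b)" by simp
    then have "(s \<bullet> b) * \<bar>w \<bullet> b - w0 \<bullet> b\<bar> < 1" using s[OF b(1)] by (simp add: field_simps)
    then have "\<bar>of_int n :: real\<bar> < 1" using s[OF b(1)] n' by (simp add: abs_mult flip: n')
    then have "n = 0" by linarith
    with n' b s[OF b(1)] show False by simp
  qed
  then have "(\<Sum>b\<in>Basis. cos (2 * pi * (((s \<bullet> b) *\<^sub>R b) \<bullet> (w - w0)))) < (\<Sum>b\<in>(Basis::'a set). 1)"
    using b by (intro sum_strict_mono_ex1) (auto intro!: bexI[of _ b] simp: order.strict_iff_order)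
  then show ?thesis by (simp add: cos_mean_def divide_less_eq)
qed

text \<open>
  Uniqueness of Fourier coefficients, at a point of continuity. Suppose \<open>D w0 \<noteq> 0\<close> and let \<open>mc\<close> be the
  mean of the cosines of period \<open>1 / (s \<bullet> b)\<close> centred at \<open>w0\<close>. For a small \<open>\<eta> > 0\<close> the trigonometric
  polynomial \<open>\<eta> + mc\<close> exceeds \<open>1 + \<eta>/2\<close> near \<open>w0\<close> and has modulus at most one in the rest of the cell.
  Its even powers concentrate at \<open>w0\<close>: their integrals against \<open>R = Re (cnj (D w0) * D)\<close> would tend to
  infinity, but they are zero by orthogonality.
\<close>

lemma orthogonal_imp_zero:
  fixes D :: "'a::euclidean_space \<Rightarrow> complex" and s w0 :: 'a
  assumes s: "\<And>b. b \<in> Basis \<Longrightarrow> 0 < s \<bullet> b"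
    and w0: "\<And>b. b \<in> Basis \<Longrightarrow> \<bar>w0 \<bullet> b\<bar> < 1 / (2 * (s \<bullet> b))"
    and D: "integrable lborel D" and out: "\<And>w. w \<notin> cell s \<Longrightarrow> D w = 0" and cont: "isCont D w0"
    and orth: "\<And>m. m \<in> grid s \<Longrightarrow> (LINT w|lborel. D w * cis (2 * pi * (m \<bullet> w))) = 0"
  shows "D w0 = 0"
proof (rule ccontr)
  assume ne: "D w0 \<noteq> 0"
  define R where "R w = Re (cnj (D w0) * D w)" for w
  define d where "d = (cmod (D w0))\<^sup>2 / 2"
  define mc where "mc w = cos_mean s w0 w" for w
  have d: "d > 0" using ne by (simp add: d_def)
  have "cnj (D w0) * D w0 = of_real ((cmod (D w0))\<^sup>2)" 
    using complex_norm_square[of "D w0"] by (simp only: mult.commute)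
  then have R0: "R w0 = 2 * d" by (simp add: R_def d_def)
  have intR: "integrable lborel R"
    unfolding R_def using D by (intro integrable_Re integrable_mult_right)
  have cR: "isCont R w0" unfolding R_def by (intro isCont_Re isCont_mult continuous_const cont)
  have cmc: "isCont mc w" for w unfolding mc_def cos_mean_def by (intro continuous_intros) auto
  have mc0: "mc w0 = 1" by (simp add: mc_def cos_mean_def)
  have mc_ge: "- 1 \<le> mc w" for w
  proof -
    have "(\<Sum>b\<in>(Basis::'a set). - 1) \<le> (\<Sum>b\<in>Basis. cos (2 * pi * (((s \<bullet> b) *\<^sub>R b) \<bullet> (w - w0))))"
      by (intro sum_mono) auto
    then show ?thesis by (simp add: mc_def cos_mean_def le_divide_eq)
  qed
  obtain r where r: "r > 0" "\<And>w. dist w w0 < r \<Longrightarrow> dist (R w) (R w0) < d"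
    using cR d unfolding continuous_at_eps_delta by blast
  then have U: "d \<le> R w" if "dist w w0 < r" for w
    using r(2)[OF that] R0 by (simp add: dist_real_def)
  obtain \<eta> where \<eta>: "\<eta> > 0" and far: "\<And>w. w \<in> cell s \<Longrightarrow> r \<le> dist w w0 \<Longrightarrow> \<bar>\<eta> + mc w\<bar> \<le> 1"
  proof (cases "cell s - ball w0 r = {}")
    case True
    then show ?thesis by (intro that[of 1]) (auto simp: dist_commute)
  next
    case False
    have "compact (cell s - ball w0 r)" by (intro compact_diff compact_cell) auto
    then obtain w1 where w1: "w1 \<in> cell s - ball w0 r" "\<And>w. w \<in> cell s - ball w0 r \<Longrightarrow> mc w \<le> mc w1"
      using continuous_attains_sup[of _ mc] False cmc by (metis continuous_at_imp_continuous_on)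
    have lt: "mc w1 < 1"
      unfolding mc_def by (rule cos_mean_lt_1[OF s w0]) (use w1(1) r(1) in auto)
    show ?thesis
    proof (rule that[of "(1 - mc w1) / 2"])
      fix w assume "w \<in> cell s" "r \<le> dist w w0"
      then have "mc w \<le> mc w1" by (intro w1) (auto simp: dist_commute)
      then show "\<bar>(1 - mc w1) / 2 + mc w\<bar> \<le> 1" using lt mc_ge[of w] by (auto simp: abs_le_iff field_simps)
    qed (use lt in simp)
  qed
  obtain r' where r': "r' > 0" "\<And>w. dist w w0 < r' \<Longrightarrow> dist (mc w) (mc w0) < \<eta> / 2"
    using cmc[of w0] half_gt_zero[OF \<eta>] unfolding continuous_at_eps_delta by blast
  define V where "V = ball w0 (min r r')"
  have V: "1 + \<eta> / 2 \<le> \<eta> + mc w" "d \<le> R w" if "w \<in> V" for w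
  proof -
    have w: "dist w w0 < r" "dist w w0 < r'" using that by (auto simp: V_def dist_commute)
    have "\<bar>mc w - 1\<bar> < \<eta> / 2" using r'(2)[OF w(2)] by (simp only: mc0 dist_real_def)
    then have "- (mc w - 1) < \<eta> / 2" by (simp only: abs_less_iff)
    then show "1 + \<eta> / 2 \<le> \<eta> + mc w" by argo
    show "d \<le> R w" by (rule U[OF w(1)])
  qed
  define v where "v = measure lborel V"
  have v: "v > 0"
    unfolding v_def V_def using r(1) r'(1) by (simp add: content_ball_pos)
  have V_int: "integrable lborel (\<lambda>w. indicator V w * x)" for x :: real
    unfolding V_def by (intro integrable_mult_left integrable_real_indicator) (use emeasure_bounded_finite[OF bounded_ball, of w0 "min r r'"] in simp_all)
  have bound: "d * (1 + \<eta> / 2) ^ (2 * n) * v \<le> (LINT w|lborel. \<bar>R w\<bar>)" for n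
  proof -
    \<comment> \<open>The exponent is even, so that the power is nonnegative also where \<open>\<eta> + mc w < 0\<close>.\<close>
    let ?q = "\<lambda>w. complex_of_real (\<eta> + mc w) ^ (2 * n)"
    have "complex_of_real (\<eta> + mc w) = of_real \<eta> +
       of_real (1 / DIM('a)) * (\<Sum>b\<in>Basis. complex_of_real (cos (2 * pi * (((s \<bullet> b) *\<^sub>R b) \<bullet> (w - w0)))))" for w
      by (simp add: mc_def cos_mean_def)
    then have "(\<lambda>w. complex_of_real (\<eta> + mc w)) \<in> trig s"
      by (simp only:) (intro trig_add trig_mult trig_const trig_sum trig_cos grid_axis)
    then have q: "?q \<in> trig s" by (rule trig_power)
    from orthogonal_trig[OF D orth q] have i: "integrable lborel (\<lambda>w. D w * ?q w)" "(LINT w|lborel. D w * ?q w) = 0"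
      by auto
    have Rq: "Re (cnj (D w0) * (D w * ?q w)) = R w * (\<eta> + mc w) ^ (2 * n)" for w
      by (simp add: R_def mult.assoc[symmetric] flip: of_real_power of_real_add)
    have i': "integrable lborel (\<lambda>w. R w * (\<eta> + mc w) ^ (2 * n))"
      unfolding Rq[symmetric] by (intro integrable_Re integrable_mult_right i)
    have "(LINT w|lborel. R w * (\<eta> + mc w) ^ (2 * n)) = Re (LINT w|lborel. cnj (D w0) * (D w * ?q w))"
      unfolding Rq[symmetric] using i(1) by (intro integral_Re integrable_mult_right)
    also have "\<dots> = 0" using i by simp
    finally have zero: "(LINT w|lborel. R w * (\<eta> + mc w) ^ (2 * n)) = 0" .
    have "indicator V w * (d * (1 + \<eta> / 2) ^ (2 * n)) - \<bar>R w\<bar> \<le> R w * (\<eta> + mc w) ^ (2 * n)" for w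
    proof -
      have pos: "0 \<le> (\<eta> + mc w) ^ (2 * n)" by simp
      consider "w \<in> V" | "w \<notin> V" "dist w w0 < r" | "w \<notin> V" "r \<le> dist w w0" "w \<in> cell s" | "w \<notin> V" "w \<notin> cell s"
        by force
      then show ?thesis
      proof cases
        case 1
        have "d * (1 + \<eta> / 2) ^ (2 * n) \<le> R w * (\<eta> + mc w) ^ (2 * n)"
          using V[OF 1] d \<eta> by (intro mult_mono power_mono) auto
        with 1 show ?thesis by simp
      next
        case 2
        have "0 \<le> R w * (\<eta> + mc w) ^ (2 * n)" using U[OF 2(2)] d pos by simp
        with 2 show ?thesis by simp
      next
        case 3
        have "(\<eta> + mc w) ^ (2 * n) \<le> 1"
          using power_le_one[OF _ far[OF 3(3,2)], of "2 * n"] by (simp add: power_even_abs)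
        then have "\<bar>R w\<bar> * (\<eta> + mc w) ^ (2 * n) \<le> \<bar>R w\<bar>" using pos by (intro mult_left_le) auto
        moreover have "- (\<bar>R w\<bar> * (\<eta> + mc w) ^ (2 * n)) \<le> R w * (\<eta> + mc w) ^ (2 * n)"
          using mult_right_mono[OF _ pos, of "- \<bar>R w\<bar>" "R w"] by simp
        ultimately show ?thesis using 3 by simp
      next
        case 4
        then show ?thesis by (simp add: R_def out)
      qed
    qed
    then have "(LINT w|lborel. indicator V w * (d * (1 + \<eta> / 2) ^ (2 * n)) - \<bar>R w\<bar>) \<le> (LINT w|lborel. R w * (\<eta> + mc w) ^ (2 * n))"
      by (intro Bochner_Integration.integral_mono Bochner_Integration.integrable_diff V_int integrable_abs intR i')
    also note zero
    also have "(LINT w|lborel. indicator V w * (d * (1 + \<eta> / 2) ^ (2 * n)) - \<bar>R w\<bar>) =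
        (LINT w|lborel. indicator V w * (d * (1 + \<eta> / 2) ^ (2 * n))) - (LINT w|lborel. \<bar>R w\<bar>)"
      by (intro Bochner_Integration.integral_diff V_int integrable_abs intR)
    also have "(LINT w|lborel. indicator V w * (d * (1 + \<eta> / 2) ^ (2 * n))) = v * (d * (1 + \<eta> / 2) ^ (2 * n))"
      by (simp add: v_def)
    finally show ?thesis by (simp add: mult_ac)
  qed
  have "1 < (1 + \<eta> / 2)\<^sup>2" using \<eta> by (intro one_less_power) auto
  then obtain n where "(LINT w|lborel. \<bar>R w\<bar>) / (d * v) < ((1 + \<eta> / 2)\<^sup>2) ^ n"
    using real_arch_pow by blast
  then have "(LINT w|lborel. \<bar>R w\<bar>) < d * (1 + \<eta> / 2) ^ (2 * n) * v"
    unfolding power_mult using d v by (simp add: divide_less_eq mult_ac)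
  with bound[of n] show False by simp
qed

text \<open>
  The series \<open>p\<close> and the function \<open>f\<close> have the same Fourier coefficients on the cell, and both are
  continuous near \<open>w0\<close>.
\<close>

theorem fourier_series:
  fixes s w0 :: "'a::euclidean_space"
  assumes s: "\<And>b. b \<in> Basis \<Longrightarrow> 0 < s \<bullet> b"
    and w0: "\<And>b. b \<in> Basis \<Longrightarrow> \<bar>w0 \<bullet> b\<bar> < 1 / (2 * (s \<bullet> b))"
    and f: "schwartz f" and out: "\<And>w. w \<notin> cell s \<Longrightarrow> f w = 0"
  shows "osc (count_space (grid s)) (\<lambda>l. (2 * pi) *\<^sub>R l) (\<lambda>l. of_real (\<Prod>b\<in>Basis. s \<bullet> b) * fourier f l) w0 = f w0"
proof -
  let ?G = "count_space (grid s)"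
  define P where "P = (\<Prod>b\<in>Basis. s \<bullet> b)"
  define c where "c l = of_real P * fourier f l" for l
  have P: "P > 0" unfolding P_def by (intro prod_pos s) 
  have c: "schwartz c" unfolding c_def by (intro schwartz_cmult schwartz_fourier f)
  define p where "p = osc ?G (\<lambda>l. (2 * pi) *\<^sub>R l) c"
  have mom: "integrable ?G (\<lambda>l. norm ((2 * pi) *\<^sub>R l) ^ k * cmod (c l))" for k
    by (rule grid_moments[OF s c])
  have intc: "integrable ?G c"
    by (rule integrable_norm_cancel) (use mom[of 0] in simp_all)
  have cg: "countable (grid s)" by (rule countable_grid[OF s])
  have pcont: "isCont p w" for w
    unfolding p_def by (intro has_derivative_continuous[OF osc_has_derivative] mom) auto
  then have pm [measurable]: "p \<in> borel_measurable borel"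
    by (intro borel_measurable_continuous_onI continuous_at_imp_continuous_on) auto
  have pb: "cmod (p w) \<le> (LINT l|?G. cmod (c l))" for w
    unfolding p_def osc_def
    by (rule order_trans[OF integral_norm_bound]) (simp add: norm_mult)
  have fm [measurable]: "f \<in> borel_measurable borel" by (rule schwartz_measurable[OF f])
  have intI: "integrable lborel (indicator (cell s) :: 'a \<Rightarrow> complex)"
  proof -
    have "integrable lborel (\<lambda>w. complex_of_real (indicator (cell s) w))"
      by (intro integrable_of_real integrable_real_indicator)
        (use emeasure_compact_finite[OF compact_cell[of s]] in simp_all)
    then show ?thesis
      by (rule Bochner_Integration.integrable_cong[THEN iffD1, rotated -1]) (auto simp: indicator_def)
  qed
  define D where "D w = indicator (cell s) w * p w - f w" for w
  have ip: "integrable lborel (\<lambda>w. indicator (cell s) w * p w * g w)" if [measurable]: "g \<in> borel_measurable borel" and "\<And>w. cmod (g w) \<le> 1" for g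
    by (rule Bochner_Integration.integrable_bound[OF integrable_mult_left[OF integrable_norm[OF intI], of "LINT l|?G. cmod (c l)"]])
      (use that(2) pb in \<open>auto intro!: AE_I2 simp: norm_mult indicator_def abs_of_nonneg mult_le_one
        order_trans[OF mult_mono[OF pb that(2)]]\<close>)
  have "D w0 = 0"
  proof (rule orthogonal_imp_zero[OF s w0])
    show "integrable lborel D"
      unfolding D_def using ip[of "\<lambda>_. 1"] schwartz_integrable[OF f]
      by (intro Bochner_Integration.integrable_diff) auto
    show "D w = 0" if "w \<notin> cell s" for w using that by (simp add: D_def out)
    have "open (\<Inter>b\<in>Basis. {w. \<bar>w \<bullet> b\<bar> < 1 / (2 * (s \<bullet> b))})"
      by (intro open_INT finite_Basis ballI open_Collect_less continuous_intros)
    moreover have "w0 \<in> (\<Inter>b\<in>Basis. {w. \<bar>w \<bullet> b\<bar> < 1 / (2 * (s \<bullet> b))})" using w0 by auto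
    ultimately have "\<forall>\<^sub>F w in nhds w0. w \<in> (\<Inter>b\<in>Basis. {w. \<bar>w \<bullet> b\<bar> < 1 / (2 * (s \<bullet> b))})"
      by (rule eventually_nhds_in_open)
    then have "\<forall>\<^sub>F w in nhds w0. D w = p w - f w"
      by eventually_elim (auto simp: D_def cell_def less_imp_le)
    moreover have "isCont (\<lambda>w. p w - f w) w0"
      using pcont schwartz_continuous[OF f, of UNIV] by (intro continuous_intros) (auto simp: continuous_on_eq_continuous_at)
    ultimately show "isCont D w0" by (simp add: isCont_cong)
    fix m assume m: "m \<in> grid s"
    let ?e = "\<lambda>w. cis (2 * pi * (m \<bullet> w))"
    interpret sigma_finite_measure ?G
      by (rule sigma_finite_measure_count_space_countable[OF cg])
    interpret PS: pair_sigma_finite ?G lborel ..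
    have "(LINT w|lborel. (indicator (cell s) w * ?e w) * (LINT l|?G. c l * cis (w \<bullet> (2 * pi) *\<^sub>R l))) =
       (LINT l|?G. c l * (LINT w|lborel. (indicator (cell s) w * ?e w) * cis (w \<bullet> (2 * pi) *\<^sub>R l)))"
    proof (rule PS.integral_swap_kernel(2)[symmetric, OF intc])
      show "integrable lborel (\<lambda>w. indicator (cell s) w * ?e w)"
        by (intro integrable_mult_cis intI) measurable
      show "case_prod (\<lambda>l w. cis (w \<bullet> (2 * pi) *\<^sub>R l)) \<in> borel_measurable (?G \<Otimes>\<^sub>M lborel)"
        by (rule measurable_pair_measure_countable1[OF cg]) auto
    qed simp
    also have "\<dots> = (LINT l|?G. c l * (if l = - m then inverse (of_real P) else 0))"
    proof (rule Bochner_Integration.integral_cong[OF refl])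
      fix l assume "l \<in> space ?G"
      then have "m + l \<in> grid s" using m by (simp add: grid_add)
      have "(LINT w|lborel. (indicator (cell s) w * ?e w) * cis (w \<bullet> (2 * pi) *\<^sub>R l)) =
        (LINT w|lborel. indicator (cell s) w * cis (2 * pi * ((m + l) \<bullet> w)))"
        by (simp add: mult.assoc cis_mult inner_add_left inner_commute[of _ l] distrib_left)
      also have "\<dots> = (if m + l = 0 then inverse (of_real P) else 0)"
        unfolding P_def by (rule integral_cell_cis[OF s \<open>m + l \<in> grid s\<close>])
      also have "(m + l = 0) = (l = - m)" by (simp add: add_eq_0_iff)
      finally show "c l * (LINT w|lborel. (indicator (cell s) w * ?e w) * cis (w \<bullet> (2 * pi) *\<^sub>R l)) =
        c l * (if l = - m then inverse (of_real P) else 0)" by simp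
    qed
    also have "\<dots> = (\<Sum>l\<in>{- m}. c l * (if l = - m then inverse (of_real P) else 0))"
      by (rule integral_count_space_supported) (auto simp: grid_uminus m)
    also have "\<dots> = fourier f (- m)" using P by (simp add: c_def)
    finally have 1: "(LINT w|lborel. indicator (cell s) w * p w * ?e w) = fourier f (- m)"
      by (simp add: p_def osc_def mult_ac)
    have 2: "(LINT w|lborel. f w * ?e w) = fourier f (- m)"
      by (simp add: fourier_def)
    have "integrable lborel (\<lambda>w. f w * ?e w)"
      by (intro integrable_mult_cis schwartz_integrable f) measurable
    then have "(LINT w|lborel. D w * ?e w) = (LINT w|lborel. indicator (cell s) w * p w * ?e w) - (LINT w|lborel. f w * ?e w)"
      unfolding D_def left_diff_distrib by (intro Bochner_Integration.integral_diff ip) auto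
    then show "(LINT w|lborel. D w * ?e w) = 0" by (simp add: 1 2)
  qed
  moreover have "w0 \<in> cell s" using w0 by (auto simp: cell_def intro: less_imp_le)
  ultimately show ?thesis by (simp add: D_def p_def c_def[abs_def] P_def)
qed

section \<open>Smooth bumps, quotients and cutoffs\<close>

lemma exp_ge_power_fact:
  fixes x :: real assumes "0 \<le> x" shows "x ^ n / fact n \<le> exp x"
proof -
  have "(\<Sum>k\<in>{n}. inverse (fact k) * x ^ k) \<le> (\<Sum>k. inverse (fact k) * x ^ k)"
    using summable_exp[of x] assms by (intro sum_le_suminf) auto
  also have "\<dots> = exp x" by (simp add: exp_def scaleR_conv_of_real)
  finally show ?thesis by (simp add: divide_inverse mult.commute)
qed

text \<open>
  The classical flat functions \<open>exp (-1/t) / t\<^sup>m\<close>, extended by zero to \<open>t \<le> 0\<close>. Their derivatives are linear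
  combinations of functions of the same kind, so all of them are smooth.
\<close>

definition flat :: "nat \<Rightarrow> real \<Rightarrow> real" where
  "flat m t = (if 0 < t then exp (- inverse t) * inverse t ^ m else 0)"

lemma flat_pos: "0 < t \<Longrightarrow> 0 < flat m t" and flat_zero: "t \<le> 0 \<Longrightarrow> flat m t = 0"
  and flat_nonneg: "0 \<le> flat m t"
  by (auto simp: flat_def)

lemma flat_le: "flat m t \<le> fact (m + 2) * t\<^sup>2"
proof (cases "0 < t")
  case True
  have "inverse t ^ (m + 2) \<le> fact (m + 2) * exp (inverse t)"
    using exp_ge_power_fact[of "inverse t" "m + 2"] True by (simp add: field_simps del: fact_Suc)
  then have "inverse t ^ (m + 2) * exp (- inverse t) \<le> fact (m + 2) * exp (inverse t) * exp (- inverse t)"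
    by (rule mult_right_mono) simp
  then have "inverse t ^ m * (inverse t ^ 2 * exp (- inverse t)) \<le> fact (m + 2)"
    by (simp only: mult.assoc exp_minus_inverse power_add mult_1_right)
  then have "(exp (- inverse t) * inverse t ^ m) * inverse t ^ 2 * t ^ 2 \<le> fact (m + 2) * t ^ 2"
    by (intro mult_right_mono) (auto simp: mult_ac simp del: fact_Suc)
  moreover have "inverse t ^ 2 * t ^ 2 = 1" using True by (simp add: power_mult_distrib[symmetric])
  ultimately show ?thesis using True by (simp add: flat_def mult.assoc del: fact_Suc)
qed (simp add: flat_def)

lemma flat_deriv: "(flat m has_real_derivative - real m * flat (Suc m) t + flat (m + 2) t) (at t)"
proof -
  consider "0 < t" | "t < 0" | "t = 0" by linarith
  then show ?thesis
  proof cases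
    case 1
    have de: "((\<lambda>t. exp (- inverse t) * inverse t ^ m) has_real_derivative
        - real m * flat (Suc m) t + flat (m + 2) t) (at t)"
    proof (rule DERIV_cong)
      show "((\<lambda>t. exp (- inverse t) * inverse t ^ m) has_real_derivative
          exp (- inverse t) * inverse t ^ 2 * inverse t ^ m
          + real m * inverse t ^ (m - 1) * - (inverse t ^ 2) * exp (- inverse t)) (at t)"
        using 1 by (auto intro!: derivative_eq_intros simp: power2_eq_square)
      have "real m * inverse t ^ (m - 1) * inverse t ^ 2 = real m * inverse t ^ Suc m"
        by (cases m) (simp_all add: power2_eq_square mult_ac)
      then have "real m * inverse t ^ (m - 1) * - (inverse t ^ 2) * exp (- inverse t) =
          - (real m * inverse t ^ Suc m) * exp (- inverse t)"
        by (simp only: mult_minus_left mult_minus_right)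
      then show "exp (- inverse t) * inverse t ^ 2 * inverse t ^ m
          + real m * inverse t ^ (m - 1) * - (inverse t ^ 2) * exp (- inverse t) =
        - real m * flat (Suc m) t + flat (m + 2) t"
        by (simp only:) (use 1 in \<open>simp add: flat_def power_add power2_eq_square algebra_simps\<close>)
    qed
    have ev: "\<forall>\<^sub>F u in nhds t. exp (- inverse u) * inverse u ^ m = flat m u"
      using eventually_nhds_in_open[of "{0<..}" t] 1 by (auto elim!: eventually_mono simp: flat_def)
    show ?thesis by (rule DERIV_cong_ev[OF refl ev refl, THEN iffD1, OF de])
  next
    case 2
    have ev: "\<forall>\<^sub>F u in nhds t. 0 = flat m u"
      using eventually_nhds_in_open[of "{..<0}" t] 2 by (auto elim!: eventually_mono simp: flat_def)
    have de: "((\<lambda>_. 0) has_real_derivative - real m * flat (Suc m) t + flat (m + 2) t) (at t)"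
      using 2 by (simp add: flat_def)
    show ?thesis by (rule DERIV_cong_ev[OF refl ev refl, THEN iffD1, OF de])
  next
    case 3
    have "((\<lambda>h. fact (m + 2) * \<bar>h\<bar>) \<longlongrightarrow> (0::real)) (at 0)"
      by (auto intro!: tendsto_eq_intros simp del: fact_Suc)
    then have "((\<lambda>h. (flat m (0 + h) - flat m 0) / h) \<longlongrightarrow> 0) (at 0)"
    proof (rule Lim_null_comparison[rotated])
      have "norm ((flat m (0 + h) - flat m 0) / h) \<le> fact (m + 2) * \<bar>h\<bar>" if "h \<noteq> 0" for h
      proof -
        have "\<bar>flat m h\<bar> / \<bar>h\<bar> \<le> (fact (m + 2) * \<bar>h\<bar> * \<bar>h\<bar>) / \<bar>h\<bar>"
          using flat_le[of m h] flat_nonneg[of m h]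
          by (intro divide_right_mono) (simp_all only: abs_of_nonneg power2_eq_square mult.assoc abs_mult_self_eq abs_ge_zero)
        then show ?thesis using that by (simp add: flat_zero del: fact_Suc)
      qed
      then show "\<forall>\<^sub>F h in at 0. norm ((flat m (0 + h) - flat m 0) / h) \<le> fact (m + 2) * \<bar>h\<bar>"
        by (simp add: eventually_at_filter del: fact_Suc)
    qed
    with 3 show ?thesis by (simp add: DERIV_def flat_zero)
  qed
qed

abbreviation regT :: "nat \<Rightarrow> ('a::euclidean_space \<Rightarrow> complex) \<Rightarrow> bool" where
  "regT n f \<equiv> reg (\<lambda>_. True) n (\<lambda>_::unit. f)"

lemma smooth_has_derivative: "smooth f \<Longrightarrow> (f has_derivative deriv_at f x) (at x)"
  using reg_has_derivative[where f="\<lambda>_::unit. f"] by (metis smooth_iff_reg)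

lemma smooth_deriv: "smooth f \<Longrightarrow> b \<in> Basis \<Longrightarrow> smooth (\<lambda>x. deriv_at f x b)"
  unfolding smooth_iff_reg by (intro allI, drule_tac x="Suc n" in spec) simp

lemma regT_const: "regT n (\<lambda>_. c)"
proof (induction n arbitrary: c)
  case (Suc n)
  show ?case by (rule reg_SucI[where f'="\<lambda>_ _ _. 0"]) (auto simp: Suc)
qed simp

lemma smooth_const: "smooth (\<lambda>_. c)"
  by (simp add: smooth_iff_reg regT_const)

lemma smooth_add: "smooth f \<Longrightarrow> smooth g \<Longrightarrow> smooth (\<lambda>x. f x + g x)"
  unfolding smooth_iff_reg by (auto intro: reg_add)

lemma smooth_mult: "smooth f \<Longrightarrow> smooth g \<Longrightarrow> smooth (\<lambda>x. f x * g x)"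
  unfolding smooth_iff_reg by (auto intro: reg_mult)

lemma smooth_diff: "smooth f \<Longrightarrow> smooth g \<Longrightarrow> smooth (\<lambda>x. f x - g x)"
  using smooth_add[of f "\<lambda>x. -1 * g x"] smooth_mult[OF smooth_const[of "-1"], of g] by simp

lemma smooth_sum: "(\<And>j. j \<in> J \<Longrightarrow> smooth (f j)) \<Longrightarrow> smooth (\<lambda>x. \<Sum>j\<in>J. f j x)"
  by (induction J rule: infinite_finite_induct) (auto intro: smooth_add smooth_const)

lemma schwartz_imp_smooth: "schwartz f \<Longrightarrow> smooth f"
  by (simp add: schwartz_def)

lemma regT_affine: "regT n (\<lambda>x. of_real ((x - c) \<bullet> v))"
proof (cases n)
  case (Suc k)
  have "((\<lambda>x. complex_of_real ((x - c) \<bullet> v)) has_derivative (\<lambda>h. of_real (h \<bullet> v))) (at x)" for x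
    by (auto intro!: derivative_eq_intros)
  then show ?thesis unfolding Suc
    by (intro reg_SucI[where f'="\<lambda>_ _ h. of_real (h \<bullet> v)"]) (auto intro: regT_const)
qed simp

text \<open>
  Negative \<open>\<beta>\<close> gives bumps inside a ball, positive \<open>\<beta>\<close> functions living outside of one.
\<close>

lemma smooth_flat_quadratic: "smooth (\<lambda>x::'a::euclidean_space. of_real (flat m (\<alpha> + \<beta> * (norm (x - c))\<^sup>2)))"
  unfolding smooth_iff_reg
proof
  fix n show "regT n (\<lambda>x::'a. of_real (flat m (\<alpha> + \<beta> * (norm (x - c))\<^sup>2)))"
  proof (induction n arbitrary: m)
    case (Suc n)
    let ?q = "\<lambda>x. \<alpha> + \<beta> * (norm (x - c))\<^sup>2"
    let ?d = "\<lambda>t. - real m * flat (Suc m) t + flat (m + 2) t"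
    show ?case
    proof (rule reg_SucI)
      fix x :: 'a
      have q: "(?q has_derivative (\<lambda>h. 2 * \<beta> * ((x - c) \<bullet> h))) (at x)"
        unfolding power2_norm_eq_inner
        by (auto intro!: derivative_eq_intros simp: inner_commute)
      have "((\<lambda>x. flat m (?q x)) has_derivative (\<lambda>h. ?d (?q x) * (2 * \<beta> * ((x - c) \<bullet> h)))) (at x)"
        by (rule has_derivative_compose[OF q flat_deriv[unfolded has_field_derivative_def]])
      then show "((\<lambda>x. complex_of_real (flat m (?q x))) has_derivative (\<lambda>h. of_real (?d (?q x) * (2 * \<beta> * ((x - c) \<bullet> h))))) (at x)"
        by (rule has_derivative_of_real)
    next
      fix b :: 'a
      have "regT n (\<lambda>x. (of_real (- real m) * of_real (flat (Suc m) (?q x)) + of_real (flat (m + 2) (?q x))) * (of_real (2 * \<beta>) * of_real ((x - c) \<bullet> b)))"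
        by (intro reg_mult[where P="\<lambda>_. True" and Q="\<lambda>_. True"] reg_add regT_const regT_affine Suc.IH) auto
      then show "regT n (\<lambda>x. of_real (?d (?q x) * (2 * \<beta> * ((x - c) \<bullet> b))))"
        by simp
    qed simp
  qed simp
qed

lemma fun_support_zero: "x \<notin> fun_support f \<Longrightarrow> f x = 0"
  unfolding fun_support_def using closure_subset[of "{x. f x \<noteq> 0}"] by auto

lemma fun_support_subset: "closed K \<Longrightarrow> (\<And>x. x \<notin> K \<Longrightarrow> f x = 0) \<Longrightarrow> fun_support f \<subseteq> K"
  unfolding fun_support_def by (rule closure_minimal) auto

lemma closed_fun_support: "closed (fun_support f)"
  by (simp add: fun_support_def)

lemma test_functionI:
  assumes "smooth f" "compact K" "\<And>x. x \<notin> K \<Longrightarrow> f x = 0"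
  shows "test_function f"
proof -
  have "fun_support f \<subseteq> K"
    using assms by (intro fun_support_subset compact_imp_closed)
  then have "K \<inter> fun_support f = fun_support f" by blast
  then show ?thesis
    using compact_Int_closed[OF assms(2) closed_fun_support[of f]] assms(1)
    by (simp add: test_function_def)
qed

lemma deriv_zero_off:
  assumes "closed K" "\<And>x. x \<notin> K \<Longrightarrow> f x = 0" "x \<notin> K"
  shows "(f has_derivative (\<lambda>_. 0)) (at x)"
proof (rule has_derivative_transform_within_open[where f="\<lambda>_. 0" and s="- K"])
  show "open (- K)" using assms by auto
qed (use assms in auto)

lemma frechet_zero_off:
  assumes "closed K" "\<And>x. x \<notin> K \<Longrightarrow> f x = 0" "x \<notin> K"
  shows "deriv_at f x v = 0"
  by (simp add: frechet_derivative_at[OF deriv_zero_off[OF assms], symmetric])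

text \<open>
  The derivative of \<open>f/g\<close> is \<open>(f' g - f g')/g\<^sup>2\<close>, which is of the same form: its numerator vanishes off
  \<open>K\<close> and its denominator does not vanish on \<open>K\<close>. Off \<open>K\<close> both sides are zero, since \<open>0 / x = 0\<close> also
  for \<open>x = 0\<close>.
\<close>

lemma smooth_quotient:
  fixes f g :: "'a::euclidean_space \<Rightarrow> complex"
  assumes "smooth f" "smooth g" and K: "closed K" "\<And>x. x \<notin> K \<Longrightarrow> f x = 0" "\<And>x. x \<in> K \<Longrightarrow> g x \<noteq> 0"
  shows "smooth (\<lambda>x. f x / g x)"
  unfolding smooth_iff_reg
proof
  fix n show "regT n (\<lambda>x. f x / g x)"
    using assms(1,2) K(2,3)
  proof (induction n arbitrary: f g)
    case (Suc n)
    note df = smooth_has_derivative[OF Suc.prems(1)] and dg = smooth_has_derivative[OF Suc.prems(2)]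
    let ?f' = "\<lambda>x. deriv_at f x" and ?g' = "\<lambda>x. deriv_at g x"
    show ?case
    proof (rule reg_SucI)
      fix x
      show "((\<lambda>x. f x / g x) has_derivative (\<lambda>h. (?f' x h * g x - f x * ?g' x h) / (g x * g x))) (at x)"
      proof (cases "x \<in> K")
        case True
        show ?thesis by (rule has_derivative_divide'[OF df dg]) (use True Suc.prems in auto)
      next
        case False
        have "((\<lambda>x. f x / g x) has_derivative (\<lambda>_. 0)) (at x)"
          by (rule deriv_zero_off[OF K(1) _ False]) (simp add: Suc.prems(3))
        moreover have "?f' x h = 0" for h by (rule frechet_zero_off[OF K(1) Suc.prems(3) False])
        ultimately show ?thesis using Suc.prems(3)[OF False] by simp
      qed
    next
      fix b :: 'a assume "b \<in> Basis"
      then show "regT n (\<lambda>x. (?f' x b * g x - f x * ?g' x b) / (g x * g x))"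
        by (intro Suc.IH smooth_diff smooth_mult smooth_deriv Suc.prems)
          (auto simp: frechet_zero_off[OF K(1) Suc.prems(3)] Suc.prems)
    qed simp
  qed simp
qed

lemma test_function_quotient:
  assumes "test_function f" "smooth g" "\<And>x. x \<in> fun_support f \<Longrightarrow> g x \<noteq> 0"
  shows "test_function (\<lambda>x. f x / g x)"
  using assms unfolding test_function_def[of f]
  by (intro test_functionI[where K="fun_support f"] smooth_quotient[where K="fun_support f"] closed_fun_support)
    (auto simp: fun_support_zero)

lemma test_function_mult:
  assumes "test_function f" "smooth g"
  shows "test_function (\<lambda>x. g x * f x)"
  using assms unfolding test_function_def[of f]
  by (intro test_functionI[where K="fun_support f"] smooth_mult) (auto simp: fun_support_zero)

lemma test_function_imp_schwartz:
  assumes "test_function f"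
  shows "schwartz f"
proof -
  let ?K = "fun_support f"
  have K: "compact ?K" "closed ?K" and f: "smooth f"
    using assms by (auto simp: test_function_def compact_imp_closed)
  have P: "rapid const_bounds (\<lambda>_::unit. f)" if f: "smooth f" "\<And>x. x \<notin> ?K \<Longrightarrow> f x = 0" for f
    unfolding rapid_const_iff
  proof
    fix k
    have "continuous_on ?K (\<lambda>x. norm x ^ k * cmod (f x))"
      by (intro continuous_intros continuous_at_imp_continuous_on ballI
          has_derivative_continuous[OF smooth_has_derivative[OF f(1)]])
    then have "bounded ((\<lambda>x. norm x ^ k * cmod (f x)) ` ?K)"
      by (intro compact_imp_bounded compact_continuous_image K)
    then obtain C where C: "\<And>x. x \<in> ?K \<Longrightarrow> \<bar>norm x ^ k * cmod (f x)\<bar> \<le> C"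
      unfolding bounded_iff by auto
    have "norm x ^ k * cmod (f x) \<le> max C 0" for x
      using C[of x] f(2)[of x] by (cases "x \<in> ?K") auto
    then show "bdd_above (range (\<lambda>x. norm x ^ k * cmod (f x)))"
      by (auto simp: bdd_above_def)
  qed
  have "reg (rapid const_bounds) n (\<lambda>_::unit. f)" if "smooth f" "\<And>x. x \<notin> ?K \<Longrightarrow> f x = 0" for n f
    using that
  proof (induction n arbitrary: f)
    case 0
    then show ?case using P by simp
  next
    case (Suc n)
    show ?case
    proof (rule reg_SucI[where f'="\<lambda>_ x. deriv_at f x"])
      show "rapid const_bounds (\<lambda>_::unit. f)" by (rule P[OF Suc.prems])
      show "(f has_derivative deriv_at f x) (at x)" for x
        by (rule smooth_has_derivative[OF Suc.prems(1)])
      show "reg (rapid const_bounds) n (\<lambda>(_::unit) x. deriv_at f x b)" if "b \<in> Basis" for b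
        by (rule Suc.IH[OF smooth_deriv[OF Suc.prems(1) that] frechet_zero_off[OF K(2) Suc.prems(2)]])
    qed
  qed
  then show ?thesis
    using f fun_support_zero[of _ f] by (intro schwartz_familyD) (auto simp: schwartz_family_def)
qed

definition bump :: "'a::euclidean_space \<Rightarrow> real \<Rightarrow> 'a \<Rightarrow> complex" where
  "bump c r x = of_real (flat 0 (r\<^sup>2 - (norm (x - c))\<^sup>2))"

lemma bump_smooth: "smooth (bump c r)"
  using smooth_flat_quadratic[of 0 "r\<^sup>2" "-1" c] by (simp add: bump_def[abs_def])

lemma bump_zero: "0 < r \<Longrightarrow> x \<notin> cball c r \<Longrightarrow> bump c r x = 0"
  by (auto simp: bump_def dist_norm norm_minus_commute intro!: flat_zero power_mono)

text \<open>
  Equal to one on the unit ball and to zero outside the ball of radius two.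
\<close>

definition cutoff :: "'a::euclidean_space \<Rightarrow> complex" where
  "cutoff x = bump 0 2 x / (bump 0 2 x + of_real (flat 0 ((norm x)\<^sup>2 - 1)))"

lemma cutoff_test_function: "test_function (cutoff :: 'a::euclidean_space \<Rightarrow> complex)"
proof -
  have "bump 0 2 x + of_real (flat 0 ((norm x)\<^sup>2 - 1)) \<noteq> 0" for x :: 'a
  proof (cases "norm x < 2")
    case True
    then have "(norm x)\<^sup>2 < 2\<^sup>2" by (intro power_strict_mono) auto
    then have "0 < flat 0 (4 - (norm x)\<^sup>2) + flat 0 ((norm x)\<^sup>2 - 1)"
      by (intro add_pos_nonneg flat_pos flat_nonneg) auto
    then show ?thesis by (simp add: bump_def flip: of_real_add)
  next
    case False
    then have "2\<^sup>2 \<le> (norm x)\<^sup>2" by (intro power_mono) auto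
    then have "0 < flat 0 (4 - (norm x)\<^sup>2) + flat 0 ((norm x)\<^sup>2 - 1)"
      by (intro add_nonneg_pos flat_pos flat_nonneg) auto
    then show ?thesis by (simp add: bump_def flip: of_real_add)
  qed
  moreover have "smooth (\<lambda>x::'a. bump 0 2 x + of_real (flat 0 ((norm x)\<^sup>2 - 1)))"
    using smooth_flat_quadratic[of 0 "-1" 1 "0::'a"] by (intro smooth_add bump_smooth) simp
  moreover have "test_function (bump (0::'a) 2)"
    by (rule test_functionI[OF bump_smooth, where K="cball 0 2"]) (auto intro: bump_zero)
  ultimately show ?thesis
    unfolding cutoff_def[abs_def] by (intro test_function_quotient) auto
qed

lemma cutoff_eq_1: "norm x \<le> 1 \<Longrightarrow> cutoff x = 1"
proof -
  assume "norm x \<le> 1"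
  then have "(norm x)\<^sup>2 \<le> 1" by (simp add: abs_square_le_1)
  then have "flat 0 ((norm x)\<^sup>2 - 1) = 0" "0 < flat 0 (4 - (norm x)\<^sup>2)"
    by (auto intro!: flat_zero flat_pos)
  then show ?thesis by (simp add: cutoff_def bump_def)
qed

section \<open>Functionals on the Schwartz space and their support\<close>

definition schwartz_linear :: "'a::euclidean_space functional \<Rightarrow> bool" where
  "schwartz_linear u \<longleftrightarrow> (\<forall>f h. schwartz f \<longrightarrow> schwartz h \<longrightarrow> u (\<lambda>x. f x + h x) = u f + u h) \<and>
     (\<forall>c f. schwartz f \<longrightarrow> u (\<lambda>x. c * f x) = c * u f)"

text \<open>
  The support theorem passes to limits along sequences. For the Fourier transform of a tempered
  distribution, sequential continuity follows from the continuity of the Fourier transform along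
  families.
\<close>

definition seq_tempered :: "'a::euclidean_space functional \<Rightarrow> bool" where
  "seq_tempered u \<longleftrightarrow> schwartz_linear u \<and> (\<forall>f. \<forall>h::nat \<Rightarrow> 'a \<Rightarrow> complex.
     schwartz f \<longrightarrow> schwartz_family (null_bounds sequentially) (\<lambda>n x. h n x - f x) \<longrightarrow> (\<lambda>n. u (h n)) \<longlonglongrightarrow> u f)"

lemma schwartz_linear_add: "schwartz_linear u \<Longrightarrow> schwartz f \<Longrightarrow> schwartz h \<Longrightarrow> u (\<lambda>x. f x + h x) = u f + u h"
  by (simp add: schwartz_linear_def)

lemma schwartz_linear_cmult: "schwartz_linear u \<Longrightarrow> schwartz f \<Longrightarrow> u (\<lambda>x. c * f x) = c * u f"
  by (simp add: schwartz_linear_def)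

lemma schwartz_linear_zero: "schwartz_linear u \<Longrightarrow> u (\<lambda>_. 0) = 0"
  using schwartz_linear_cmult[of u "\<lambda>_. 0" 0] schwartz_zero by simp

lemma schwartz_linear_sum:
  assumes "schwartz_linear u" "\<And>j. j \<in> J \<Longrightarrow> schwartz (f j)"
  shows "u (\<lambda>x. \<Sum>j\<in>J. f j x) = (\<Sum>j\<in>J. u (f j))"
  using assms(2)
  by (induction J rule: infinite_finite_induct)
    (auto simp: schwartz_linear_zero[OF assms(1)] schwartz_linear_add[OF assms(1)] schwartz_sum)

lemma schwartz_linear_diff:
  assumes "schwartz_linear u" "schwartz f" "schwartz h"
  shows "u (\<lambda>x. f x - h x) = u f - u h"
  using schwartz_linear_add[OF assms(1,2) schwartz_cmult[OF assms(3), of "-1"]]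
    schwartz_linear_cmult[OF assms(1,3), of "-1"] by simp

text \<open>
  The support is defined by local vanishing. A partition of unity subordinate to finitely many balls,
  each contained in an open set where \<open>u\<close> vanishes, splits \<open>f\<close> into functions that \<open>u\<close> annihilates.
\<close>

lemma test_function_off_support:
  assumes u: "schwartz_linear u" and f: "test_function f" and disj: "fun_support f \<inter> distr_support u = {}"
  shows "u f = 0"
proof -
  let ?K = "fun_support f"
  have K: "compact ?K" using f by (simp add: test_function_def)
  have "\<exists>r>0. \<forall>h. test_function h \<and> fun_support h \<subseteq> cball x r \<longrightarrow> u h = 0" if x: "x \<in> ?K" for x
  proof -
    have "x \<in> \<Union>{U. open U \<and> (\<forall>f. test_function f \<and> fun_support f \<subseteq> U \<longrightarrow> u f = 0)}"
      using x disj unfolding distr_support_def by blast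
    then obtain U where U: "open U" "x \<in> U" "\<And>h. test_function h \<Longrightarrow> fun_support h \<subseteq> U \<Longrightarrow> u h = 0"
      by blast
    obtain r where "r > 0" "cball x r \<subseteq> U" using U(1,2) by (metis open_contains_cball)
    with U(3) show ?thesis by (meson subset_trans)
  qed
  then obtain r where r: "\<And>x. x \<in> ?K \<Longrightarrow> 0 < r x"
    and van: "\<And>x h. x \<in> ?K \<Longrightarrow> test_function h \<Longrightarrow> fun_support h \<subseteq> cball x (r x) \<Longrightarrow> u h = 0"
    by metis
  obtain D where D: "D \<subseteq> ?K" "finite D" "?K \<subseteq> (\<Union>x\<in>D. ball x (r x))"
  proof -
    have "?K \<subseteq> (\<Union>c\<in>?K. ball c (r c))" using r by auto
    from compactE_image[OF K _ this] that show ?thesis by (metis open_ball)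
  qed
  define \<Psi> where "\<Psi> x = (\<Sum>c\<in>D. bump c (r c) x)" for x
  have \<Psi>: "smooth \<Psi>" unfolding \<Psi>_def by (intro smooth_sum bump_smooth)
  have \<Psi>0: "\<Psi> x \<noteq> 0" if x: "x \<in> ?K" for x
  proof -
    obtain c where c: "c \<in> D" "x \<in> ball c (r c)" using D x by blast
    then have "(norm (x - c))\<^sup>2 < (r c)\<^sup>2"
      by (intro power_strict_mono) (auto simp: dist_norm norm_minus_commute)
    then have "0 < flat 0 ((r c)\<^sup>2 - (norm (x - c))\<^sup>2)" by (simp add: flat_pos)
    then have "0 < (\<Sum>c\<in>D. flat 0 ((r c)\<^sup>2 - (norm (x - c))\<^sup>2))"
      using c D by (intro sum_pos2) (auto simp: flat_nonneg)
    then show ?thesis by (simp add: \<Psi>_def bump_def flip: of_real_sum)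
  qed
  have q: "test_function (\<lambda>x. f x / \<Psi> x)"
    by (rule test_function_quotient[OF f \<Psi> \<Psi>0])
  have p: "test_function (\<lambda>x. bump c (r c) x * (f x / \<Psi> x))" for c
    by (rule test_function_mult[OF q bump_smooth])
  have "f = (\<lambda>x. \<Sum>c\<in>D. bump c (r c) x * (f x / \<Psi> x))"
  proof
    fix x
    show "f x = (\<Sum>c\<in>D. bump c (r c) x * (f x / \<Psi> x))"
      unfolding sum_distrib_right[symmetric] \<Psi>_def[symmetric]
      using \<Psi>0[of x] fun_support_zero[of x f] by auto
  qed
  then have "u f = u (\<lambda>x. \<Sum>c\<in>D. bump c (r c) x * (f x / \<Psi> x))"
    by (rule arg_cong)
  also have "\<dots> = (\<Sum>c\<in>D. u (\<lambda>x. bump c (r c) x * (f x / \<Psi> x)))"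
    by (rule schwartz_linear_sum[OF u test_function_imp_schwartz[OF p]])
  also have "\<dots> = 0"
  proof (intro sum.neutral ballI)
    fix c assume c: "c \<in> D"
    then show "u (\<lambda>x. bump c (r c) x * (f x / \<Psi> x)) = 0"
      using D r by (intro van[of c] p fun_support_subset) (auto simp: bump_zero)
  qed
  finally show ?thesis .
qed

lemma null_boundsI: "(B \<longlongrightarrow> 0) F \<Longrightarrow> B \<in> null_bounds F"
  by (simp add: null_bounds_def)

lemma rapid_index_scale:
  fixes a :: "nat \<Rightarrow> real"
  assumes "bound_class \<B>" "rapid \<B> f" "\<And>i. \<bar>a i\<bar> \<le> C"
  shows "rapid \<B> (\<lambda>i x. of_real (a i) * f i x)"
proof (rule rapidI)
  fix k
  obtain B where B: "B \<in> \<B>" "\<And>i x. norm x ^ k * cmod (f i x) \<le> B i"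
    using rapidD[OF assms(2)] by blast
  have "norm x ^ k * cmod (of_real (a i) * f i x) \<le> C * B i" for i x
  proof -
    have "norm x ^ k * cmod (of_real (a i) * f i x) = \<bar>a i\<bar> * (norm x ^ k * cmod (f i x))"
      by (simp add: norm_mult)
    also have "\<dots> \<le> C * B i"
      using assms(3)[of i] abs_ge_zero[of "a i"] by (intro mult_mono B) auto
    finally show ?thesis .
  qed
  then show "\<exists>B\<in>\<B>. \<forall>i x. norm x ^ k * cmod (of_real (a i) * f i x) \<le> B i"
    by (intro bexI[OF _ bound_class_scale[OF assms(1) B(1), of C]]) auto
qed

lemma reg_null_scale:
  fixes f :: "'a::euclidean_space \<Rightarrow> complex"
  assumes "schwartz f" "a \<longlonglongrightarrow> (0::real)"
  shows "reg (rapid (null_bounds sequentially)) N (\<lambda>n x. of_real (a n) * f x)"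
proof (rule reg_scale[where f="\<lambda>_. f" and P="rapid const_bounds"])
  show "reg (rapid const_bounds) N (\<lambda>_::nat. f)"
    by (rule schwartz_family_constI[OF assms(1), unfolded schwartz_family_def, rule_format])
  fix f :: "nat \<Rightarrow> 'a \<Rightarrow> complex" assume f: "rapid const_bounds f"
  show "rapid (null_bounds sequentially) (\<lambda>n x. of_real (a n) * f n x)"
  proof (rule rapidI)
    fix k
    obtain B where "B \<in> const_bounds" "\<And>i x. norm x ^ k * cmod (f i x) \<le> B i"
      using rapidD[OF f, of k] by blast
    then obtain C where C: "\<And>i x. norm x ^ k * cmod (f i x) \<le> C"
      by (auto simp: const_bounds_def)
    have "norm x ^ k * cmod (of_real (a i) * f i x) \<le> \<bar>a i\<bar> * C" for i x
      using mult_left_mono[OF C[where i=i and x=x] abs_ge_zero[of "a i"]] by (simp add: norm_mult mult_ac)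
    moreover have "(\<lambda>i. \<bar>a i\<bar> * C) \<longlonglongrightarrow> 0"
      using tendsto_mult_left_zero[OF tendsto_rabs_zero[OF assms(2)]] .
    ultimately show "\<exists>B\<in>null_bounds sequentially. \<forall>i x. norm x ^ k * cmod (of_real (a i) * f i x) \<le> B i"
      by (intro bexI[of _ "\<lambda>i. \<bar>a i\<bar> * C"] null_boundsI) auto
  qed
qed

lemma schwartz_has_derivative: "schwartz f \<Longrightarrow> (f has_derivative deriv_at f x) (at x)"
  by (intro smooth_has_derivative schwartz_imp_smooth)

lemma schwartz_deriv: "schwartz f \<Longrightarrow> b \<in> Basis \<Longrightarrow> schwartz (\<lambda>x. deriv_at f x b)"
  using schwartz_family_member[OF schwartz_family_deriv[OF _ schwartz_family_constI[of f]]] by simp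

text \<open>
  By the mean value theorem on the segment from \<open>t x\<close> to \<open>x\<close> the difference is at most \<open>1 - t\<close> times a
  derivative of \<open>f\<close> at a point of norm at least \<open>norm x / 2\<close>, times \<open>norm x\<close>. The derivative decays faster
  than any power.
\<close>

lemma dilation_rapid:
  fixes f :: "'a::euclidean_space \<Rightarrow> complex" and t :: "nat \<Rightarrow> real"
  assumes f: "schwartz f" and t: "\<And>n. 1 / 2 \<le> t n" "\<And>n. t n < 1" "t \<longlonglongrightarrow> 1"
  shows "rapid (null_bounds sequentially) (\<lambda>n x. f (t n *\<^sub>R x) - f x)"
proof (rule rapidI)
  fix k
  have "\<exists>C. \<forall>x. norm x ^ Suc k * cmod (deriv_at f x b) \<le> C" if "b \<in> Basis" for b
    using schwartz_decay[OF schwartz_deriv[OF f that]] by metis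
  then obtain C where C: "\<And>b x. b \<in> Basis \<Longrightarrow> norm x ^ Suc k * cmod (deriv_at f x b) \<le> C b"
    by metis
  define M where "M = 2 ^ Suc k * (\<Sum>b\<in>Basis. C b)"
  have "norm x ^ k * cmod (f (t n *\<^sub>R x) - f x) \<le> (1 - t n) * M" for n x
  proof -
    obtain s where s: "0 < s" "s < 1 - t n" and
      le: "cmod (f (t n *\<^sub>R x + (1 - t n) *\<^sub>R x) - f (t n *\<^sub>R x)) \<le> (1 - t n) * cmod (deriv_at f (t n *\<^sub>R x + s *\<^sub>R x) x)"
      by (rule directional_mvt[OF schwartz_has_derivative[OF f], of "1 - t n"]) (use t(2)[of n] in auto)
    define y where "y = t n *\<^sub>R x + s *\<^sub>R x"
    have "t n *\<^sub>R x + (1 - t n) *\<^sub>R x = x" by (simp flip: scaleR_add_left)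
    with le have le': "cmod (f (t n *\<^sub>R x) - f x) \<le> (1 - t n) * cmod (deriv_at f y x)"
      by (simp add: y_def norm_minus_commute)
    have "norm y = (t n + s) * norm x" using t(1)[of n] s(1) by (simp add: y_def flip: scaleR_add_left)
    moreover have "1 / 2 * norm x \<le> (t n + s) * norm x" using t(1)[of n] s(1) by (intro mult_right_mono) auto
    ultimately have xy: "norm x \<le> 2 * norm y" by simp
    have "deriv_at f y x = (\<Sum>b\<in>Basis. (x \<bullet> b) *\<^sub>R deriv_at f y b)"
    proof -
      have lin: "linear (deriv_at f y)"
        by (rule has_derivative_linear[OF schwartz_has_derivative[OF f]])
      have "deriv_at f y (\<Sum>b\<in>Basis. (x \<bullet> b) *\<^sub>R b) = (\<Sum>b\<in>Basis. (x \<bullet> b) *\<^sub>R deriv_at f y b)"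
        by (simp add: linear_sum[OF lin] linear_scale[OF lin])
      then show ?thesis by (simp only: euclidean_representation)
    qed
    also have "cmod \<dots> \<le> (\<Sum>b\<in>Basis. norm x * cmod (deriv_at f y b))"
      by (intro sum_norm_le) (auto intro!: mult_right_mono Basis_le_norm)
    finally have "norm x ^ k * cmod (deriv_at f y x) \<le> norm x ^ k * (\<Sum>b\<in>Basis. norm x * cmod (deriv_at f y b))"
      by (intro mult_left_mono) auto
    also have "\<dots> = (\<Sum>b\<in>Basis. norm x ^ Suc k * cmod (deriv_at f y b))"
      by (simp add: sum_distrib_left mult_ac)
    also have "\<dots> \<le> (\<Sum>b\<in>Basis. 2 ^ Suc k * C b)"
    proof (intro sum_mono)
      fix b :: 'a assume b: "b \<in> Basis"
      have "norm x ^ Suc k * cmod (deriv_at f y b) \<le> (2 * norm y) ^ Suc k * cmod (deriv_at f y b)"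
        using xy by (intro mult_right_mono power_mono) auto
      also have "\<dots> = 2 ^ Suc k * (norm y ^ Suc k * cmod (deriv_at f y b))"
        by (simp only: power_mult_distrib mult.assoc)
      also have "\<dots> \<le> 2 ^ Suc k * C b" by (intro mult_left_mono C b) auto
      finally show "norm x ^ Suc k * cmod (deriv_at f y b) \<le> 2 ^ Suc k * C b" .
    qed
    finally have "norm x ^ k * cmod (deriv_at f y x) \<le> M"
      by (simp only: M_def sum_distrib_left)
    then have "(1 - t n) * (norm x ^ k * cmod (deriv_at f y x)) \<le> (1 - t n) * M"
      using t(2)[of n] by (intro mult_left_mono) auto
    moreover have "norm x ^ k * cmod (f (t n *\<^sub>R x) - f x) \<le> norm x ^ k * ((1 - t n) * cmod (deriv_at f y x))"
      by (intro mult_left_mono le') auto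
    ultimately show ?thesis by (simp add: mult_ac)
  qed
  moreover have "(\<lambda>n. (1 - t n) * M) \<longlonglongrightarrow> 0"
    using tendsto_mult_left_zero[OF tendsto_diff[OF tendsto_const[of 1] t(3), simplified]] .
  ultimately show "\<exists>B\<in>null_bounds sequentially. \<forall>n x. norm x ^ k * cmod (f (t n *\<^sub>R x) - f x) \<le> B n"
    by (intro bexI[of _ "\<lambda>n. (1 - t n) * M"] null_boundsI) auto
qed

text \<open>
  A derivative of \<open>f (t x) - f x\<close> is \<open>t (g (t x) - g x) + (t - 1) g x\<close> with \<open>g\<close> the derivative of \<open>f\<close>; the
  first summand has the original form and the second carries a null factor.
\<close>

lemma dilation_tendsto:
  fixes f :: "'a::euclidean_space \<Rightarrow> complex" and t :: "nat \<Rightarrow> real"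
  assumes f: "schwartz f" and t: "\<And>n. 1 / 2 \<le> t n" "\<And>n. t n < 1" "t \<longlonglongrightarrow> 1"
  shows "schwartz_family (null_bounds sequentially) (\<lambda>n x. f (t n *\<^sub>R x) - f x)"
  unfolding schwartz_family_def
proof
  fix N show "reg (rapid (null_bounds sequentially)) N (\<lambda>n x. f (t n *\<^sub>R x) - f x)"
    using f
  proof (induction N arbitrary: f)
    case 0
    then show ?case using dilation_rapid[OF 0 t] by simp
  next
    case (Suc N)
    note d = schwartz_has_derivative[OF Suc.prems]
    have lin: "linear (deriv_at f x)" for x
      by (rule has_derivative_linear[OF d])
    show ?case
    proof (rule reg_SucI)
      show "rapid (null_bounds sequentially) (\<lambda>n x. f (t n *\<^sub>R x) - f x)"
        by (rule dilation_rapid[OF Suc.prems t])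
      show "((\<lambda>x. f (t n *\<^sub>R x) - f x) has_derivative
        (\<lambda>h. deriv_at f (t n *\<^sub>R x) (t n *\<^sub>R h) - deriv_at f x h)) (at x)" for n x
        by (rule has_derivative_diff[OF has_derivative_compose[where g=f, OF _ d] d]) (auto intro!: derivative_eq_intros)
      fix b :: 'a assume b: "b \<in> Basis"
      let ?g = "\<lambda>x. deriv_at f x b"
      have g: "schwartz ?g" by (rule schwartz_deriv[OF Suc.prems b])
      have "(\<lambda>n. t n - 1) \<longlonglongrightarrow> 0" using tendsto_diff[OF t(3) tendsto_const[of 1]] by simp
      moreover have "\<bar>t n\<bar> \<le> 1" for n using t(1,2)[of n] by auto
      ultimately have "reg (rapid (null_bounds sequentially)) N (\<lambda>n x. of_real (t n) * (?g (t n *\<^sub>R x) - ?g x) + of_real (t n - 1) * ?g x)"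
        by (intro reg_add reg_scale[where c="\<lambda>n. of_real (t n)" and P="rapid (null_bounds sequentially)"] reg_null_scale Suc.IH g rapid_add bound_class_null)
          (auto intro: rapid_index_scale[OF bound_class_null])
      then show "reg (rapid (null_bounds sequentially)) N (\<lambda>n x. deriv_at f (t n *\<^sub>R x) (t n *\<^sub>R b) - ?g x)"
        by (simp add: linear_scale[OF lin] scaleR_conv_of_real algebra_simps)
    qed
  qed
qed

text \<open>
  Where \<open>\<theta> (r x)\<close> is nonzero, \<open>r * norm x \<ge> 1\<close>. Spending one extra power of \<open>norm x\<close> gains a factor \<open>r\<close>.
\<close>

lemma tail_rapid:
  fixes f \<theta> :: "'a::euclidean_space \<Rightarrow> complex" and r :: "nat \<Rightarrow> real"
  assumes f: "schwartz f" and \<theta>: "unif const_bounds (\<lambda>_::unit. \<theta>)" "\<And>x. norm x < 1 \<Longrightarrow> \<theta> x = 0"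
    and r: "\<And>n. 0 < r n" "r \<longlonglongrightarrow> 0"
  shows "rapid (null_bounds sequentially) (\<lambda>n x. f x * \<theta> (r n *\<^sub>R x))"
proof (rule rapidI)
  fix k
  obtain T where T: "\<And>x. cmod (\<theta> x) \<le> T" using \<theta>(1) by (auto simp: unif_def const_bounds_def)
  have T0: "0 \<le> T" by (rule order_trans[OF norm_ge_zero T])
  obtain C where C: "\<And>x. norm x ^ Suc k * cmod (f x) \<le> C" using schwartz_decay[OF f] by metis
  have C0: "0 \<le> C" using C[of 0] by simp
  have "norm x ^ k * cmod (f x * \<theta> (r n *\<^sub>R x)) \<le> r n * (C * T)" for n x
  proof (cases "norm (r n *\<^sub>R x) < 1")
    case True
    then show ?thesis using \<theta>(2)[OF True] r(1)[of n] C0 T0 by simp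
  next
    case False
    then have "1 \<le> r n * norm x" using r(1)[of n] by simp
    then have "1 * (norm x ^ k * cmod (f x)) \<le> (r n * norm x) * (norm x ^ k * cmod (f x))"
      by (intro mult_right_mono) auto
    also have "\<dots> = r n * (norm x ^ Suc k * cmod (f x))" by (simp add: mult_ac)
    also have "\<dots> \<le> r n * C" using r(1)[of n] by (intro mult_left_mono C) auto
    finally have A: "norm x ^ k * cmod (f x) \<le> r n * C" by simp
    have "(norm x ^ k * cmod (f x)) * cmod (\<theta> (r n *\<^sub>R x)) \<le> (r n * C) * T"
      by (rule mult_mono[OF A T]) (use r(1)[of n] C0 in auto)
    then show ?thesis by (simp add: norm_mult mult_ac)
  qed
  moreover have "(\<lambda>n. r n * (C * T)) \<longlonglongrightarrow> 0" by (rule tendsto_mult_left_zero[OF r(2)])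
  ultimately show "\<exists>B\<in>null_bounds sequentially. \<forall>n x. norm x ^ k * cmod (f x * \<theta> (r n *\<^sub>R x)) \<le> B n"
    by (intro bexI[of _ "\<lambda>n. r n * (C * T)"] null_boundsI) auto
qed

lemma tail_tendsto:
  fixes f \<theta> :: "'a::euclidean_space \<Rightarrow> complex" and r :: "nat \<Rightarrow> real"
  assumes f: "schwartz f" and \<theta>: "\<And>n. reg (unif const_bounds) n (\<lambda>_::unit. \<theta>)" "\<And>x. norm x < 1 \<Longrightarrow> \<theta> x = 0"
    and r: "\<And>n. 0 < r n" "\<And>n. r n \<le> 1" "r \<longlonglongrightarrow> 0"
  shows "schwartz_family (null_bounds sequentially) (\<lambda>n x. f x * \<theta> (r n *\<^sub>R x))"
  unfolding schwartz_family_def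
proof
  fix N show "reg (rapid (null_bounds sequentially)) N (\<lambda>n x. f x * \<theta> (r n *\<^sub>R x))"
    using f \<theta>
  proof (induction N arbitrary: f \<theta>)
    case 0
    then show ?case using tail_rapid[OF 0(1) reg_imp[OF 0(2)] 0(3) r(1,3)] by simp
  next
    case (Suc N)
    note df = schwartz_has_derivative[OF Suc.prems(1)]
    have d\<theta>: "(\<theta> has_derivative deriv_at \<theta> x) (at x)" for x
      using reg_has_derivative[OF Suc.prems(2)] .
    have lin: "linear (deriv_at \<theta> x)" for x
      by (rule has_derivative_linear[OF d\<theta>])
    show ?case
    proof (rule reg_SucI)
      show "rapid (null_bounds sequentially) (\<lambda>n x. f x * \<theta> (r n *\<^sub>R x))"
        by (rule tail_rapid[OF Suc.prems(1) reg_imp[OF Suc.prems(2)] Suc.prems(3) r(1,3)])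
      show "((\<lambda>x. f x * \<theta> (r n *\<^sub>R x)) has_derivative
        (\<lambda>h. f x * deriv_at \<theta> (r n *\<^sub>R x) (r n *\<^sub>R h) + deriv_at f x h * \<theta> (r n *\<^sub>R x))) (at x)" for n x
        by (rule has_derivative_mult[OF df has_derivative_compose[where g=\<theta>, OF _ d\<theta>]]) (auto intro!: derivative_eq_intros)
      fix b :: 'a assume b: "b \<in> Basis"
      let ?\<theta>' = "\<lambda>x. deriv_at \<theta> x b"
      have 1: "reg (unif const_bounds) n (\<lambda>_::unit. ?\<theta>')" for n
        using Suc.prems(2)[of "Suc n"] b by simp
      have 2: "?\<theta>' x = 0" if "norm x < 1" for x
        by (rule frechet_zero_off[where K="- ball 0 1"]) (use Suc.prems(3) that in \<open>auto simp: closed_def\<close>)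
      have "\<bar>r n\<bar> \<le> 1" for n using r(1,2)[of n] by auto
      then have "reg (rapid (null_bounds sequentially)) N (\<lambda>n x. of_real (r n) * (f x * ?\<theta>' (r n *\<^sub>R x)) + deriv_at f x b * \<theta> (r n *\<^sub>R x))"
        by (intro reg_add reg_scale[where c="\<lambda>n. of_real (r n)" and P="rapid (null_bounds sequentially)"] Suc.IH Suc.prems 1 2 schwartz_deriv b rapid_add bound_class_null)
          (auto intro: rapid_index_scale[OF bound_class_null])
      then show "reg (rapid (null_bounds sequentially)) N (\<lambda>n x. f x * deriv_at \<theta> (r n *\<^sub>R x) (r n *\<^sub>R b) + deriv_at f x b * \<theta> (r n *\<^sub>R x))"
        by (simp add: linear_scale[OF lin] scaleR_conv_of_real mult_ac)
    qed
  qed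
qed

lemma smooth_dilate: "smooth f \<Longrightarrow> smooth (\<lambda>x. f (r *\<^sub>R x))"
  unfolding smooth_iff_reg by (auto intro: reg_dilate[where f="\<lambda>_. f"])

text \<open>
  The cutoffs \<open>f x * cutoff (r x)\<close> are test functions supported off the support of \<open>u\<close>, and they converge to
  \<open>f\<close> as \<open>r\<close> tends to \<open>0\<close>.
\<close>

lemma schwartz_off_support:
  assumes u: "seq_tempered u" and f: "schwartz f" and disj: "fun_support f \<inter> distr_support u = {}"
  shows "u f = 0"
proof -
  define r where "r n = inverse (real (Suc n))" for n
  have r: "0 < r n" "r n \<le> 1" for n by (auto simp: r_def divide_simps)
  have r0: "r \<longlonglongrightarrow> 0" unfolding r_def by (rule LIMSEQ_inverse_real_of_nat)
  have lin: "schwartz_linear u" using u by (simp add: seq_tempered_def)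
  let ?\<theta> = "\<lambda>x::'a. -1 * (1 + -1 * cutoff x)"
  have cut: "test_function (cutoff :: 'a \<Rightarrow> complex)" by (rule cutoff_test_function)
  have uc: "unif const_bounds (\<lambda>(_::unit) (_::'a). c)" for c
    by (auto simp: unif_def const_bounds_def)
  have creg: "reg (unif const_bounds) n (\<lambda>_::unit. (\<lambda>_::'a. c::complex))" for n c
  proof (induction n arbitrary: c)
    case (Suc n)
    show ?case by (rule reg_SucI[where f'="\<lambda>_ _ _. 0"]) (auto simp: Suc uc)
  qed (simp add: uc)
  have \<theta>: "reg (unif const_bounds) n (\<lambda>_::unit. ?\<theta>)" for n
    by (intro reg_cmult reg_add creg schwartz_imp_unif test_function_imp_schwartz cut unif_add unif_cmult bound_class_const)
  have "schwartz_family (null_bounds sequentially) (\<lambda>n x. f x * ?\<theta> (r n *\<^sub>R x))"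
    by (rule tail_tendsto[OF f \<theta> _ r r0]) (simp add: cutoff_eq_1)
  then have "schwartz_family (null_bounds sequentially) (\<lambda>n x. f x * cutoff (r n *\<^sub>R x) - f x)"
    by (simp add: algebra_simps)
  then have lim: "(\<lambda>n. u (\<lambda>x. f x * cutoff (r n *\<^sub>R x))) \<longlonglongrightarrow> u f"
    using u f by (simp add: seq_tempered_def)
  have "u (\<lambda>x. f x * cutoff (r n *\<^sub>R x)) = 0" for n
  proof (rule test_function_off_support[OF lin])
    have sm: "smooth (\<lambda>x. f x * cutoff (r n *\<^sub>R x))"
      using cut by (intro smooth_mult[OF schwartz_imp_smooth[OF f]] smooth_dilate) (simp add: test_function_def)
    have cz: "cutoff y = 0" if "2 < norm y" for y :: 'a
      using that by (simp add: cutoff_def bump_zero)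
    show "test_function (\<lambda>x. f x * cutoff (r n *\<^sub>R x))"
    proof (rule test_functionI[OF sm, where K="cball 0 (2 / r n)"])
      fix x :: 'a assume "x \<notin> cball 0 (2 / r n)"
      then have "2 < norm (r n *\<^sub>R x)" using r(1)[of n] by (simp add: field_simps)
      then show "f x * cutoff (r n *\<^sub>R x) = 0" by (simp add: cz)
    qed simp
    have "fun_support (\<lambda>x. f x * cutoff (r n *\<^sub>R x)) \<subseteq> fun_support f"
      by (rule fun_support_subset[OF closed_fun_support]) (simp add: fun_support_zero)
    then show "fun_support (\<lambda>x. f x * cutoff (r n *\<^sub>R x)) \<inter> distr_support u = {}"
      using disj by auto
  qed
  with lim have "(\<lambda>n. 0) \<longlonglongrightarrow> u f" by simp
  then show ?thesis by (simp add: LIMSEQ_const_iff)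
qed

text \<open>
  A Schwartz function that vanishes on the support need not be annihilated (consider a derivative of
  the Dirac distribution). The condition \<open>star\<close> excludes this: the dilates \<open>f (t x)\<close> with \<open>t < 1\<close> vanish
  on a neighbourhood of \<open>K\<close>, and they converge to \<open>f\<close> as \<open>t\<close> tends to \<open>1\<close>.
\<close>

theorem vanishing_on_support:
  assumes u: "seq_tempered u" and f: "schwartz f"
    and supp: "distr_support u \<subseteq> K" and zero: "\<And>x. x \<in> K \<Longrightarrow> f x = 0"
    and star: "\<And>t. 0 < t \<Longrightarrow> t < 1 \<Longrightarrow> K \<subseteq> interior ((\<lambda>x. t *\<^sub>R x) -` K)"
  shows "u f = 0"
proof -
  define t where "t n = 1 - inverse (real (Suc (Suc n)))" for n
  have t: "1 / 2 \<le> t n" "t n < 1" for n by (auto simp: t_def divide_simps)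
  have t1: "t \<longlonglongrightarrow> 1"
    using tendsto_diff[OF tendsto_const[of 1] LIMSEQ_Suc[OF LIMSEQ_inverse_real_of_nat]] by (simp add: t_def[abs_def])
  have fam: "schwartz_family (null_bounds sequentially) (\<lambda>n x. f (t n *\<^sub>R x) - f x)"
    by (rule dilation_tendsto[OF f t t1])
  then have lim: "(\<lambda>n. u (\<lambda>x. f (t n *\<^sub>R x))) \<longlonglongrightarrow> u f"
    using u f by (simp add: seq_tempered_def)
  have "u (\<lambda>x. f (t n *\<^sub>R x)) = 0" for n
  proof (rule schwartz_off_support[OF u])
    show "schwartz (\<lambda>x. f (t n *\<^sub>R x))"
      using schwartz_add[OF schwartz_family_member[OF fam, of n] f] by simp
    let ?W = "interior ((\<lambda>x. t n *\<^sub>R x) -` K)"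
    have "fun_support (\<lambda>x. f (t n *\<^sub>R x)) \<subseteq> - ?W"
      by (rule fun_support_subset) (use zero interior_subset in \<open>auto simp: closed_def\<close>)
    moreover have "K \<subseteq> ?W" using t[of n] by (intro star) auto
    ultimately show "fun_support (\<lambda>x. f (t n *\<^sub>R x)) \<inter> distr_support u = {}"
      using supp by blast
  qed
  with lim have "(\<lambda>n. 0) \<longlonglongrightarrow> u f" by simp
  then show ?thesis by (simp add: LIMSEQ_const_iff)
qed

section \<open>Continuity of tempered distributions along families\<close>

lemma iter_deriv_add:
  assumes "smooth f" "smooth g" "set vs \<subseteq> Basis"
  shows "iter_deriv vs (\<lambda>x. f x + g x) = (\<lambda>x. iter_deriv vs f x + iter_deriv vs g x)"
  using assms
proof (induction vs arbitrary: f g rule: rev_induct)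
  case (snoc b vs)
  have "deriv_at (\<lambda>x. f x + g x) x = (\<lambda>h. deriv_at f x h + deriv_at g x h)" for x
    using frechet_derivative_at[OF has_derivative_add[OF smooth_has_derivative[OF snoc.prems(1)] smooth_has_derivative[OF snoc.prems(2)]]] by metis
  then show ?case
    using snoc by (simp add: iter_deriv_snoc smooth_deriv)
qed simp

lemma seminorm_triangle:
  assumes f: "schwartz f" and g: "schwartz g" and vs: "set vs \<subseteq> Basis"
  shows "schwartz_seminorm k vs (\<lambda>x. f x + g x) \<le> schwartz_seminorm k vs f + schwartz_seminorm k vs g"
  unfolding schwartz_seminorm_def iter_deriv_add[OF schwartz_imp_smooth[OF f] schwartz_imp_smooth[OF g] vs]
proof (rule cSUP_least)
  fix x
  have "bdd_above (range (\<lambda>x. norm x ^ k * cmod (iter_deriv vs f x)))" "bdd_above (range (\<lambda>x. norm x ^ k * cmod (iter_deriv vs g x)))"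
    using f g vs by (auto simp: schwartz_def)
  then have "norm x ^ k * cmod (iter_deriv vs f x) \<le> (SUP x. norm x ^ k * cmod (iter_deriv vs f x))"
    "norm x ^ k * cmod (iter_deriv vs g x) \<le> (SUP x. norm x ^ k * cmod (iter_deriv vs g x))"
    by (auto intro: cSUP_upper)
  moreover have "norm x ^ k * cmod (iter_deriv vs f x + iter_deriv vs g x) \<le> norm x ^ k * cmod (iter_deriv vs f x) + norm x ^ k * cmod (iter_deriv vs g x)"
    by (simp add: distrib_left[symmetric] mult_left_mono norm_triangle_ineq)
  ultimately show "norm x ^ k * cmod (iter_deriv vs f x + iter_deriv vs g x) \<le>
    (SUP x. norm x ^ k * cmod (iter_deriv vs f x)) + (SUP x. norm x ^ k * cmod (iter_deriv vs g x))"
    by linarith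
qed simp

text \<open>
  Convergence in all seminorms implies convergence in the topology that they generate. By induction
  over the generation of \<open>W\<close> it is enough to treat a subbasic set, where the triangle inequality applies.
\<close>

lemma schwartz_topology_eventually:
  fixes f :: "'a::euclidean_space \<Rightarrow> complex"
  assumes f: "schwartz f" and fam: "schwartz_family (null_bounds F) (\<lambda>i x. h i x - f x)"
    and W: "openin schwartz_topology W" "f \<in> W"
  shows "\<forall>\<^sub>F i in F. h i \<in> W"
proof -
  have h: "schwartz (h i)" for i
    using schwartz_add[OF schwartz_family_member[OF fam, of i] f] by simp
  have "generate_topology_on {{f. schwartz f \<and> schwartz_seminorm k vs (\<lambda>x. f x - h x) < r} | k vs h r.
        set vs \<subseteq> Basis \<and> schwartz h \<and> 0 < r} W"
    using W(1) unfolding schwartz_topology_def openin_topology_generated_by_iff .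
  then show ?thesis
    using W(2)
  proof (induction rule: generate_topology_on.induct)
    case (Int a b)
    then show ?case by (auto intro: eventually_conj)
  next
    case (UN K)
    then obtain k where "k \<in> K" "f \<in> k" by auto
    with UN(2) have "\<forall>\<^sub>F i in F. h i \<in> k" by auto
    then show ?case by (rule eventually_mono) (use \<open>k \<in> K\<close> in auto)
  next
    case (Basis s)
    then obtain k vs p r where s: "s = {f. schwartz f \<and> schwartz_seminorm k vs (\<lambda>x. f x - p x) < r}"
      and vs: "set vs \<subseteq> Basis" and p: "schwartz p" and lt: "schwartz_seminorm k vs (\<lambda>x. f x - p x) < r"
      by auto
    obtain B where B: "B \<in> null_bounds F" "\<And>i. schwartz_seminorm k vs (\<lambda>x. h i x - f x) \<le> B i"
      using schwartz_family_seminorm[OF fam vs] by metis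
    have "(B \<longlongrightarrow> 0) F" using B(1) by (simp add: null_bounds_def)
    then have "\<forall>\<^sub>F i in F. B i < r - schwartz_seminorm k vs (\<lambda>x. f x - p x)"
      by (rule order_tendstoD) (use lt in simp)
    then show ?case
    proof eventually_elim
      case (elim i)
      have "schwartz_seminorm k vs (\<lambda>x. h i x - p x) \<le> schwartz_seminorm k vs (\<lambda>x. h i x - f x) + schwartz_seminorm k vs (\<lambda>x. f x - p x)"
        using seminorm_triangle[OF schwartz_diff[OF h f] schwartz_diff[OF f p] vs, of k] by simp
      also have "\<dots> < r" using B(2)[of i] elim by linarith
      finally show ?case by (simp add: s h)
    qed
  qed auto
qed

lemma topspace_schwartz: "topspace schwartz_topology = {f. schwartz f}"
proof -
  have "f \<in> topspace schwartz_topology" if f: "schwartz f" for f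
  proof -
    have "schwartz_seminorm 0 [] (\<lambda>x. f x - f x) = 0"
      by (simp add: schwartz_seminorm_def)
    then have "f \<in> {h. schwartz h \<and> schwartz_seminorm 0 [] (\<lambda>x. h x - f x) < 1}"
      using f by simp
    then show ?thesis
      unfolding schwartz_topology_def topology_generated_by_topspace
      by (rule UnionI[rotated]) (rule CollectI, intro exI[of _ 0] exI[of _ "[]"] exI[of _ f] exI[of _ 1], use f in simp)
  qed
  then show ?thesis unfolding schwartz_topology_def topology_generated_by_topspace by auto
qed

theorem tempered_tendsto:
  assumes u: "tempered_distribution u" and f: "schwartz f"
    and fam: "schwartz_family (null_bounds F) (\<lambda>i x. h i x - f x)"
  shows "((\<lambda>i. u (h i)) \<longlongrightarrow> u f) F"
proof (rule topological_tendstoI)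
  fix V assume V: "open V" "u f \<in> V"
  have h: "schwartz (h i)" for i
    using schwartz_add[OF schwartz_family_member[OF fam, of i] f] by simp
  have "openin schwartz_topology {x \<in> topspace schwartz_topology. u x \<in> V}"
    using u V(1) by (intro openin_continuous_map_preimage[where Y=euclidean]) (auto simp: tempered_distribution_def)
  from schwartz_topology_eventually[OF f fam this]
  show "\<forall>\<^sub>F i in F. u (h i) \<in> V"
    using V f by (auto simp: topspace_schwartz elim: eventually_mono)
qed

lemma tempered_linear: "tempered_distribution u \<Longrightarrow> schwartz_linear u"
  by (simp add: tempered_distribution_def schwartz_linear_def)

lemma fourier_add:
  assumes "schwartz f" "schwartz g"
  shows "fourier (\<lambda>x. f x + g x) = (\<lambda>\<xi>. fourier f \<xi> + fourier g \<xi>)"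
proof
  fix \<xi>
  have "integrable lborel (\<lambda>x. f x * cis (- 2 * pi * (\<xi> \<bullet> x)))" "integrable lborel (\<lambda>x. g x * cis (- 2 * pi * (\<xi> \<bullet> x)))"
    by (intro integrable_mult_cis schwartz_integrable assms; measurable)+
  then show "fourier (\<lambda>x. f x + g x) \<xi> = fourier f \<xi> + fourier g \<xi>"
    by (simp add: fourier_def distrib_right)
qed

lemma fourier_cmult: "fourier (\<lambda>x. c * f x) = (\<lambda>\<xi>. c * fourier f \<xi>)"
  by (simp add: fourier_def fun_eq_iff mult.assoc)

lemma fourier_family_diff:
  assumes f: "schwartz f" and fam: "schwartz_family (null_bounds F) (\<lambda>i x. h i x - f x)"
  shows "schwartz_family (null_bounds F) (\<lambda>i \<xi>. fourier (h i) \<xi> - fourier f \<xi>)"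
proof -
  have d: "schwartz (\<lambda>x. h i x - f x)" for i using schwartz_family_member[OF fam, of i] .
  have "fourier (\<lambda>x. h i x - f x) = (\<lambda>\<xi>. fourier (h i) \<xi> - fourier f \<xi>)" for i
    using fourier_add[OF d[of i] f] by (simp add: fun_eq_iff)
  then show ?thesis using schwartz_family_fourier[OF bound_class_null fam] by simp
qed

lemma fourier_distr_seq_tempered:
  fixes u :: "'a::euclidean_space functional"
  assumes u: "tempered_distribution u"
  shows "seq_tempered (fourier_distr u)"
  unfolding seq_tempered_def
proof (intro conjI allI impI)
  show "schwartz_linear (fourier_distr u)"
    using tempered_linear[OF u]
    by (auto simp: schwartz_linear_def fourier_distr_def fourier_add fourier_cmult schwartz_fourier)
  fix f :: "'a \<Rightarrow> complex" and h
  assume "schwartz f" "schwartz_family (null_bounds sequentially) (\<lambda>n x. h n x - f x)"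
  then show "(\<lambda>n. fourier_distr u (h n)) \<longlonglongrightarrow> fourier_distr u f"
    unfolding fourier_distr_def by (intro tempered_tendsto[OF u] schwartz_fourier fourier_family_diff)
qed

section \<open>Absolutely convergent sums as integrals\<close>

lemma integrable_count_space_has_sum:
  fixes f :: "'a \<Rightarrow> 'b::{banach, second_countable_topology}"
  assumes "integrable (count_space A) f"
  shows "(f has_sum integral\<^sup>L (count_space A) f) A"
proof -
  have a: "Infinite_Set_Sum.abs_summable_on f A" using assms by (simp add: abs_summable_on_def)
  then have "f summable_on A"
    using abs_summable_equivalent abs_summable_summable by blast
  then have "(f has_sum infsum f A) A" by simp
  also have "infsum f A = integral\<^sup>L (count_space A) f"
    using infsetsum_infsum[OF a] by (simp add: infsetsum_def)
  finally show ?thesis .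
qed

text \<open>
  The tails of an absolutely convergent sum over the index set \<open>A\<close>. The integrand is defined for every
  set \<open>F\<close>, since families are indexed by all sets and not only by the finite subsets of \<open>A\<close>.
\<close>

lemma integral_complement_tendsto_0:
  fixes m :: "'a \<Rightarrow> real"
  assumes "integrable (count_space A) m"
  shows "((\<lambda>F. LINT l|count_space A. (if l \<in> F then 0 else m l)) \<longlongrightarrow> 0) (finite_subsets_at_top A)"
proof -
  let ?I = "integral\<^sup>L (count_space A) m"
  have "(sum m \<longlongrightarrow> ?I) (finite_subsets_at_top A)"
    using integrable_count_space_has_sum[OF assms] by (simp add: has_sum_def)
  then have "((\<lambda>F. ?I - sum m F) \<longlongrightarrow> ?I - ?I) (finite_subsets_at_top A)"
    by (intro tendsto_diff tendsto_const)
  then have lim: "((\<lambda>F. ?I - sum m F) \<longlongrightarrow> 0) (finite_subsets_at_top A)" by simp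
  have "(LINT l|count_space A. (if l \<in> F then 0 else m l)) = ?I - sum m F" if F: "finite F" "F \<subseteq> A" for F
  proof -
    have "integrable (count_space A) (\<lambda>l. indicator F l * m l)"
      using integrable_mult_indicator[OF _ assms, of F] F by simp
    then have "(LINT l|count_space A. m l - indicator F l * m l) = ?I - (LINT l|count_space A. indicator F l * m l)"
      by (intro Bochner_Integration.integral_diff assms)
    moreover have "(LINT l|count_space A. indicator F l * m l) = (\<Sum>l\<in>F. indicator F l * m l)"
      by (rule integral_count_space_supported) (use F in auto)
    moreover have "m l - indicator F l * m l = (if l \<in> F then 0 else m l)" for l by simp
    ultimately show ?thesis by simp
  qed
  then show ?thesis
    by (intro Lim_transform_eventually[OF lim] eventually_finite_subsets_at_top_weakI) simp
qed

section \<open>The Rihaczek distribution\<close>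

lemma norm_Pair_power_le:
  fixes x :: "'a::real_normed_vector" and y :: "'b::real_normed_vector"
  shows "norm (x, y) ^ k \<le> 2 ^ k * (norm x ^ k + norm y ^ k)"
proof -
  have "norm (x, y) \<le> norm x + norm y" by (rule norm_Pair_le)
  also have "\<dots> \<le> 2 * max (norm x) (norm y)" by simp
  finally have "norm (x, y) ^ k \<le> (2 * max (norm x) (norm y)) ^ k" by (intro power_mono) auto
  also have "\<dots> \<le> 2 ^ k * (norm x ^ k + norm y ^ k)"
    by (auto simp: power_mult_distrib max_def)
  finally show ?thesis .
qed

lemma schwartz_bounded:
  assumes "schwartz f"
  obtains C where "0 \<le> C" "\<And>x. norm x ^ k * cmod (f x) \<le> C" "\<And>x. cmod (f x) \<le> C"
proof -
  obtain A where A: "\<And>x. norm x ^ k * cmod (f x) \<le> A" using schwartz_decay[OF assms] by metis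
  obtain B where B: "\<And>x. norm x ^ 0 * cmod (f x) \<le> B" using schwartz_decay[OF assms] by metis
  show ?thesis
  proof (rule that[of "max 0 (max A B)"])
    show "norm x ^ k * cmod (f x) \<le> max 0 (max A B)" for x using A[of x] by simp
    show "cmod (f x) \<le> max 0 (max A B)" for x using B[of x] by simp
  qed simp
qed

text \<open>
  A derivative of \<open>g x * h \<xi> * exp (-2\<pi>i x \<bullet> \<xi>)\<close> is a sum of two functions of the same shape, in which \<open>g\<close>
  or \<open>h\<close> is differentiated or multiplied by a coordinate. So the growth of the derivatives of the
  exponential does no harm.
\<close>

lemma twisted_tensor_schwartz:
  fixes g h :: "'a::euclidean_space \<Rightarrow> complex"
  assumes g: "schwartz g" and h: "schwartz h"
  shows "schwartz (\<lambda>(x, \<xi>). g x * h \<xi> * cis (- 2 * pi * (x \<bullet> \<xi>)))"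
proof -
  let ?T = "\<lambda>g h :: 'a \<Rightarrow> complex. \<lambda>z. g (fst z) * h (snd z) * cis (- 2 * pi * (fst z \<bullet> snd z))"
  have P: "rapid const_bounds (\<lambda>_::unit. ?T g h)" if gh: "schwartz g" "schwartz h" for g h
  proof (rule rapidI)
    fix k
    obtain A where A: "0 \<le> A" "\<And>x. norm x ^ k * cmod (g x) \<le> A" "\<And>x. cmod (g x) \<le> A"
      using schwartz_bounded[OF gh(1)] by metis
    obtain B where B: "0 \<le> B" "\<And>x. norm x ^ k * cmod (h x) \<le> B" "\<And>x. cmod (h x) \<le> B"
      using schwartz_bounded[OF gh(2)] by metis
    have "norm z ^ k * cmod (?T g h z) \<le> 2 ^ k * (A * B + A * B)" for z :: "'a \<times> 'a"
    proof -
      obtain x y where z: "z = (x, y)" by (cases z)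
      have "norm (x, y) ^ k * (cmod (g x) * cmod (h y)) \<le> 2 ^ k * (norm x ^ k + norm y ^ k) * (cmod (g x) * cmod (h y))"
        by (intro mult_right_mono norm_Pair_power_le) auto
      also have "\<dots> = 2 ^ k * ((norm x ^ k * cmod (g x)) * cmod (h y) + cmod (g x) * (norm y ^ k * cmod (h y)))"
        by (simp add: algebra_simps)
      also have "\<dots> \<le> 2 ^ k * (A * B + A * B)"
        by (intro mult_left_mono add_mono mult_mono A B) auto
      finally show ?thesis by (simp add: z norm_mult)
    qed
    then show "\<exists>B\<in>const_bounds. \<forall>(i::unit) z. norm z ^ k * cmod (?T g h z) \<le> B i"
      by (intro bexI[of _ "\<lambda>_. 2 ^ k * (A * B + A * B)"]) (auto simp: const_bounds_def)
  qed
  have "reg (rapid const_bounds) n (\<lambda>_::unit. ?T g h)" for n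
    using g h
  proof (induction n arbitrary: g h)
    case 0
    then show ?case using P by simp
  next
    case (Suc n)
    note dg = schwartz_has_derivative[OF Suc.prems(1)] and dh = schwartz_has_derivative[OF Suc.prems(2)]
    let ?g' = "\<lambda>x. deriv_at g x" and ?h' = "\<lambda>x. deriv_at h x"
    let ?e = "\<lambda>z::'a \<times> 'a. cis (- 2 * pi * (fst z \<bullet> snd z))"
    have g0: "?g' x 0 = 0" and h0: "?h' x 0 = 0" for x
      using linear_0[OF has_derivative_linear[OF dg]] linear_0[OF has_derivative_linear[OF dh]] by auto
    show ?case
    proof (rule reg_SucI)
      show "rapid const_bounds (\<lambda>_::unit. ?T g h)" by (rule P[OF Suc.prems])
      fix z :: "'a \<times> 'a"
      have 1: "((\<lambda>z. g (fst z)) has_derivative (\<lambda>k. ?g' (fst z) (fst k))) (at z)"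
        by (rule has_derivative_compose[OF _ dg]) (auto intro!: derivative_eq_intros)
      have 2: "((\<lambda>z. h (snd z)) has_derivative (\<lambda>k. ?h' (snd z) (snd k))) (at z)"
        by (rule has_derivative_compose[OF _ dh]) (auto intro!: derivative_eq_intros)
      have 3: "(?e has_derivative (\<lambda>k. \<i> * of_real (- 2 * pi * (fst k \<bullet> snd z + fst z \<bullet> snd k)) * ?e z)) (at z)"
        by (rule has_derivative_cis) (auto intro!: derivative_eq_intros)
      show "(?T g h has_derivative (\<lambda>k. g (fst z) * h (snd z) * (\<i> * of_real (- 2 * pi * (fst k \<bullet> snd z + fst z \<bullet> snd k)) * ?e z)
          + (g (fst z) * ?h' (snd z) (snd k) + ?g' (fst z) (fst k) * h (snd z)) * ?e z)) (at z)"
        by (intro has_derivative_mult 1 2 3)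
    next
      fix b :: "'a \<times> 'a" assume "b \<in> Basis"
      then consider v where "v \<in> Basis" "b = (v, 0)" | v where "v \<in> Basis" "b = (0, v)"
        by (auto simp: Basis_prod_def)
      then show "reg (rapid const_bounds) n (\<lambda>(_::unit) z. g (fst z) * h (snd z) * (\<i> * of_real (- 2 * pi * (fst b \<bullet> snd z + fst z \<bullet> snd b)) * ?e z)
          + (g (fst z) * ?h' (snd z) (snd b) + ?g' (fst z) (fst b) * h (snd z)) * ?e z)"
      proof cases
        case 1
        have "schwartz (\<lambda>y. of_real (y \<bullet> v) * h y)"
          using schwartz_family_member[OF schwartz_family_coord[OF bound_class_const 1(1) schwartz_family_constI[OF Suc.prems(2)]]] by simp
        then have "reg (rapid const_bounds) n (\<lambda>(_::unit) z. (\<i> * of_real (- 2 * pi)) * ?T g (\<lambda>y. of_real (y \<bullet> v) * h y) z + ?T (\<lambda>x. ?g' x v) h z)"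
          by (intro reg_add reg_cmult Suc.IH schwartz_deriv Suc.prems 1 rapid_add rapid_cmult bound_class_const)
        then show ?thesis
          by (simp add: 1 h0 inner_commute[of v] mult_ac)
      next
        case 2
        have "schwartz (\<lambda>y. of_real (y \<bullet> v) * g y)"
          using schwartz_family_member[OF schwartz_family_coord[OF bound_class_const 2(1) schwartz_family_constI[OF Suc.prems(1)]]] by simp
        then have "reg (rapid const_bounds) n (\<lambda>(_::unit) z. (\<i> * of_real (- 2 * pi)) * ?T (\<lambda>y. of_real (y \<bullet> v) * g y) h z + ?T g (\<lambda>x. ?h' x v) z)"
          by (intro reg_add reg_cmult Suc.IH schwartz_deriv Suc.prems 2 rapid_add rapid_cmult bound_class_const)
        then show ?thesis
          by (simp add: 2 g0 mult_ac)
      qed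
    qed
  qed
  then have "schwartz (?T g h)" by (intro schwartz_familyD) (simp add: schwartz_family_def)
  then show ?thesis by (simp add: case_prod_unfold)
qed

lemma rihaczek_schwartz: "schwartz f \<Longrightarrow> schwartz g \<Longrightarrow> schwartz (rihaczek f g)"
  unfolding rihaczek_def by (intro twisted_tensor_schwartz schwartz_cnj schwartz_fourier)

text \<open>
  A time-frequency shift by \<open>(p, q)\<close> becomes, up to a phase, a translation by \<open>q\<close>.
\<close>

lemma fourier_tf_shift:
  fixes g :: "real ^ 'd \<Rightarrow> complex"
  assumes g: "schwartz g"
  shows "fourier (tf_shift (p, q) g) \<xi> = cis (- 2 * pi * (p \<bullet> (\<xi> - q))) * fourier g (\<xi> - q)"
proof -
  let ?G = "\<lambda>t. cis (- 2 * pi * (p \<bullet> (\<xi> - q))) * (g t * cis (- 2 * pi * ((\<xi> - q) \<bullet> t)))"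
  have "integrable lborel (\<lambda>t. g t * cis (- 2 * pi * ((\<xi> - q) \<bullet> t)))"
    by (intro integrable_mult_cis schwartz_integrable g) measurable
  then have i: "integrable lborel ?G" by (rule integrable_mult_right)
  have "tf_shift (p, q) g t * cis (- 2 * pi * (\<xi> \<bullet> t)) = ?G (t + (- p))" for t
  proof -
    have "2 * pi * (q \<bullet> t) + - 2 * pi * (\<xi> \<bullet> t) = - 2 * pi * (p \<bullet> (\<xi> - q)) + - 2 * pi * ((\<xi> - q) \<bullet> (t + - p))"
      by (simp add: inner_diff_left inner_diff_right inner_add_right inner_commute[of p] algebra_simps)
    then have "cis (2 * pi * (q \<bullet> t)) * cis (- 2 * pi * (\<xi> \<bullet> t)) = cis (- 2 * pi * (p \<bullet> (\<xi> - q))) * cis (- 2 * pi * ((\<xi> - q) \<bullet> (t + - p)))"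
      by (simp only: cis_mult)
    then show ?thesis by (simp add: tf_shift_def mult_ac)
  qed
  then have "fourier (tf_shift (p, q) g) \<xi> = (LINT t|lborel. ?G (t + (- p)))"
    by (simp add: fourier_def)
  also have "\<dots> = (LINT t|lborel. ?G t)" by (rule integral_shift[OF i])
  finally show ?thesis by (simp add: fourier_def)
qed

text \<open>
  The phases of the two factors and of the chirp combine to the chirp at the shifted point.
\<close>

lemma rihaczek_tf_shift:
  fixes g :: "real ^ 'd \<Rightarrow> complex"
  assumes g: "schwartz g"
  shows "rihaczek (tf_shift l g) (tf_shift l g) = translate l (rihaczek g g)"
proof
  fix z :: "(real ^ 'd) \<times> (real ^ 'd)"
  obtain p q where l: "l = (p, q)" by (cases l)
  obtain x \<xi> where z: "z = (x, \<xi>)" by (cases z)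
  have "2 * pi * (q \<bullet> x) + 2 * pi * (p \<bullet> (\<xi> - q)) + - 2 * pi * (x \<bullet> \<xi>) = - 2 * pi * ((x - p) \<bullet> (\<xi> - q))"
    by (simp add: inner_diff_left inner_diff_right inner_commute[of q] algebra_simps)
  then have "cis (2 * pi * (q \<bullet> x)) * cis (2 * pi * (p \<bullet> (\<xi> - q))) * cis (- 2 * pi * (x \<bullet> \<xi>)) = cis (- 2 * pi * ((x - p) \<bullet> (\<xi> - q)))"
    by (simp only: cis_mult)
  then show "rihaczek (tf_shift l g) (tf_shift l g) z = translate l (rihaczek g g) z"
    by (simp add: l z rihaczek_def translate_def fourier_tf_shift[OF g] tf_shift_def cis_cnj mult_ac)
qed

text \<open>
  For fixed \<open>x\<close> the integral over \<open>\<xi>\<close> is an inverse Fourier transform of \<open>cnj (fourier g)\<close>, which recovers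
  \<open>cnj (g (x + y))\<close>. The remaining integral over \<open>x\<close> is the short-time Fourier transform at \<open>(-y, \<eta>)\<close>.
\<close>

lemma fourier_rihaczek:
  fixes g :: "real ^ 'd \<Rightarrow> complex"
  assumes f: "schwartz f" and g: "schwartz g"
  shows "fourier (rihaczek f g) = flip_map (stft g f)"
proof
  fix w :: "(real ^ 'd) \<times> (real ^ 'd)"
  obtain \<eta> y where w: "w = (\<eta>, y)" by (cases w)
  let ?F = "\<lambda>z. rihaczek f g z * cis (- 2 * pi * (w \<bullet> z))"
  have "integrable lborel ?F"
    by (intro integrable_mult_cis schwartz_integrable rihaczek_schwartz f g) measurable
  then have int: "integrable (lborel \<Otimes>\<^sub>M lborel) ?F" by (simp add: lborel_prod)
  have "fourier (rihaczek f g) w = (LINT z|(lborel \<Otimes>\<^sub>M lborel). ?F z)" by (simp add: fourier_def lborel_prod)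
  also have "\<dots> = (LINT x|lborel. LINT \<xi>|lborel. ?F (x, \<xi>))"
    by (rule lborel_pair.integral_fst'[OF int, symmetric])
  also have "\<dots> = (LINT x|lborel. f x * cnj (g (x - (- y))) * cis (- 2 * pi * (\<eta> \<bullet> x)))"
  proof (rule Bochner_Integration.integral_cong[OF refl])
    fix x
    have "?F (x, \<xi>) = (f x * cis (- 2 * pi * (\<eta> \<bullet> x))) * cnj (fourier g \<xi> * cis (2 * pi * (\<xi> \<bullet> (x + y))))" for \<xi>
    proof -
      have "- 2 * pi * (x \<bullet> \<xi>) + - 2 * pi * (\<eta> \<bullet> x + y \<bullet> \<xi>) = - 2 * pi * (\<eta> \<bullet> x) + - (2 * pi * (\<xi> \<bullet> (x + y)))"
        by (simp add: inner_add_right inner_commute[of _ \<xi>] algebra_simps)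
      then have "cis (- 2 * pi * (x \<bullet> \<xi>)) * cis (- 2 * pi * (\<eta> \<bullet> x + y \<bullet> \<xi>)) = cis (- 2 * pi * (\<eta> \<bullet> x)) * cis (- (2 * pi * (\<xi> \<bullet> (x + y))))"
        by (simp only: cis_mult)
      then show ?thesis by (simp add: rihaczek_def w cis_cnj mult_ac)
    qed
    then have "(LINT \<xi>|lborel. ?F (x, \<xi>)) =
        (f x * cis (- 2 * pi * (\<eta> \<bullet> x))) * (LINT \<xi>|lborel. cnj (fourier g \<xi> * cis (2 * pi * (\<xi> \<bullet> (x + y)))))"
      by (simp only: integral_mult_right_zero)
    also have "(LINT \<xi>|lborel. cnj (fourier g \<xi> * cis (2 * pi * (\<xi> \<bullet> (x + y))))) = cnj (inverse_fourier (fourier g) (x + y))"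
      unfolding inverse_fourier_def by (rule Bochner_Integration.integral_cnj)
    finally have "(LINT \<xi>|lborel. ?F (x, \<xi>)) = (f x * cis (- 2 * pi * (\<eta> \<bullet> x))) * cnj (inverse_fourier (fourier g) (x + y))" .
    then show "(LINT \<xi>|lborel. ?F (x, \<xi>)) = f x * cnj (g (x - (- y))) * cis (- 2 * pi * (\<eta> \<bullet> x))"
      by (simp add: inverse_fourier_fourier[OF g])
  qed
  also have "\<dots> = flip_map (stft g f) w"
    by (simp add: flip_map_def stft_def w)
  finally show "fourier (rihaczek f g) w = flip_map (stft g f) w" .
qed

lemma cnj_fourier: "cnj (fourier f \<xi>) = inverse_fourier (\<lambda>x. cnj (f x)) \<xi>"
proof -
  have "cnj (fourier f \<xi>) = (LINT x|lborel. cnj (f x * cis (- 2 * pi * (\<xi> \<bullet> x))))"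
    unfolding fourier_def by (rule Bochner_Integration.integral_cnj[symmetric])
  then show ?thesis by (simp add: inverse_fourier_def cis_cnj inner_commute)
qed

lemma fourier_modulate: "fourier (\<lambda>w. f w * cis (2 * pi * (l \<bullet> w))) z = fourier f (z - l)"
  unfolding fourier_def
  by (intro Bochner_Integration.integral_cong refl) (simp add: mult.assoc cis_mult inner_diff_left algebra_simps)

text \<open>
  Fubini, followed by the observation that translation by \<open>l\<close> is modulation on the Fourier side.
\<close>

lemma pairing_translate_inverse_fourier:
  fixes \<Phi> f :: "'a::euclidean_space \<Rightarrow> complex"
  assumes \<Phi>: "schwartz \<Phi>" and f: "schwartz f"
  shows "distr_of (translate l (inverse_fourier \<Phi>)) f = fourier (\<lambda>w. \<Phi> w * inverse_fourier f w) l"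
proof -
  have "distr_of (translate l (inverse_fourier \<Phi>)) f = (LINT z|lborel. f z * (LINT w|lborel. \<Phi> w * cis (2 * pi * (w \<bullet> (z - l)))))"
    by (simp add: distr_of_def translate_def inverse_fourier_def mult.commute)
  also have "\<dots> = (LINT w|lborel. \<Phi> w * (LINT z|lborel. f z * cis (2 * pi * (w \<bullet> (z - l)))))"
    by (rule lborel_pair.integral_swap_kernel(2)) (auto intro: schwartz_integrable \<Phi> f)
  also have "\<dots> = (LINT w|lborel. \<Phi> w * inverse_fourier f w * cis (- 2 * pi * (l \<bullet> w)))"
  proof (rule Bochner_Integration.integral_cong[OF refl])
    fix w
    have "(LINT z|lborel. f z * cis (2 * pi * (w \<bullet> (z - l)))) = (LINT z|lborel. f z * cis (2 * pi * (z \<bullet> w)) * cis (- 2 * pi * (l \<bullet> w)))"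
      by (intro Bochner_Integration.integral_cong refl)
        (simp add: mult.assoc cis_mult inner_diff_right inner_commute[of w] algebra_simps)
    also have "\<dots> = inverse_fourier f w * cis (- 2 * pi * (l \<bullet> w))"
      unfolding inverse_fourier_def by (rule integral_mult_left_zero)
    finally show "\<Phi> w * (LINT z|lborel. f z * cis (2 * pi * (w \<bullet> (z - l)))) = \<Phi> w * inverse_fourier f w * cis (- 2 * pi * (l \<bullet> w))"
      by (simp add: mult.assoc)
  qed
  finally show ?thesis by (simp add: fourier_def)
qed

section \<open>The lattice and the box in phase space\<close>

definition const_pair :: "real \<Rightarrow> real \<Rightarrow> (real ^ 'd) \<times> (real ^ 'd)" where
  "const_pair a b = (\<chi> i. a, \<chi> i. b)"

lemma Basis_pair_cases:
  assumes "e \<in> (Basis :: ((real ^ 'd) \<times> (real ^ 'd)) set)"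
  obtains i where "e = (axis i 1, 0)" | i where "e = (0, axis i 1)"
  using assms by (auto simp: Basis_prod_def Basis_vec_def)

lemma axis_in_Basis: "(axis i 1, 0) \<in> (Basis :: ((real ^ 'd) \<times> (real ^ 'd)) set)" "(0, axis i 1) \<in> (Basis :: ((real ^ 'd) \<times> (real ^ 'd)) set)"
  by (auto simp: Basis_prod_def Basis_vec_def)

lemma ball_Basis_pair: "(\<forall>e\<in>Basis. P (e :: (real ^ 'd) \<times> (real ^ 'd))) \<longleftrightarrow> (\<forall>i. P (axis i 1, 0)) \<and> (\<forall>i. P (0, axis i 1))"
  by (auto simp: axis_in_Basis elim!: Basis_pair_cases)

lemma const_pair_pos: "0 < a \<Longrightarrow> 0 < b \<Longrightarrow> e \<in> Basis \<Longrightarrow> 0 < (const_pair a b :: (real ^ 'd) \<times> (real ^ 'd)) \<bullet> e"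
  by (erule Basis_pair_cases) (auto simp: const_pair_def inner_axis)

lemma prod_const_pair: "(\<Prod>e\<in>Basis. (const_pair a b :: (real ^ 'd) \<times> (real ^ 'd)) \<bullet> e) = (a * b) ^ CARD('d)"
proof -
  have v: "(\<chi> i. c) \<bullet> e = c" if "e \<in> Basis" for c and e :: "real ^ 'd"
    using that by (auto simp: Basis_vec_def inner_axis)
  have "(\<Prod>e\<in>Basis. (const_pair a b :: (real ^ 'd) \<times> (real ^ 'd)) \<bullet> e) =
      (\<Prod>e\<in>(\<lambda>u. (u, 0)) ` (Basis :: (real ^ 'd) set). (const_pair a b :: (real ^ 'd) \<times> (real ^ 'd)) \<bullet> e) *
      (\<Prod>e\<in>(\<lambda>u. (0, u)) ` (Basis :: (real ^ 'd) set). (const_pair a b :: (real ^ 'd) \<times> (real ^ 'd)) \<bullet> e)"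
    unfolding Basis_prod_def by (subst prod.union_disjoint) auto
  also have "\<dots> = (\<Prod>e\<in>(Basis :: (real ^ 'd) set). a) * (\<Prod>e\<in>(Basis :: (real ^ 'd) set). b)"
    by (subst (1 2) prod.reindex) (auto simp: inj_on_def const_pair_def v)
  finally show ?thesis by (simp add: power_mult_distrib)
qed

lemma lattice_eq_grid:
  assumes "0 < a" "0 < b"
  shows "(lattice a b :: ((real ^ 'd) \<times> (real ^ 'd)) set) = grid (const_pair a b)"
proof (intro set_eqI iffI)
  fix z :: "(real ^ 'd) \<times> (real ^ 'd)"
  assume "z \<in> lattice a b"
  then obtain k l where z: "z = (a *\<^sub>R k, b *\<^sub>R l)" and kl: "\<And>i. k $ i \<in> \<int>" "\<And>i. l $ i \<in> \<int>"
    by (auto simp: lattice_def)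
  show "z \<in> grid (const_pair a b)"
    unfolding grid_def mem_Collect_eq ball_Basis_pair
  proof (intro conjI allI)
    fix i
    show "\<exists>n::int. z \<bullet> (axis i 1, 0) = of_int n * (const_pair a b \<bullet> (axis i 1, 0))"
      using kl(1)[of i] by (auto simp: z const_pair_def inner_axis elim!: Ints_cases)
    show "\<exists>n::int. z \<bullet> (0, axis i 1) = of_int n * (const_pair a b \<bullet> (0, axis i 1))"
      using kl(2)[of i] by (auto simp: z const_pair_def inner_axis elim!: Ints_cases)
  qed
next
  fix z :: "(real ^ 'd) \<times> (real ^ 'd)"
  assume "z \<in> grid (const_pair a b)"
  then have z: "\<exists>n::int. fst z $ i = of_int n * a" "\<exists>n::int. snd z $ i = of_int n * b" for i
    unfolding grid_def mem_Collect_eq ball_Basis_pair by (auto simp: const_pair_def inner_axis inner_Pair_0)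
  have "z = (a *\<^sub>R (fst z /\<^sub>R a), b *\<^sub>R (snd z /\<^sub>R b))"
    using assms by simp
  moreover have "(fst z /\<^sub>R a) $ i \<in> \<int>" "(snd z /\<^sub>R b) $ i \<in> \<int>" for i
  proof -
    have "inverse r * x \<in> \<int>" if x: "\<exists>n::int. x = of_int n * r" and r: "0 < r" for r x :: real
    proof -
      obtain n :: int where "x = of_int n * r" using x by blast
      then have "inverse r * x = of_int n" using r by (simp add: field_simps)
      then show ?thesis by simp
    qed
    from this[OF z(1) assms(1)] this[OF z(2) assms(2)]
    show "(fst z /\<^sub>R a) $ i \<in> \<int>" "(snd z /\<^sub>R b) $ i \<in> \<int>"
      by simp_all
  qed
  ultimately show "z \<in> lattice a b"
    unfolding lattice_def mem_Collect_eq by blast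
qed

lemma Q_box_eq: "(Q_box a b \<epsilon> :: ((real ^ 'd) \<times> (real ^ 'd)) set) =
    {w. \<forall>e\<in>Basis. \<bar>w \<bullet> e\<bar> \<le> const_pair (1 / (2 * a) - \<epsilon>) (1 / (2 * b) - \<epsilon>) \<bullet> e}"
proof -
  have "(x \<in> {- 1 / (2 * c) + \<epsilon>..1 / (2 * c) - \<epsilon>}) = (\<bar>x\<bar> \<le> 1 / (2 * c) - \<epsilon>)" for x c :: real
    by (auto simp: abs_le_iff)
  then show ?thesis
    by (auto simp: Q_box_def ball_Basis_pair const_pair_def inner_axis)
qed

text \<open>
  Boxes with nonempty interior satisfy the condition \<open>star\<close> of \<open>vanishing_on_support\<close>.
\<close>

lemma box_interior_dilation:
  fixes \<rho> :: "'a::euclidean_space"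
  assumes \<rho>: "\<And>e. e \<in> Basis \<Longrightarrow> 0 < \<rho> \<bullet> e" and t: "0 < t" "t < 1"
  shows "{w. \<forall>e\<in>Basis. \<bar>w \<bullet> e\<bar> \<le> \<rho> \<bullet> e} \<subseteq> interior ((\<lambda>x. t *\<^sub>R x) -` {w. \<forall>e\<in>Basis. \<bar>w \<bullet> e\<bar> \<le> \<rho> \<bullet> e})"
proof -
  let ?U = "\<Inter>e\<in>Basis. {w. \<bar>t * (w \<bullet> e)\<bar> < \<rho> \<bullet> e}"
  have op: "open ?U"
    by (intro open_INT finite_Basis ballI open_Collect_less continuous_intros)
  have "?U \<subseteq> (\<lambda>x. t *\<^sub>R x) -` {w. \<forall>e\<in>Basis. \<bar>w \<bullet> e\<bar> \<le> \<rho> \<bullet> e}"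
    by (auto intro: less_imp_le)
  then have "?U \<subseteq> interior ((\<lambda>x. t *\<^sub>R x) -` {w. \<forall>e\<in>Basis. \<bar>w \<bullet> e\<bar> \<le> \<rho> \<bullet> e})"
    by (rule interior_maximal[OF _ op])
  moreover have "w \<in> ?U" if w: "\<forall>e\<in>Basis. \<bar>w \<bullet> e\<bar> \<le> \<rho> \<bullet> e" for w
  proof clarsimp
    fix e :: 'a assume e: "e \<in> Basis"
    have "\<bar>t * (w \<bullet> e)\<bar> = t * \<bar>w \<bullet> e\<bar>" using t by (simp add: abs_mult)
    also have "\<dots> \<le> t * (\<rho> \<bullet> e)" using w e t by (intro mult_left_mono) auto
    also have "\<dots> < 1 * (\<rho> \<bullet> e)" using t \<rho>[OF e] by (intro mult_strict_right_mono) auto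
    finally show "\<bar>t * (w \<bullet> e)\<bar> < \<rho> \<bullet> e" by simp
  qed
  ultimately show ?thesis by (intro subsetI) (unfold mem_Collect_eq, rule subsetD)
qed

section \<open>The sampling expansion\<close>

text \<open>
  The first statement makes the Fourier series with coefficients \<open>c\<close> smooth with bounded derivatives.
  The second one, for the negative of its tails, makes it converge together with all derivatives.
\<close>

lemma grid_moments_in:
  fixes s :: "'a::euclidean_space"
  assumes s: "\<And>b. b \<in> Basis \<Longrightarrow> 0 < s \<bullet> b" and c: "schwartz c"
  shows "moments_in const_bounds (count_space (grid s)) (\<lambda>l. (2 * pi) *\<^sub>R l) (\<lambda>_::unit. c)"
    and "moments_in (null_bounds (finite_subsets_at_top (grid s))) (count_space (grid s)) (\<lambda>l. (2 * pi) *\<^sub>R l)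
      (\<lambda>F l. if l \<in> F then 0 else - c l)"
proof -
  let ?G = "count_space (grid s)"
  have int: "integrable ?G (\<lambda>l. norm ((2 * pi) *\<^sub>R l) ^ k * cmod (c l))" for k
    by (rule grid_moments[OF s c])
  show "moments_in const_bounds ?G (\<lambda>l. (2 * pi) *\<^sub>R l) (\<lambda>_::unit. c)"
    unfolding moments_in_def
  proof (intro conjI allI)
    fix k
    show "\<exists>B\<in>const_bounds. \<forall>i::unit. integrable ?G (\<lambda>l. norm ((2 * pi) *\<^sub>R l) ^ k * cmod (c l)) \<and>
        (LINT l|?G. norm ((2 * pi) *\<^sub>R l) ^ k * cmod (c l)) \<le> B i"
      by (rule bexI[of _ "\<lambda>_. LINT l|?G. norm ((2 * pi) *\<^sub>R l) ^ k * cmod (c l)"])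
        (use int in \<open>auto simp: const_bounds_def\<close>)
  qed simp
  show "moments_in (null_bounds (finite_subsets_at_top (grid s))) ?G (\<lambda>l. (2 * pi) *\<^sub>R l)
      (\<lambda>F l. if l \<in> F then 0 else - c l)"
    unfolding moments_in_def
  proof (intro conjI allI)
    fix k
    let ?m = "\<lambda>l. norm ((2 * pi) *\<^sub>R l) ^ k * cmod (c l)"
    have eq: "norm ((2 * pi) *\<^sub>R l) ^ k * cmod (if l \<in> F then 0 else - c l) = (if l \<in> F then 0 else ?m l)" for l F
      by simp
    have i: "integrable ?G (\<lambda>l. if l \<in> F then 0 else ?m l)" for F
      by (rule Bochner_Integration.integrable_bound[OF int[of k]]) auto
    show "\<exists>B\<in>null_bounds (finite_subsets_at_top (grid s)). \<forall>F.
        integrable ?G (\<lambda>l. norm ((2 * pi) *\<^sub>R l) ^ k * cmod (if l \<in> F then 0 else - c l)) \<and>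
        (LINT l|?G. norm ((2 * pi) *\<^sub>R l) ^ k * cmod (if l \<in> F then 0 else - c l)) \<le> B F"
      unfolding eq
      by (rule bexI[of _ "\<lambda>F. LINT l|?G. (if l \<in> F then 0 else ?m l)"])
        (use i in \<open>auto intro!: null_boundsI integral_complement_tendsto_0 int\<close>)
  qed simp
qed

lemma osc_partial_sum:
  fixes s :: "'a::euclidean_space"
  assumes s: "\<And>b. b \<in> Basis \<Longrightarrow> 0 < s \<bullet> b" and c: "schwartz c" and F: "finite F" "F \<subseteq> grid s"
  shows "osc (count_space (grid s)) (\<lambda>l. (2 * pi) *\<^sub>R l) c w
    + osc (count_space (grid s)) (\<lambda>l. (2 * pi) *\<^sub>R l) (\<lambda>l. if l \<in> F then 0 else - c l) w
    = (\<Sum>l\<in>F. c l * cis (2 * pi * (l \<bullet> w)))"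
proof -
  let ?G = "count_space (grid s)" and ?e = "\<lambda>l. cis (w \<bullet> (2 * pi) *\<^sub>R l)"
  have "integrable ?G c"
    by (rule integrable_norm_cancel) (use grid_moments[OF s c, of 0] in simp_all)
  then have i: "integrable ?G (\<lambda>l. d l * ?e l)" if "\<And>l. cmod (d l) \<le> cmod (c l)" for d
    by (rule Bochner_Integration.integrable_bound) (use that in \<open>auto simp: norm_mult\<close>)
  have "osc ?G (\<lambda>l. (2 * pi) *\<^sub>R l) c w + osc ?G (\<lambda>l. (2 * pi) *\<^sub>R l) (\<lambda>l. if l \<in> F then 0 else - c l) w
    = (LINT l|?G. c l * ?e l + (if l \<in> F then 0 else - c l) * ?e l)"
    unfolding osc_def by (intro Bochner_Integration.integral_add[symmetric] i) auto
  also have "\<dots> = (LINT l|?G. (if l \<in> F then c l * ?e l else 0))"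
    by (intro Bochner_Integration.integral_cong refl) auto
  also have "\<dots> = (\<Sum>l\<in>F. (if l \<in> F then c l * ?e l else 0))"
    by (rule integral_count_space_supported) (use F in auto)
  also have "\<dots> = (\<Sum>l\<in>F. c l * cis (2 * pi * (l \<bullet> w)))"
    by (intro sum.cong refl) (simp add: inner_commute)
  finally show ?thesis .
qed

text \<open>
  The sampling theorem without reference to pseudodifferential operators. The hypothesis \<open>inv\<close> says that
  \<open>\<Phi>\<close> inverts the Fourier multiplier \<open>\<F>\<inverse>S\<close> on \<open>K\<close>, and \<open>inner\<close> together with \<open>out\<close> is the
  band limitation that rules out aliasing.
\<close>

theorem sampling_expansion:
  fixes s :: "'a::euclidean_space" and \<sigma> :: "'a functional" and S f \<Phi> :: "'a \<Rightarrow> complex"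
  assumes s: "\<And>b. b \<in> Basis \<Longrightarrow> 0 < s \<bullet> b"
    and \<sigma>: "tempered_distribution \<sigma>" and S: "schwartz S" and f: "schwartz f" and \<Phi>: "schwartz \<Phi>"
    and supp: "distr_support (fourier_distr \<sigma>) \<subseteq> K"
    and star: "\<And>t. 0 < t \<Longrightarrow> t < 1 \<Longrightarrow> K \<subseteq> interior ((\<lambda>x. t *\<^sub>R x) -` K)"
    and inner: "\<And>w b. w \<in> K \<Longrightarrow> b \<in> Basis \<Longrightarrow> \<bar>w \<bullet> b\<bar> < 1 / (2 * (s \<bullet> b))"
    and out: "\<And>w. w \<notin> cell s \<Longrightarrow> \<Phi> w = 0"
    and inv: "\<And>w. w \<in> K \<Longrightarrow> inverse_fourier S w * \<Phi> w = 1"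
  shows "((\<lambda>l. of_real (\<Prod>b\<in>Basis. s \<bullet> b) * \<sigma> (translate l S) * distr_of (translate l (inverse_fourier \<Phi>)) f)
    has_sum \<sigma> f) (grid s)"
proof -
  define u where "u = fourier_distr \<sigma>"
  define E where "E = inverse_fourier S"
  define h where "h = inverse_fourier f"
  define c where "c l = of_real (\<Prod>b\<in>Basis. s \<bullet> b) * fourier (\<lambda>w. \<Phi> w * h w) l" for l
  have E: "schwartz E" and h: "schwartz h"
    unfolding E_def h_def by (intro schwartz_inverse_fourier S f)+
  have \<Phi>h: "schwartz (\<lambda>w. \<Phi> w * h w)"
    by (intro schwartz_mult_bounded \<Phi> schwartz_imp_unif h)
  have c: "schwartz c"
    unfolding c_def by (intro schwartz_cmult schwartz_fourier \<Phi>h)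
  have u: "seq_tempered u" unfolding u_def by (rule fourier_distr_seq_tempered[OF \<sigma>])
  then have lin: "schwartz_linear u" by (simp add: seq_tempered_def)
  let ?G = "count_space (grid s)" and ?\<theta> = "\<lambda>l. (2 * pi) *\<^sub>R l"
  let ?T = "finite_subsets_at_top (grid s)"
  define p where "p = osc ?G ?\<theta> c"
  \<comment> \<open>\<open>p + q F\<close> is the partial sum over \<open>F\<close>.\<close>
  define q where "q F = osc ?G ?\<theta> (\<lambda>l. if l \<in> F then 0 else - c l)" for F
  define v where "v w = E w * p w" for w
  have v: "schwartz v"
    unfolding v_def p_def
    by (intro schwartz_mult_bounded E osc_reg[where f="\<lambda>_::unit. c"] grid_moments_in(1) s c) auto
  have fam: "schwartz_family (null_bounds ?T) (\<lambda>F w. E w * q F w)"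
    unfolding q_def
    by (intro schwartz_family_mult bound_class_null E osc_reg grid_moments_in(2) s c) auto
  have coeff: "of_real (\<Prod>b\<in>Basis. s \<bullet> b) * \<sigma> (translate l S) * distr_of (translate l (inverse_fourier \<Phi>)) f
      = c l * u (\<lambda>w. E w * cis (2 * pi * (l \<bullet> w)))" for l
  proof -
    have "fourier (\<lambda>w. E w * cis (2 * pi * (l \<bullet> w))) = translate l S"
      by (simp add: fun_eq_iff fourier_modulate translate_def E_def fourier_inverse_fourier[OF S])
    then have "u (\<lambda>w. E w * cis (2 * pi * (l \<bullet> w))) = \<sigma> (translate l S)"
      by (simp add: u_def fourier_distr_def)
    then show ?thesis
      by (simp add: c_def pairing_translate_inverse_fourier[OF \<Phi> f] h_def)
  qed
  have modul: "schwartz (\<lambda>w. E w * cis (2 * pi * (l \<bullet> w)))" for l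
  proof -
    \<comment> \<open>A single exponential is an oscillatory integral over a one-point space.\<close>
    have "moments_in const_bounds (count_space {()}) (\<lambda>_. (2 * pi) *\<^sub>R l) (\<lambda>(_::unit) _. 1)"
      unfolding moments_in_def
      by (auto simp: integrable_count_space lebesgue_integral_count_space_finite const_bounds_def)
    then have "reg (unif const_bounds) n (\<lambda>_::unit. osc (count_space {()}) (\<lambda>_. (2 * pi) *\<^sub>R l) (\<lambda>_. 1))" for n
      by (intro osc_reg) auto
    moreover have "osc (count_space {()}) (\<lambda>_. (2 * pi) *\<^sub>R l) (\<lambda>_. 1) = (\<lambda>w. cis (2 * pi * (l \<bullet> w)))"
      by (simp add: osc_def fun_eq_iff lebesgue_integral_count_space_finite inner_commute)
    ultimately show ?thesis by (intro schwartz_mult_bounded E) simp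
  qed
  have partial: "(\<Sum>l\<in>F. c l * u (\<lambda>w. E w * cis (2 * pi * (l \<bullet> w)))) = u (\<lambda>w. v w + E w * q F w)"
    if F: "finite F" "F \<subseteq> grid s" for F
  proof -
    have "(\<Sum>l\<in>F. c l * u (\<lambda>w. E w * cis (2 * pi * (l \<bullet> w)))) = (\<Sum>l\<in>F. u (\<lambda>w. c l * (E w * cis (2 * pi * (l \<bullet> w)))))"
      by (simp add: schwartz_linear_cmult[OF lin modul])
    also have "\<dots> = u (\<lambda>w. \<Sum>l\<in>F. c l * (E w * cis (2 * pi * (l \<bullet> w))))"
      by (intro schwartz_linear_sum[OF lin, symmetric] schwartz_cmult modul)
    also have "(\<lambda>w. \<Sum>l\<in>F. c l * (E w * cis (2 * pi * (l \<bullet> w)))) = (\<lambda>w. v w + E w * q F w)"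
      using osc_partial_sum[OF s c F]
      by (simp add: v_def p_def q_def fun_eq_iff distrib_left[symmetric] sum_distrib_left mult_ac)
    finally show ?thesis .
  qed
  have "schwartz_family (null_bounds ?T) (\<lambda>F w. (v w + E w * q F w) - v w)"
    using fam by simp
  then have "((\<lambda>F. \<sigma> (fourier (\<lambda>w. v w + E w * q F w))) \<longlongrightarrow> \<sigma> (fourier v)) ?T"
    by (intro tempered_tendsto[OF \<sigma>] schwartz_fourier v fourier_family_diff)
  then have lim: "((\<lambda>F. u (\<lambda>w. v w + E w * q F w)) \<longlongrightarrow> u v) ?T"
    by (simp add: u_def fourier_distr_def)
  have "u (\<lambda>w. v w - h w) = 0"
  proof (rule vanishing_on_support[OF u _ supp[folded u_def] _ star])
    show "schwartz (\<lambda>w. v w - h w)" by (intro schwartz_diff v h)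
    fix w assume w: "w \<in> K"
    have "p w = \<Phi> w * h w"
      unfolding p_def c_def
      by (rule fourier_series[OF s inner[OF w] \<Phi>h]) (auto simp: out)
    then show "v w - h w = 0"
      using inv[OF w] by (simp add: v_def E_def mult.assoc[symmetric])
  qed auto
  then have "u v = u h" using schwartz_linear_diff[OF lin v h] by simp
  also have "u h = \<sigma> f" by (simp add: u_def fourier_distr_def h_def fourier_inverse_fourier[OF f])
  finally have uv: "u v = \<sigma> f" .
  have "((\<lambda>F. \<Sum>l\<in>F. c l * u (\<lambda>w. E w * cis (2 * pi * (l \<bullet> w)))) \<longlongrightarrow> \<sigma> f) ?T"
    using lim unfolding uv
    by (rule Lim_transform_eventually) (rule eventually_finite_subsets_at_top_weakI, simp add: partial)
  then show ?thesis unfolding coeff has_sum_def .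
qed

theorem proposition3p4:
  fixes a b \<epsilon> :: real
    and \<sigma> :: "((real ^ 'd) \<times> (real ^ 'd)) functional"
    and g :: "real ^ 'd \<Rightarrow> complex"
    and \<phi> :: "(real ^ 'd) \<times> (real ^ 'd) \<Rightarrow> complex"
  assumes "0 < a" and "0 < b" and "0 < \<epsilon>"
    and "\<epsilon> \<noteq> 1 / (2 * a)" and "\<epsilon> \<noteq> 1 / (2 * b)"
    and "tempered_distribution \<sigma>"
    and "distr_support (fourier_distr \<sigma>) \<subseteq> Q_box a b \<epsilon>"
    and "schwartz g"
    and "test_function \<phi>"
    and "\<And>z. z \<in> Q_box a b \<epsilon> \<Longrightarrow> \<phi> z = 1"
    and "fun_support \<phi> \<subseteq> Q_box a b 0"
    and "\<And>z. z \<in> fun_support \<phi> \<Longrightarrow> cnj (flip_map (stft g g) z) \<noteq> 0"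
  shows "has_distr_sum
    (\<lambda>l f. complex_of_real ((a * b) ^ CARD('d)) *
      bracket (kohn_nirenberg \<sigma> (tf_shift l g)) (tf_shift l g) *
      distr_of (translate l
        (inverse_fourier (support_quotient \<phi> (\<lambda>z. cnj (flip_map (stft g g) z))))) f)
    \<sigma> (lattice a b)"
proof -
  note a = \<open>0 < a\<close> and b = \<open>0 < b\<close> and g = \<open>schwartz g\<close> and \<phi> = \<open>test_function \<phi>\<close>
  let ?s = "const_pair a b :: (real ^ 'd) \<times> (real ^ 'd)"
  let ?K = "Q_box a b \<epsilon> :: ((real ^ 'd) \<times> (real ^ 'd)) set"
  define S where "S z = cnj (rihaczek g g z)" for z
  have S: "schwartz S" unfolding S_def by (intro schwartz_cnj rihaczek_schwartz g)
  have E: "cnj (flip_map (stft g g) z) = inverse_fourier S z" for z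
    unfolding fourier_rihaczek[OF g g, symmetric] cnj_fourier S_def ..
  define \<Phi> where "\<Phi> z = \<phi> z / inverse_fourier S z" for z
  have \<Phi>_eq: "support_quotient \<phi> (\<lambda>z. cnj (flip_map (stft g g) z)) = \<Phi>"
    by (auto simp: support_quotient_def \<Phi>_def E fun_support_zero)
  have nz: "inverse_fourier S z \<noteq> 0" if "z \<in> fun_support \<phi>" for z
    using assms(12)[OF that] by (simp add: E)
  have \<Phi>: "schwartz \<Phi>"
    unfolding \<Phi>_def
    by (intro test_function_imp_schwartz test_function_quotient \<phi> schwartz_imp_smooth schwartz_inverse_fourier S nz)
  have H: "bracket (kohn_nirenberg \<sigma> (tf_shift l g)) (tf_shift l g) = \<sigma> (translate l S)" for l
    by (simp only: bracket_kohn_nirenberg rihaczek_tf_shift[OF g]) (simp add: bracket_def translate_def[abs_def] S_def)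
  have cell: "cell ?s = Q_box a b 0"
    by (auto simp: cell_def Q_box_eq ball_Basis_pair const_pair_def inner_axis)
  have "((\<lambda>l. of_real (\<Prod>e\<in>Basis. ?s \<bullet> e) * \<sigma> (translate l S) * distr_of (translate l (inverse_fourier \<Phi>)) f)
      has_sum \<sigma> f) (grid ?s)" if f: "schwartz f" for f
  proof (rule sampling_expansion[where K="?K"])
    show "0 < ?s \<bullet> e" if "e \<in> Basis" for e by (rule const_pair_pos[OF a b that])
    show "\<bar>w \<bullet> e\<bar> < 1 / (2 * (?s \<bullet> e))" if "w \<in> ?K" "e \<in> Basis" for w e
      using that(2)
    proof (rule Basis_pair_cases)
      fix i assume e: "e = (axis i 1, 0)"
      have "\<bar>w \<bullet> e\<bar> \<le> 1 / (2 * a) - \<epsilon>" "?s \<bullet> e = a"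
        using that(1) by (auto simp: e Q_box_eq ball_Basis_pair const_pair_def inner_axis)
      then show ?thesis using \<open>0 < \<epsilon>\<close> by simp
    next
      fix i assume e: "e = (0, axis i 1)"
      have "\<bar>w \<bullet> e\<bar> \<le> 1 / (2 * b) - \<epsilon>" "?s \<bullet> e = b"
        using that(1) by (auto simp: e Q_box_eq ball_Basis_pair const_pair_def inner_axis)
      then show ?thesis using \<open>0 < \<epsilon>\<close> by simp
    qed
    \<comment> \<open>The box may be empty; otherwise it has nonempty interior, since \<open>\<epsilon>\<close> is neither
      \<open>1 / (2 * a)\<close> nor \<open>1 / (2 * b)\<close>.\<close>
    show "?K \<subseteq> interior ((\<lambda>x. t *\<^sub>R x) -` ?K)" if t: "0 < t" "t < 1" for t
    proof (cases "?K = {}")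
      case False
      then obtain w where w: "w \<in> ?K" by blast
      have pos: "0 \<le> 1 / (2 * a) - \<epsilon>" "0 \<le> 1 / (2 * b) - \<epsilon>"
        using w abs_ge_zero order_trans unfolding Q_box_eq mem_Collect_eq ball_Basis_pair
        by (auto simp: const_pair_def inner_axis)
      then have "0 < 1 / (2 * a) - \<epsilon>" "0 < 1 / (2 * b) - \<epsilon>"
        using assms(4,5) by linarith+
      then show ?thesis
        unfolding Q_box_eq by (intro box_interior_dilation t const_pair_pos)
    qed simp
    show "\<Phi> w = 0" if "w \<notin> cell ?s" for w
      using that assms(11) fun_support_zero[of w \<phi>] by (auto simp: cell \<Phi>_def)
    show "inverse_fourier S w * \<Phi> w = 1" if "w \<in> ?K" for w
    proof -
      have "\<phi> w = 1" by (rule assms(10)[OF that])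
      moreover from this have "inverse_fourier S w \<noteq> 0"
        using fun_support_zero[of w \<phi>] by (intro nz) auto
      ultimately show ?thesis by (simp add: \<Phi>_def)
    qed
  qed (use assms S f \<Phi> in auto)
  then show ?thesis
    unfolding has_distr_sum_def H \<Phi>_eq lattice_eq_grid[OF a b] prod_const_pair by blast
qed

end
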